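(* Let $\mathfrak b$ be a nonzero fractional ideal of $A_{\infty_1}$ whose ideal class is different from the class of $\mathfrak a_i$ for every $i=0,\dots,d-1$. Then $\mathsf N(j(\mathfrak b))\neq\mathsf N(j((1)))$, where for a nonzero fractional ideal $\mathfrak c$ one sets $\mathsf N(j(\mathfrak c))=\prod_{i=0}^{d-1}j(\mathfrak c\,\mathfrak a_i)$.
   Context: Let $q$ be a prime power, $k=\mathbb F_q(T)$, $A=\mathbb F_q[T]$, $k_\infty=\mathbb F_q((1/T))$ with $|x|=q^{\deg_T x}$. Let $f\in k_\infty\setminus k$ be a root of $X^2-aX-b$ with $a\in A$ monic, $d=\deg_T a\ge1$, $b\in\mathbb F_q^*$, $|f|=q^d$. Let $K=k(f)\subset k_\infty$, $\infty_1$ the place of $K$ induced by this embedding, and $A_{\infty_1}=\mathbb F_q[f,fT,\dots,fT^{d-1}]$ the ring of elements of $K$ regular away from $\infty_1$. For $0\le i\le d-1$, $\mathfrak a_i=(f,fT,\dots,fT^i)\subset A_{\infty_1}$. For a nonzero fractional ideal $\mathfrak c\subset K$ let $S_{\mathfrak c}(m)=\sum_{0\neq x\in\mathfrak c}x^{-m}$ and $j(\mathfrak c)=\Big(\frac1{T^q-T}+\frac{T^{q^2}-T}{(T^q-T)^{q+1}}\cdot\frac{S_{\mathfrak c}(q^2-1)}{S_{\mathfrak c}(q-1)^{q+1}}\Big)^{-1}$; this depends only on the ideal class of $\mathfrak c$, and for integral $\mathfrak c$ equals $\big(\frac1{T^q-T}-J(\mathfrak c)\big)^{-1}$ with $J(\mathfrak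 c)=\frac{T^{q^2}-T}{(T^q-T)^{q+1}}\frac{\zeta^{\mathfrak c}(q^2-1)}{\zeta^{\mathfrak c}(q-1)^{q+1}}$, $\zeta^{\mathfrak c}(n(q-1))=\sum_{0\ne x\in\mathfrak c\text{ monic}}x^{n(1-q)}$, where $x\in A_{\infty_1}$ is monic if it can be written $c_0+c_1(T)f+\dots+c_k(T)f^k$ with $c_0\in\mathbb F_q$, $\deg c_i\le d-1$ for $i\ge1$, $c_k$ monic. *)

theory Defs
  imports "HOL-Analysis.Analysis" "HOL-Computational_Algebra.Formal_Laurent_Series"
begin

text \<open>k_infinity = F_q((1/T)) is modelled as 'a fls (Laurent series in X = 1/T) over a
finite field 'a (q = CARD('a)); T is fls_X_inv. The absolute value |x| = q^(deg_T x)
corresponds to deg_T x = - fls_subdegree x, and the fls metric induces the same topology.\<close>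

definition Tx :: "'a::field fls" where
  "Tx = fls_X_inv"

definition polyA :: "'a::field poly \<Rightarrow> 'a fls" where
  "polyA p = poly (map_poly fls_const p) Tx"

definition Aset :: "'a::field fls set" where
  "Aset = range polyA"

definition kset :: "'a::field fls set" where
  "kset = {x / y | x y. x \<in> Aset \<and> y \<in> Aset \<and> y \<noteq> 0}"

text \<open>K = k(f) = k + k f (f is quadratic over k).\<close>
definition Kset :: "'a::field fls \<Rightarrow> 'a fls set" where
  "Kset f = {u + v * f | u v. u \<in> kset \<and> v \<in> kset}"

inductive_set Ainf1 :: "'a::field fls \<Rightarrow> nat \<Rightarrow> 'a fls set" for f d where
  const: "fls_const c \<in> Ainf1 f d"
| gen: "i < d \<Longrightarrow> f * Tx ^ i \<in> Ainf1 f d"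
| add: "x \<in> Ainf1 f d \<Longrightarrow> y \<in> Ainf1 f d \<Longrightarrow> x + y \<in> Ainf1 f d"
| mult: "x \<in> Ainf1 f d \<Longrightarrow> y \<in> Ainf1 f d \<Longrightarrow> x * y \<in> Ainf1 f d"
| neg: "x \<in> Ainf1 f d \<Longrightarrow> - x \<in> Ainf1 f d"

definition frac_ideal :: "'a::field fls \<Rightarrow> nat \<Rightarrow> 'a fls set \<Rightarrow> bool" where
  "frac_ideal f d c \<longleftrightarrow>
     c \<subseteq> Kset f \<and> 0 \<in> c \<and> c \<noteq> {0} \<and>
     (\<forall>x\<in>c. \<forall>y\<in>c. x + y \<in> c) \<and>
     (\<forall>r\<in>Ainf1 f d. \<forall>x\<in>c. r * x \<in> c) \<and>
     (\<exists>e\<in>Ainf1 f d. e \<noteq> 0 \<and> (\<forall>x\<in>c. e * x \<in> Ainf1 f d))"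

definition same_class :: "'a::field fls \<Rightarrow> 'a fls set \<Rightarrow> 'a fls set \<Rightarrow> bool" where
  "same_class f c c' \<longleftrightarrow> (\<exists>l\<in>Kset f. l \<noteq> 0 \<and> c' = (\<lambda>x. l * x) ` c)"

inductive_set ideal_mult :: "'a::field fls set \<Rightarrow> 'a fls set \<Rightarrow> 'a fls set" for I J where
  prod: "x \<in> I \<Longrightarrow> y \<in> J \<Longrightarrow> x * y \<in> ideal_mult I J"
| add: "u \<in> ideal_mult I J \<Longrightarrow> v \<in> ideal_mult I J \<Longrightarrow> u + v \<in> ideal_mult I J"

definition a_ideal :: "'a::field fls \<Rightarrow> nat \<Rightarrow> nat \<Rightarrow> 'a fls set" where
  "a_ideal f d i = {(\<Sum>j\<le>i. r j * (f * Tx ^ j)) | r. \<forall>j\<le>i. r j \<in> Ainf1 f d}"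

definition Ssum :: "'a::field fls set \<Rightarrow> nat \<Rightarrow> 'a fls" where
  "Ssum c m = infsum (\<lambda>x. inverse (x ^ m)) (c - {0})"

definition jinv :: "'a::{finite,field} fls set \<Rightarrow> 'a fls" where
  "jinv c = (let q = CARD('a) in
     inverse (inverse (Tx ^ q - Tx)
       + (Tx ^ (q ^ 2) - Tx) / (Tx ^ q - Tx) ^ (q + 1)
         * (Ssum c (q ^ 2 - 1) / (Ssum c (q - 1)) ^ (q + 1))))"

definition normj :: "'a::{finite,field} fls \<Rightarrow> nat \<Rightarrow> 'a fls set \<Rightarrow> 'a fls" where
  "normj f d c = (\<Prod>i<d. jinv (ideal_mult c (a_ideal f d i)))"

end

theory Submission
  imports Defs
begin

text \<open>
  The size of the invariant of an ideal class can be read off exactly from a lattice in the class.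
  Normalise a lattice \<open>L\<close> so that \<open>1\<close> is a shortest element, let \<open>exp_fun L\<close> be its exponential
  function, and let \<open>M\<close> be the subspace of all \<open>x \<in> L\<close> with \<open>T x \<in> L\<close>, which has codimension one.
  If \<open>\<lambda> \<in> L - M\<close>, then up to a factor of known size the reciprocal of the invariant equals
  \<open>exp_fun L (T \<lambda>) / exp_fun M \<lambda> ^ q\<^sup>2\<close>. If \<open>1, T, \<dots>, T\<^sup>m\<close> lie in \<open>L\<close> and \<open>T\<^bsup>m+1\<^esup>\<close> does not,
  one takes \<open>\<lambda> = T\<^sup>m\<close>; then \<open>\<bar>exp_fun M \<lambda>\<bar>\<close> depends on \<open>m\<close> only, while \<open>\<bar>exp_fun L (T \<lambda>)\<bar>\<close> is at
  least \<open>q\<^bsup>-d\<^esup>\<close>, because \<open>f\<close> times the distance vector from \<open>T\<^bsup>m+1\<^esup>\<close> to \<open>L\<close> is a nonzero element of \<open>L\<close>.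

  Up to scaling, the \<open>d\<close> ideals in the norm are \<open>\<bb>, \<bb>(1,T), \<dots>, \<bb>(1,T)\<^bsup>d-1\<^esup>\<close>, and multiplying
  by \<open>(1,T)\<close> either raises \<open>m\<close> by one or resets it to \<open>0\<close>. Since \<open>(1,T)\<^sup>d\<close> is principal, this gives
  a cyclic sequence of ascending runs of total length \<open>d\<close>. A single run of length \<open>d\<close> occurs exactly
  for the excluded classes; for all other classes the absolute value of the norm is strictly smaller.
\<close>


section \<open>Finite fields and the Frobenius map\<close>

text \<open>The two terms in the denominator of j have equal size and cancel to leading order, so no
  termwise estimate gives |j|. With e1, e2 the coefficients of z^q and z^(q^2) in the exponential
  function, the denominator equals Delta / ((T^q - T) e1)^(q+1), where Delta = (T^(q^2) - T) e2 -
  (T^q - T) e1^(q+1). This is the formula for the discriminant of a Drinfeld module of rank two,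
  used formally: the lattices here are not stable under T. Delta is a limit; its size comes from
  truncations whose absolute value is eventually constant and nonzero. For the final comparison put
  G_m = q + q^2 + ... + q^m. A run contributes q^2 (G_0 + G_1 + ...) to the exponent of the norm,
  and breaking the run of length d loses at least q^2 G_(d-1). Using only an upper bound for each
  factor of the general class costs at most d per factor, d^2 in total. Together with the exact
  corrections in the norm of (1) this stays below q^2 G_(d-1), since G grows geometrically.\<close>

lemma finite_field_power_card:
  fixes c :: "'a::{finite,field}"
  shows "c ^ CARD('a) = c"
proof (cases "c = 0")
  case True
  then show ?thesis by (simp add: zero_power)
next
  case False
  have "inj_on ((*) c) (UNIV - {0})" using False by (auto simp: inj_on_def)
  moreover have "(*) c ` (UNIV - {0}) = UNIV - {0}"
    using False by (intro endo_inj_surj) (auto simp: inj_on_def)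
  ultimately have "prod (\<lambda>x. x) (UNIV - {0}) = (\<Prod>x\<in>UNIV - {0}. c * x)"
    using prod.reindex[of "(*) c" "UNIV - {0}" "\<lambda>x. x"] by (simp add: o_def)
  also have "\<dots> = c ^ (CARD('a) - 1) * prod (\<lambda>x. x) (UNIV - {0})"
    by (simp add: prod.distrib card_Diff_singleton)
  finally have "c ^ (CARD('a) - 1) = 1" by (simp add: prod_zero_iff)
  moreover have "CARD('a) = Suc (CARD('a) - 1)" by (simp add: zero_less_card_finite)
  ultimately show ?thesis by (metis mult.right_neutral power_Suc)
qed

lemma card_finite_field_ge2: "CARD('a::{finite,field}) \<ge> 2"
proof -
  have "card {0, 1 :: 'a} \<le> CARD('a)" by (intro card_mono) auto
  then show ?thesis by simp
qed

lemma finite_field_power_card_minus_1: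
  fixes c :: "'a::{finite,field}"
  assumes "c \<noteq> 0"
  shows "c ^ (CARD('a) - 1) = 1"
proof -
  have "c * c ^ (CARD('a) - 1) = c * 1"
    using finite_field_power_card[of c] card_finite_field_ge2[where 'a='a]
    by (metis One_nat_def Suc_pred' mult.right_neutral power_Suc zero_less_card_finite)
  then show ?thesis using assms by simp
qed

text \<open>The polynomial (X + 1)^q - X^q - 1 has degree below q and vanishes at all q elements of
  the field, so it is zero; its coefficients are the inner binomials. Additivity of the q-th power
  map thus comes directly from the cardinality.\<close>

lemma of_nat_choose_card_eq_0:
  assumes "0 < i" "i < CARD('a::{finite,field})"
  shows "of_nat (CARD('a) choose i) = (0::'a)"
proof -
  let ?q = "CARD('a)"
  let ?p = "\<Sum>k = 1..<?q. monom (of_nat (?q choose k)) k :: 'a poly"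
  have v: "poly ?p x = 0" for x :: 'a
  proof -
    have "(x + 1) ^ ?q = (\<Sum>k\<le>?q. of_nat (?q choose k) * x ^ k)"
      by (subst binomial_ring) simp
    also have "{..?q} = insert 0 (insert ?q {1..<?q})" by auto
    also have "(\<Sum>k\<in>insert 0 (insert ?q {1..<?q}). of_nat (?q choose k) * x ^ k)
        = 1 + (x ^ ?q + poly ?p x)"
      by (simp add: poly_sum poly_monom)
    finally show ?thesis by (simp add: finite_field_power_card)
  qed
  have "degree ?p < ?q"
    using card_finite_field_ge2[where 'a='a]
    by (intro order.strict_trans1[OF degree_sum_le[where n="?q - 1"]])
       (auto intro!: order.trans[OF degree_monom_le])
  have "?p = 0"
  proof (rule ccontr)
    assume "?p \<noteq> 0"
    then have "card {x. poly ?p x = 0} \<le> degree ?p" by (rule card_poly_roots_bound)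
    with v \<open>degree ?p < ?q\<close> show False by simp
  qed
  then have "coeff ?p i = 0" by simp
  then show ?thesis using assms by (simp add: coeff_sum sum.delta)
qed

lemma frobenius_add_aux:
  fixes x y :: "'b::comm_ring_1"
  assumes n: "n > 0" and z: "\<And>i. 0 < i \<Longrightarrow> i < n \<Longrightarrow> of_nat (n choose i) = (0::'b)"
  shows "(x + y) ^ n = x ^ n + y ^ n"
proof -
  have "(x + y) ^ n = (\<Sum>k\<le>n. of_nat (n choose k) * x ^ k * y ^ (n - k))"
    by (rule binomial_ring)
  also have "\<dots> = (\<Sum>k\<in>{0, n}. of_nat (n choose k) * x ^ k * y ^ (n - k))"
    by (rule sum.mono_neutral_right) (auto simp: z)
  finally show ?thesis using n by (simp add: add.commute)
qed

lemma of_nat_fls_const: "of_nat n = fls_const (of_nat n :: 'a::comm_ring_1)"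
  by (simp add: fls_of_nat)

lemma frobenius_fls_add:
  fixes x y :: "'a::{finite,field} fls"
  shows "(x + y) ^ CARD('a) = x ^ CARD('a) + y ^ CARD('a)"
  by (rule frobenius_add_aux)
     (simp_all add: of_nat_fls_const of_nat_choose_card_eq_0 zero_less_card_finite)

lemma frobenius_fls_minus:
  fixes x :: "'a::{finite,field} fls"
  shows "(- x) ^ CARD('a) = - (x ^ CARD('a))"
  using frobenius_fls_add[of x "- x"]
  by (simp add: zero_less_card_finite zero_power add_eq_0_iff)

lemma frobenius_fls_diff:
  fixes x y :: "'a::{finite,field} fls"
  shows "(x - y) ^ CARD('a) = x ^ CARD('a) - y ^ CARD('a)"
  using frobenius_fls_add[of x "- y"] by (simp add: frobenius_fls_minus)

lemma frobenius_fls_poly_add: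
  fixes x y :: "'a::{finite,field} fls poly"
  shows "(x + y) ^ CARD('a) = x ^ CARD('a) + y ^ CARD('a)"
  by (rule frobenius_add_aux)
     (simp_all add: of_nat_poly of_nat_fls_const of_nat_choose_card_eq_0 zero_less_card_finite)

lemma frobenius_fls_sum:
  fixes g :: "'i \<Rightarrow> 'a::{finite,field} fls"
  shows "(\<Sum>i\<in>A. g i) ^ CARD('a) = (\<Sum>i\<in>A. g i ^ CARD('a))"
  by (induction A rule: infinite_finite_induct)
     (auto simp: frobenius_fls_add zero_power zero_less_card_finite)

lemma fls_const_eq_iff [simp]: "fls_const x = fls_const y \<longleftrightarrow> x = y"
  by (metis fls_const_nth)

lemma fls_const_power_card:
  "(fls_const c :: 'a::{finite,field} fls) ^ CARD('a) = fls_const c"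
  by (simp add: fls_const_power[symmetric] finite_field_power_card)

lemma fls_const_power_card_minus_1:
  "c \<noteq> 0 \<Longrightarrow> (fls_const c :: 'a::{finite,field} fls) ^ (CARD('a) - 1) = 1"
  by (metis finite_field_power_card_minus_1 fls_const_power fls_const_1)

text \<open>As polynomials in \<open>y\<close> both sides have degree at most q - 1 and agree at 0
  and at the q - 1 nonzero constants, that is, at q points.\<close>

lemma prod_one_minus_over_units:
  fixes y :: "'a::{finite,field} fls"
  shows "(\<Prod>c\<in>UNIV - {0}. 1 - y / fls_const c) = 1 - y ^ (CARD('a) - 1)"
proof -
  let ?q = "CARD('a)"
  let ?U = "UNIV - {0} :: 'a set"
  let ?P = "\<Prod>c\<in>?U. [:1, - inverse (fls_const c):] :: 'a fls poly"
  let ?R = "1 - monom 1 (?q - 1) :: 'a fls poly"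
  have q: "?q \<ge> 2" by (rule card_finite_field_ge2)
  have cU: "card ?U = ?q - 1" by (simp add: card_Diff_singleton)
  have eq: "?P - ?R = 0"
  proof (rule ccontr)
    assume nz: "?P - ?R \<noteq> 0"
    let ?Z = "insert 0 (fls_const ` ?U) :: 'a fls set"
    have "card (fls_const ` ?U :: 'a fls set) = ?q - 1"
      using cU by (subst card_image) (auto simp: inj_on_def)
    then have "card ?Z = ?q"
      using q by (subst card_insert_disjoint) (auto simp: fls_const_nonzero)
    have "degree ?P \<le> (\<Sum>c\<in>?U. degree [:1, - inverse (fls_const c) :: 'a fls:])"
      using degree_prod_sum_le[of ?U "\<lambda>c. [:1, - inverse (fls_const c) :: 'a fls:]"] by (simp add: o_def)
    also have "\<dots> \<le> (\<Sum>c\<in>?U. 1)" by (intro sum_mono) simp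
    finally have "degree ?P \<le> ?q - 1" using cU by simp
    moreover have "degree ?R \<le> ?q - 1"
      by (intro degree_diff_le) (auto simp: degree_monom_le)
    ultimately have "degree (?P - ?R) \<le> ?q - 1" by (rule degree_diff_le)
    moreover have Zsub: "?Z \<subseteq> {x. poly (?P - ?R) x = 0}"
    proof -
      have "poly (?P - ?R) 0 = 0"
        using q by (simp add: poly_prod poly_monom zero_power)
      moreover have "poly (?P - ?R) (fls_const c) = 0" if "c \<noteq> 0" for c
      proof -
        have "(\<Prod>x\<in>?U. poly [:1, - inverse (fls_const x):] (fls_const c :: 'a fls)) = 0"
          using that by (auto simp: prod_zero_iff fls_const_nonzero intro!: bexI[of _ c])
        then show ?thesis
          using that by (simp only: poly_diff poly_prod) (simp add: poly_monom fls_const_power_card_minus_1[unfolded One_nat_def])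
      qed
      ultimately show ?thesis by auto
    qed
    moreover have "card {x. poly (?P - ?R) x = 0} \<le> degree (?P - ?R)"
      using nz by (rule card_poly_roots_bound)
    moreover have "card ?Z \<le> card {x. poly (?P - ?R) x = 0}"
      by (rule card_mono[OF poly_roots_finite[OF nz] Zsub])
    ultimately have "?q \<le> ?q - 1"
      using \<open>card ?Z = ?q\<close> by linarith
    then show False using q by simp
  qed
  then have "poly ?P y = poly ?R y" by simp
  then show ?thesis
    by (simp add: poly_prod poly_monom divide_inverse mult.commute)
qed

section \<open>The absolute value\<close>

definition absv :: "'a::{finite,field} fls \<Rightarrow> real" where
  "absv x = (if x = 0 then 0 else real CARD('a) powi (- fls_subdegree x))"

lemma card_real_gt_1: "real CARD('a::{finite,field}) > 1"
  using card_finite_field_ge2[where 'a='a] by simp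

lemma absv_0 [simp]: "absv 0 = 0" by (simp add: absv_def)

lemma absv_1 [simp]: "absv 1 = 1" by (simp add: absv_def)

lemma absv_pos: "x \<noteq> 0 \<Longrightarrow> absv x > 0"
  using card_real_gt_1[where 'a='a] by (simp add: absv_def zero_less_power_int)

lemma absv_nonneg [simp]: "absv x \<ge> 0"
  using absv_pos[of x] by (cases "x = 0") auto

lemma absv_eq_0_iff [simp]: "absv x = 0 \<longleftrightarrow> x = 0"
  using absv_pos[of x] by (cases "x = 0") auto

lemma absv_pos_iff [simp]: "absv x > 0 \<longleftrightarrow> x \<noteq> 0"
  using absv_pos[of x] by (cases "x = 0") auto

lemma absv_mult: "absv (x * y) = absv x * absv y"
  using card_real_gt_1[where 'a='a] by (auto simp: absv_def power_int_add[symmetric])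

lemma absv_minus [simp]: "absv (- x) = absv x" by (simp add: absv_def)

lemma absv_diff_commute: "absv (x - y) = absv (y - x)"
  by (metis absv_minus minus_diff_eq)

lemma absv_power: "absv (x ^ n) = absv x ^ n"
  by (induction n) (simp_all add: absv_mult)

lemma absv_inverse: "absv (inverse x) = inverse (absv x)"
proof (cases "x = 0")
  case False
  have "absv (inverse x) * absv x = 1" using False by (simp add: absv_mult[symmetric])
  then show ?thesis by (metis inverse_unique mult.commute)
qed simp

lemma absv_divide: "absv (x / y) = absv x / absv y"
  by (simp add: divide_inverse absv_mult absv_inverse)

lemma absv_prod: "absv (prod g A) = (\<Prod>i\<in>A. absv (g i))"
  by (induction A rule: infinite_finite_induct) (auto simp: absv_mult)

lemma absv_const [simp]: "c \<noteq> 0 \<Longrightarrow> absv (fls_const c) = 1"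
  by (simp add: absv_def fls_const_nonzero)

lemma absv_const_le: "absv (fls_const c) \<le> 1"
  by (cases "c = 0") auto

lemma absv_Tx [simp]: "absv (Tx :: 'a::{finite,field} fls) = real CARD('a)"
  by (simp add: absv_def Tx_def)

lemma Tx_nonzero [simp]: "(Tx :: 'a::{finite,field} fls) \<noteq> 0"
  by (simp add: Tx_def)

lemma absv_le_iff_subdegree:
  "x \<noteq> 0 \<Longrightarrow> y \<noteq> 0 \<Longrightarrow> absv x \<le> absv y \<longleftrightarrow> fls_subdegree y \<le> fls_subdegree x"
  for x y :: "'a::{finite,field} fls"
  using card_real_gt_1[where 'a='a]
    power_int_strict_increasing[of "- fls_subdegree y" "- fls_subdegree x" "real CARD('a)"]
    power_int_increasing[of "- fls_subdegree x" "- fls_subdegree y" "real CARD('a)"]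
  by (force simp: absv_def not_le[symmetric])

lemma absv_add_le: "absv (x + y) \<le> max (absv x) (absv y)"
proof (cases "x = 0 \<or> y = 0 \<or> x + y = 0")
  case True
  then show ?thesis by (auto simp: le_max_iff_disj)
next
  case False
  then have "min (fls_subdegree x) (fls_subdegree y) \<le> fls_subdegree (x + y)"
    by (intro fls_plus_subdegree) auto
  then show ?thesis
    using False by (auto simp: le_max_iff_disj absv_le_iff_subdegree min_le_iff_disj)
qed

lemma absv_diff_le: "absv (x - y) \<le> max (absv x) (absv y)"
  using absv_add_le[of x "- y"] by simp

lemma absv_add_eq_left: "absv y < absv x \<Longrightarrow> absv (x + y) = absv x"
proof (rule antisym)
  assume a: "absv y < absv x"
  show "absv (x + y) \<le> absv x" using absv_add_le[of x y] a by simp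
  have "absv x \<le> max (absv (x + y)) (absv y)" using absv_diff_le[of "x + y" y] by simp
  then show "absv x \<le> absv (x + y)" using a by (simp add: le_max_iff_disj)
qed

lemma absv_add_eq_right: "absv x < absv y \<Longrightarrow> absv (x + y) = absv y"
  using absv_add_eq_left[of x y] by (simp add: add.commute)

lemma absv_diff_eq_left: "absv y < absv x \<Longrightarrow> absv (x - y) = absv x"
  using absv_add_eq_left[of "- y" x] by simp

lemma absv_diff_eq_right: "absv x < absv y \<Longrightarrow> absv (x - y) = absv y"
  using absv_add_eq_right[of x "- y"] by simp

section \<open>Finite subspaces and their exponential polynomials\<close>

definition fq_subspace :: "'a::{finite,field} fls set \<Rightarrow> bool" where
  "fq_subspace V \<longleftrightarrow> 0 \<in> V \<and> (\<forall>x\<in>V. \<forall>y\<in>V. x + y \<in> V) \<and> (\<forall>c. \<forall>x\<in>V. fls_const c * x \<in> V)"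

lemma fq_subspaceI:
  assumes "0 \<in> V" "\<And>x y. x \<in> V \<Longrightarrow> y \<in> V \<Longrightarrow> x + y \<in> V"
    and "\<And>c x. x \<in> V \<Longrightarrow> fls_const c * x \<in> V"
  shows "fq_subspace V"
  using assms by (auto simp: fq_subspace_def)

lemma fq_subspace_0: "fq_subspace V \<Longrightarrow> 0 \<in> V"
  and fq_subspace_add: "fq_subspace V \<Longrightarrow> x \<in> V \<Longrightarrow> y \<in> V \<Longrightarrow> x + y \<in> V"
  and fq_subspace_scale: "fq_subspace V \<Longrightarrow> x \<in> V \<Longrightarrow> fls_const c * x \<in> V"
  by (auto simp: fq_subspace_def)

lemma fq_subspace_uminus: "fq_subspace V \<Longrightarrow> x \<in> V \<Longrightarrow> - x \<in> V"
  using fq_subspace_scale[of V x "-1"] by (simp add: fls_const_uminus[symmetric])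

lemma fq_subspace_diff: "fq_subspace V \<Longrightarrow> x \<in> V \<Longrightarrow> y \<in> V \<Longrightarrow> x - y \<in> V"
  using fq_subspace_add[of V x "- y"] fq_subspace_uminus[of V y] by simp

lemma fq_subspace_scale_iff: "fq_subspace V \<Longrightarrow> c \<noteq> 0 \<Longrightarrow> fls_const c * x \<in> V \<longleftrightarrow> x \<in> V"
  using fq_subspace_scale[of V "fls_const c * x" "inverse c"] fq_subspace_scale[of V x c]
  by (auto simp: mult.assoc[symmetric] fls_const_mult_const)

lemma fq_subspace_sum: "fq_subspace V \<Longrightarrow> (\<And>i. i \<in> A \<Longrightarrow> g i \<in> V) \<Longrightarrow> sum g A \<in> V"
  by (induction A rule: infinite_finite_induct) (auto simp: fq_subspace_0 fq_subspace_add)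

text \<open>Every finite subspace arises from {0} by such steps, so this is the induction step for
  all facts on exponential functions.\<close>

definition adjoin :: "'a::{finite,field} fls set \<Rightarrow> 'a fls \<Rightarrow> 'a fls set" where
  "adjoin V x = (\<lambda>(c, v). v + fls_const c * x) ` (UNIV \<times> V)"

lemma adjoinI: "v \<in> V \<Longrightarrow> v + fls_const c * x \<in> adjoin V x"
  by (force simp: adjoin_def)

lemma in_adjoin_iff: "y \<in> adjoin V x \<longleftrightarrow> (\<exists>c. \<exists>v\<in>V. y = v + fls_const c * x)"
  by (force simp: adjoin_def)

lemma in_adjoin_iff_diff: "y \<in> adjoin V x \<longleftrightarrow> (\<exists>c. y - fls_const c * x \<in> V)"
  unfolding in_adjoin_iff by (metis add_diff_cancel_right' diff_add_cancel)

lemma finite_adjoin [simp]: "finite V \<Longrightarrow> finite (adjoin V x)"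
  by (simp add: adjoin_def)

lemma subset_adjoin: "V \<subseteq> adjoin V x"
  using adjoinI[of _ V 0 x] by auto

lemma fq_subspace_adjoin:
  assumes "fq_subspace V" shows "fq_subspace (adjoin V x)"
proof (rule fq_subspaceI)
  show "0 \<in> adjoin V x" using fq_subspace_0[OF assms] subset_adjoin by blast
next
  fix y z assume "y \<in> adjoin V x" "z \<in> adjoin V x"
  then obtain c v c' v' where "v \<in> V" "v' \<in> V"
    "y = v + fls_const c * x" "z = v' + fls_const c' * x"
    by (auto simp: in_adjoin_iff)
  then have "y + z = (v + v') + fls_const (c + c') * x"
    by (simp add: algebra_simps fls_plus_const[symmetric])
  then show "y + z \<in> adjoin V x"
    using adjoinI[OF fq_subspace_add[OF assms \<open>v \<in> V\<close> \<open>v' \<in> V\<close>], of "c + c'" x] by simp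
next
  fix d y assume "y \<in> adjoin V x"
  then obtain c v where "v \<in> V" "y = v + fls_const c * x"
    by (auto simp: in_adjoin_iff)
  then have "fls_const d * y = fls_const d * v + fls_const (d * c) * x"
    by (simp add: distrib_left mult.assoc[symmetric])
  then show "fls_const d * y \<in> adjoin V x"
    using adjoinI[OF fq_subspace_scale[OF assms \<open>v \<in> V\<close>, of d], of "d * c" x] by simp
qed

lemma inj_on_adjoin:
  assumes "fq_subspace V" "x \<notin> V"
  shows "inj_on (\<lambda>(c, v). v + fls_const c * x) (UNIV \<times> V)"
proof (rule inj_onI, clarify)
  fix c c' v v' assume v: "v \<in> V" "v' \<in> V" and e: "v + fls_const c * x = v' + fls_const c' * x"
  then have "fls_const (c - c') * x = v' - v"
    by (simp add: algebra_simps fls_minus_const[symmetric])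
  then have "fls_const (c - c') * x \<in> V" using v fq_subspace_diff[OF assms(1)] by simp
  then have "c - c' = 0" using fq_subspace_scale_iff[OF assms(1), of "c - c'" x] assms(2) by blast
  then show "c = c' \<and> v = v'" using e by simp
qed

lemma card_adjoin:
  assumes "fq_subspace V" "x \<notin> V"
  shows "card (adjoin V x) = CARD('a) * card (V :: 'a::{finite,field} fls set)"
  unfolding adjoin_def by (subst card_image[OF inj_on_adjoin[OF assms]]) (simp add: card_cartesian_product)

lemma fq_subspace_zero: "fq_subspace {0}"
  by (rule fq_subspaceI) auto

lemma adjoin_subset: "fq_subspace V \<Longrightarrow> W \<subseteq> V \<Longrightarrow> x \<in> V \<Longrightarrow> adjoin W x \<subseteq> V"
  by (auto simp: in_adjoin_iff intro!: fq_subspace_add fq_subspace_scale)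

lemma finite_fq_subspace_induct [consumes 2, case_names zero adjoin]:
  assumes "finite V" "fq_subspace V" and "P {0}"
    and step: "\<And>W x. finite W \<Longrightarrow> fq_subspace W \<Longrightarrow> x \<notin> W \<Longrightarrow> P W \<Longrightarrow> P (adjoin W x)"
  shows "P V"
proof -
  have "P V" if "finite W" "fq_subspace W" "W \<subseteq> V" "P W" for W
    using that
  proof (induction "card V - card W" arbitrary: W rule: less_induct)
    case less
    show ?case
    proof (cases "W = V")
      case False
      then obtain x where x: "x \<in> V" "x \<notin> W" using less.prems by auto
      let ?W = "adjoin W x"
      have sub: "?W \<subseteq> V" using adjoin_subset assms(2) less.prems(3) x by blast
      have "x \<in> ?W" using adjoinI[OF fq_subspace_0[OF less.prems(2)], of 1 x] by simp
      then have "W \<subset> ?W" using subset_adjoin[of W x] x by blast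
      then have "card W < card ?W" using less.prems(1) by (intro psubset_card_mono) auto
      moreover have "card ?W \<le> card V" using sub assms(1) by (rule card_mono[rotated])
      ultimately have "card V - card ?W < card V - card W" by linarith
      then show ?thesis
        by (rule less.hyps[OF _ finite_adjoin[OF less.prems(1)] fq_subspace_adjoin[OF less.prems(2)] sub
              step[OF less.prems(1,2) x(2) less.prems(4)]])
    qed (use less in simp)
  qed
  from this[of "{0}"] show ?thesis using assms fq_subspace_zero fq_subspace_0[OF assms(2)] by auto
qed

definition exp_fun :: "'a::{finite,field} fls set \<Rightarrow> 'a fls \<Rightarrow> 'a fls" where
  "exp_fun V z = z * (\<Prod>v\<in>V - {0}. 1 - z / v)"

lemma exp_fun_0 [simp]: "exp_fun V 0 = 0" by (simp add: exp_fun_def)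

lemma exp_fun_eq_0_iff: "finite V \<Longrightarrow> fq_subspace V \<Longrightarrow> exp_fun V z = 0 \<longleftrightarrow> z \<in> V"
  using fq_subspace_0[of V] by (auto simp: exp_fun_def)

lemma exp_fun_zero [simp]: "exp_fun {0} z = z" by (simp add: exp_fun_def)

lemma prod_diff_eq_exp_fun:
  assumes "finite V" "fq_subspace V"
  shows "(\<Prod>v\<in>V. y - v) = (\<Prod>v\<in>V - {0}. - v) * exp_fun V y"
proof -
  have "(\<Prod>v\<in>V. y - v) = y * (\<Prod>v\<in>V - {0}. y - v)"
    using assms by (subst prod.remove[of V 0]) (auto simp: fq_subspace_0)
  also have "(\<Prod>v\<in>V - {0}. y - v) = (\<Prod>v\<in>V - {0}. (- v) * (1 - y / v))"
    by (rule prod.cong) (auto simp: field_simps)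
  finally show ?thesis by (simp only: exp_fun_def prod.distrib mult.left_commute mult.assoc)
qed

text \<open>Up to a common constant, numerator and denominator are the values of
  \<open>exp_fun V\<close> at y - z and at y. Additivity enters as a hypothesis because the lemma is
  used inside the induction that proves it.\<close>

lemma prod_coset:
  assumes "finite V" "fq_subspace V" "y \<notin> V"
    and add: "\<And>x y. exp_fun V (x + y) = exp_fun V x + exp_fun V y"
  shows "(\<Prod>v\<in>V. 1 - z / (v + y)) = 1 - exp_fun V z / exp_fun V y"
proof -
  let ?k = "\<Prod>v\<in>V - {0}. - v"
  have k: "?k \<noteq> 0" using assms(1) by (auto simp: prod_zero_iff)
  have ey: "exp_fun V y \<noteq> 0" using assms by (simp add: exp_fun_eq_0_iff)
  have nz: "v + y \<noteq> 0" if "v \<in> V" for v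
    using fq_subspace_uminus[OF assms(2) that] assms(3) by (metis add_eq_0_iff minus_minus)
  have "(\<Prod>v\<in>V. 1 - z / (v + y)) = (\<Prod>v\<in>V. ((y - z) - (- v)) / (y - (- v)))"
    by (rule prod.cong) (use nz in \<open>auto simp: field_simps\<close>)
  also have "\<dots> = (\<Prod>v\<in>V. (y - z) - v) / (\<Prod>v\<in>V. y - v)"
  proof -
    have r: "(\<Prod>v\<in>V. t - (- v)) = (\<Prod>v\<in>V. t - v)" for t
      by (rule prod.reindex_bij_witness[of _ uminus uminus]) (auto simp: fq_subspace_uminus assms(2))
    show ?thesis by (simp only: prod_dividef r)
  qed
  also have "\<dots> = exp_fun V (y - z) / exp_fun V y"
    using k by (simp add: prod_diff_eq_exp_fun[OF assms(1,2)])
  also have "exp_fun V (y - z) = exp_fun V y - exp_fun V z"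
    using add[of "y - z" z] by simp
  finally show ?thesis using ey by (simp add: field_simps)
qed

text \<open>The nonzero elements v + c x are grouped by c. The group c = 0 gives
  \<open>exp_fun V z\<close>, and every other c contributes 1 - e(z) / (c e(x)) with e =
  \<open>exp_fun V\<close>; the product over c collapses by
  \<open>prod_one_minus_over_units\<close>.\<close>

lemma exp_fun_adjoin_aux:
  fixes V :: "'a::{finite,field} fls set"
  assumes "finite V" "fq_subspace V" "x \<notin> V"
    and add: "\<And>x y. exp_fun V (x + y) = exp_fun V x + exp_fun V y"
    and hom: "\<And>c x. exp_fun V (fls_const c * x) = fls_const c * exp_fun V x"
  shows "exp_fun (adjoin V x) z = exp_fun V z - exp_fun V z ^ CARD('a) * inverse (exp_fun V x ^ (CARD('a) - 1))"
proof -
  let ?f = "\<lambda>(c, v). v + fls_const c * x"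
  let ?g = "\<lambda>v. 1 - z / v"
  let ?w = "exp_fun V x"
  have w: "?w \<noteq> 0" using assms by (simp add: exp_fun_eq_0_iff)
  note inj = inj_on_adjoin[OF assms(2,3)]
  have split: "UNIV \<times> V - {(0, 0)} = (\<lambda>v. (0, v)) ` (V - {0}) \<union> (UNIV - {0}) \<times> V" by auto
  have "adjoin V x - {0} = ?f ` (UNIV \<times> V - {(0, 0)})"
    unfolding adjoin_def using inj fq_subspace_0[OF assms(2)]
    by (subst inj_on_image_set_diff[OF inj]) auto
  then have "prod ?g (adjoin V x - {0}) = prod (?g \<circ> ?f) (UNIV \<times> V - {(0, 0)})"
    by (simp only:) (rule prod.reindex, rule inj_on_subset[OF inj], auto)
  also have "\<dots> = prod (?g \<circ> ?f) ((\<lambda>v. (0, v)) ` (V - {0})) * prod (?g \<circ> ?f) ((UNIV - {0}) \<times> V)"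
    unfolding split using assms(1) by (intro prod.union_disjoint) auto
  also have "prod (?g \<circ> ?f) ((\<lambda>v. (0, v)) ` (V - {0})) = prod ?g (V - {0})"
    by (subst prod.reindex) (auto simp: inj_on_def o_def)
  also have "prod (?g \<circ> ?f) ((UNIV - {0}) \<times> V) = (\<Prod>c\<in>UNIV - {0}. \<Prod>v\<in>V. 1 - z / (v + fls_const c * x))"
    by (simp add: prod.cartesian_product o_def case_prod_unfold)
  also have "\<dots> = (\<Prod>c\<in>UNIV - {0}. 1 - (exp_fun V z / ?w) / fls_const c)"
  proof (rule prod.cong)
    fix c :: 'a assume "c \<in> UNIV - {0}"
    then have "fls_const c * x \<notin> V" using assms(3) fq_subspace_scale_iff[OF assms(2)] by simp
    then have "(\<Prod>v\<in>V. 1 - z / (v + fls_const c * x)) = 1 - exp_fun V z / (fls_const c * ?w)"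
      by (subst prod_coset[OF assms(1,2) _ add]) (simp_all add: hom)
    then show "(\<Prod>v\<in>V. 1 - z / (v + fls_const c * x)) = 1 - (exp_fun V z / ?w) / fls_const c"
      by (simp add: mult.commute)
  qed simp
  also have "\<dots> = 1 - (exp_fun V z / ?w) ^ (CARD('a) - 1)" by (rule prod_one_minus_over_units)
  finally have "exp_fun (adjoin V x) z = exp_fun V z * (1 - (exp_fun V z / ?w) ^ (CARD('a) - 1))"
    by (simp add: exp_fun_def)
  also have "\<dots> = exp_fun V z - (exp_fun V z * exp_fun V z ^ (CARD('a) - 1)) * inverse (?w ^ (CARD('a) - 1))"
    by (simp add: algebra_simps power_divide divide_inverse power_mult_distrib power_inverse)
  also have "exp_fun V z * exp_fun V z ^ (CARD('a) - 1) = exp_fun V z ^ CARD('a)"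
    using card_finite_field_ge2[where 'a='a]
    by (metis One_nat_def Suc_pred' power_Suc zero_less_card_finite)
  finally show ?thesis .
qed

text \<open>The recursion expresses the new function through the old one and its q-th power, and
  taking q-th powers is linear over the constants.\<close>

lemma exp_fun_linear:
  assumes "finite V" "fq_subspace V"
  shows "(\<forall>x y. exp_fun V (x + y) = exp_fun V x + exp_fun V y) \<and>
         (\<forall>c x. exp_fun V (fls_const c * x) = fls_const c * exp_fun V x)"
  using assms
proof (induction V rule: finite_fq_subspace_induct)
  case zero
  then show ?case by simp
next
  case (adjoin W x)
  then have r: "exp_fun (adjoin W x) z = exp_fun W z - exp_fun W z ^ CARD('a) * inverse (exp_fun W x ^ (CARD('a) - 1))" for z
    by (intro exp_fun_adjoin_aux) auto
  show ?case
    unfolding r using adjoin.IH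
    by (auto simp: frobenius_fls_add algebra_simps power_mult_distrib fls_const_power_card)
qed

lemma exp_fun_add: "finite V \<Longrightarrow> fq_subspace V \<Longrightarrow> exp_fun V (x + y) = exp_fun V x + exp_fun V y"
  and exp_fun_scale: "finite V \<Longrightarrow> fq_subspace V \<Longrightarrow> exp_fun V (fls_const c * x) = fls_const c * exp_fun V x"
  using exp_fun_linear by blast+

lemma exp_fun_diff: "finite V \<Longrightarrow> fq_subspace V \<Longrightarrow> exp_fun V (x - y) = exp_fun V x - exp_fun V y"
  using exp_fun_add[of V "x - y" y] by simp

lemma exp_fun_adjoin:
  fixes V :: "'a::{finite,field} fls set"
  assumes "finite V" "fq_subspace V" "x \<notin> V"
  shows "exp_fun (adjoin V x) z = exp_fun V z - exp_fun V z ^ CARD('a) * inverse (exp_fun V x ^ (CARD('a) - 1))"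
  by (rule exp_fun_adjoin_aux) (use assms in \<open>auto intro: exp_fun_add exp_fun_scale\<close>)

lemma exp_fun_image_scale:
  assumes "l \<noteq> 0"
  shows "exp_fun ((*) l ` V) z = l * exp_fun V (z / l)"
proof -
  have "(*) l ` V - {0} = (*) l ` (V - {0})" using assms by auto
  moreover have "inj_on ((*) l) (V - {0})" using assms by (auto simp: inj_on_def)
  ultimately have "(\<Prod>v\<in>(*) l ` V - {0}. 1 - z / v) = (\<Prod>v\<in>V - {0}. 1 - (z / l) / v)"
    by (simp add: prod.reindex)
  then show ?thesis using assms by (simp add: exp_fun_def)
qed

section \<open>Power sums as coefficients of the exponential polynomial\<close>

definition inv_sum :: "'a::field fls set \<Rightarrow> nat \<Rightarrow> 'a fls" where
  "inv_sum V k = (\<Sum>v\<in>V - {0}. inverse (v ^ k))"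

definition exp_poly :: "'a::{finite,field} fls set \<Rightarrow> 'a fls poly" where
  "exp_poly V = [:0, 1:] * (\<Prod>v\<in>V - {0}. [:1, - inverse v:])"

lemma poly_exp_poly: "poly (exp_poly V) z = exp_fun V z"
  by (simp add: exp_poly_def exp_fun_def poly_prod divide_inverse)

lemma infinite_fls: "infinite (UNIV :: 'a::field fls set)"
proof
  assume "finite (UNIV :: 'a fls set)"
  moreover have "inj (\<lambda>n::nat. fls_X ^ n :: 'a fls)"
    by (rule injI) (metis fls_subdegree_fls_X_pow of_nat_eq_iff)
  ultimately show False
    by (metis finite_UNIV_inj_surj finite_imageD finite_subset infinite_UNIV_nat subset_UNIV)
qed

lemma poly_fls_eqI:
  fixes p r :: "'a::field fls poly"
  assumes "\<And>z. poly p z = poly r z"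
  shows "p = r"
proof (rule ccontr)
  assume "p \<noteq> r"
  then have "finite {z. poly (p - r) z = 0}" by (intro poly_roots_finite) auto
  then show False using assms infinite_fls[where 'a='a] by simp
qed

lemma exp_poly_adjoin:
  fixes V :: "'a::{finite,field} fls set"
  assumes "finite V" "fq_subspace V" "x \<notin> V"
  shows "exp_poly (adjoin V x) = exp_poly V - smult (inverse (exp_fun V x ^ (CARD('a) - 1))) (exp_poly V ^ CARD('a))"
  by (rule poly_fls_eqI) (simp add: poly_exp_poly exp_fun_adjoin[OF assms] mult.commute)

lemma frobenius_pCons:
  fixes p :: "'a::{finite,field} fls poly"
  shows "pCons a p ^ CARD('a) = [:a ^ CARD('a):] + monom 1 CARD('a) * p ^ CARD('a)"
proof -
  have "pCons a p = [:a:] + [:0, 1:] * p" by simp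
  then have "pCons a p ^ CARD('a) = [:a:] ^ CARD('a) + [:0, 1:] ^ CARD('a) * p ^ CARD('a)"
    by (simp only: frobenius_fls_poly_add power_mult_distrib)
  also have "[:0, 1:] ^ CARD('a) = (monom 1 CARD('a) :: 'a fls poly)" by (simp add: monom_altdef)
  also have "[:a:] ^ CARD('a) = [:a ^ CARD('a):]" by (simp add: poly_const_pow)
  finally show ?thesis .
qed

lemma coeff_frobenius:
  fixes p :: "'a::{finite,field} fls poly"
  shows "coeff (p ^ CARD('a)) k = (if CARD('a) dvd k then coeff p (k div CARD('a)) ^ CARD('a) else 0)"
proof (induction p arbitrary: k)
  case 0
  then show ?case by (simp add: zero_power)
next
  case (pCons a p)
  have q: "CARD('a) > 0" by simp
  have c: "coeff (pCons a p ^ CARD('a)) k =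
      (if k = 0 then a ^ CARD('a) else 0) + (if k < CARD('a) then 0 else coeff (p ^ CARD('a)) (k - CARD('a)))"
    by (simp only: frobenius_pCons coeff_add) (simp add: coeff_monom_mult coeff_pCons split: nat.split)
  show ?case
  proof (cases "k < CARD('a)")
    case True
    then have "CARD('a) dvd k \<longleftrightarrow> k = 0" by (auto dest: dvd_imp_le)
    with True show ?thesis unfolding c by auto
  next
    case False
    then obtain j where j: "k = CARD('a) + j" using le_Suc_ex not_less by blast
    have "(CARD('a) + j) div CARD('a) = Suc (j div CARD('a))" using q by simp
    with j show ?thesis unfolding c pCons.IH by (auto simp: coeff_pCons split: nat.splits)
  qed
qed

lemma card_eq_0_fls: "of_nat CARD('a) = (0 :: 'a::{finite,field} fls)"
proof -
  have "of_nat (CARD('a) choose 1) = (0::'a)"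
    using card_finite_field_ge2[where 'a='a] by (intro of_nat_choose_card_eq_0) auto
  then show ?thesis by (simp add: of_nat_fls_const)
qed

lemma pderiv_frobenius: "pderiv (p ^ CARD('a)) = (0 :: 'a::{finite,field} fls poly)"
proof -
  obtain n where n: "CARD('a) = Suc n"
    using zero_less_card_finite[where 'a='a] gr0_implies_Suc by blast
  then show ?thesis
    using card_eq_0_fls[where 'a='a] by (simp only: pderiv_power_Suc n) simp
qed

lemma exp_poly_zero [simp]: "exp_poly {0} = [:0, 1:]" by (simp add: exp_poly_def)

text \<open>Each induction step subtracts a multiple of a q-th power, which has derivative zero and
  only exponents divisible by q. Hence below q^2 only the exponents 1 and q survive.\<close>

lemma exp_poly_shape:
  fixes V :: "'a::{finite,field} fls set"
  assumes "finite V" "fq_subspace V"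
  shows "pderiv (exp_poly V) = 1 \<and> coeff (exp_poly V) 1 = 1 \<and>
    (\<forall>k < CARD('a)\<^sup>2. k \<noteq> 1 \<longrightarrow> k \<noteq> CARD('a) \<longrightarrow> coeff (exp_poly V) k = 0)"
  using assms
proof (induction V rule: finite_fq_subspace_induct)
  case zero
  show ?case by (auto simp: pderiv_pCons coeff_pCons split: nat.splits)
next
  case (adjoin W x)
  let ?q = "CARD('a)"
  have q: "?q \<ge> 2" by (rule card_finite_field_ge2)
  note E = exp_poly_adjoin[OF adjoin.hyps(1-3)]
  have "coeff (exp_poly W ^ ?q) k = 0" if "k < ?q\<^sup>2" "k \<noteq> ?q" for k
  proof (cases "?q dvd k")
    case True
    then obtain j where j: "k = ?q * j" by auto
    then have "j < ?q" "j \<noteq> 1" using that by (auto simp: power2_eq_square)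
    moreover have "?q < ?q\<^sup>2" using q by (simp add: power2_eq_square)
    ultimately have "coeff (exp_poly W) j = 0" using adjoin.IH by auto
    then show ?thesis using j q by (simp add: coeff_frobenius zero_power)
  qed (simp add: coeff_frobenius)
  moreover have "1 < ?q\<^sup>2" using one_less_power[of ?q 2] q by simp
  ultimately show ?case
    unfolding E using adjoin.IH q by (auto simp: pderiv_diff pderiv_smult pderiv_frobenius)
qed

text \<open>This is a logarithmic derivative: the factor 1 - X/v contributes - (1/v) / (1 - X/v), a
  geometric series in which the inverse powers of v are the coefficients.\<close>

lemma fps_deriv_prod_one_minus:
  fixes A :: "'b::field set"
  assumes "finite A" "0 \<notin> A"
  shows "fps_deriv (\<Prod>v\<in>A. 1 - fps_const (inverse v) * fps_X) =
    - (\<Prod>v\<in>A. 1 - fps_const (inverse v) * fps_X) * Abs_fps (\<lambda>n. \<Sum>v\<in>A. inverse (v ^ Suc n))"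
  using assms
proof (induction A rule: finite_induct)
  case empty
  have "Abs_fps (\<lambda>n. 0) = (0 :: 'b fps)" by (rule fps_ext) simp
  then show ?case by simp
next
  case (insert x F)
  let ?P = "\<Prod>v\<in>F. 1 - fps_const (inverse v) * fps_X"
  let ?G = "Abs_fps (\<lambda>n. \<Sum>v\<in>F. inverse (v ^ Suc n))"
  let ?g = "Abs_fps (\<lambda>n. inverse (x ^ Suc n))"
  have s: "Abs_fps (\<lambda>n. \<Sum>v\<in>insert x F. inverse (v ^ Suc n)) = ?g + ?G"
    using insert by (intro fps_ext) simp
  have g: "(1 - fps_const (inverse x) * fps_X) * ?g = fps_const (inverse x)"
  proof (rule fps_ext)
    fix n show "((1 - fps_const (inverse x) * fps_X) * ?g) $ n = fps_const (inverse x) $ n"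
      by (cases n) (simp_all add: left_diff_distrib mult.assoc)
  qed
  have alg: "L * (- P * G) - k * P = - (L * P) * (h + G)" if "L * h = k" for L P G k h :: "'b fps"
    unfolding that[symmetric] by (simp add: algebra_simps)
  have d: "fps_deriv (1 - fps_const (inverse x) * fps_X) = - fps_const (inverse x)" by simp
  have "fps_deriv ((1 - fps_const (inverse x) * fps_X) * ?P) =
      (1 - fps_const (inverse x) * fps_X) * (- ?P * ?G) - fps_const (inverse x) * ?P"
    using insert.IH insert.prems by (simp only: fps_deriv_mult d) (simp del: fps_const_neg add: algebra_simps)
  also have "\<dots> = - ((1 - fps_const (inverse x) * fps_X) * ?P) * (?g + ?G)"
    by (rule alg[OF g])
  finally show ?case using insert unfolding s by simp
qed

lemma fps_of_poly_linear: "fps_of_poly [:1, - c:] = 1 - fps_const (c :: 'b::field) * fps_X"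
  by (rule fps_ext) (auto simp: coeff_pCons split: nat.splits)

lemma fls_power_sum_frobenius:
  "inv_sum V (k * CARD('a)) = (inv_sum V k :: 'a::{finite,field} fls) ^ CARD('a)"
  by (simp add: inv_sum_def frobenius_fls_sum power_mult power_inverse)

text \<open>A Newton recursion. Writing the polynomial as X F with derivative 1 gives F + X F' = 1,
  and the logarithmic derivative turns this into F = 1 + X F G, where G generates the power sums.
  Most coefficients of F vanish, so only the terms of index 0 and q - 1 remain.\<close>

lemma exp_poly_coeffs:
  fixes V :: "'a::{finite,field} fls set"
  defines "q \<equiv> CARD('a)"
  assumes "finite V" "fq_subspace V"
  shows "coeff (exp_poly V) q = inv_sum V (q - 1)"
    and "coeff (exp_poly V) (q\<^sup>2) = inv_sum V (q\<^sup>2 - 1) + inv_sum V (q - 1) ^ (q + 1)"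
proof -
  have q: "q \<ge> 2" unfolding q_def by (rule card_finite_field_ge2)
  let ?F = "\<Prod>v\<in>V - {0}. [:1, - inverse v:]"
  let ?f = "fps_of_poly ?F"
  let ?G = "Abs_fps (\<lambda>n. inv_sum V (Suc n))"
  have E: "exp_poly V = pCons 0 ?F" by (simp add: exp_poly_def)
  have "fps_deriv ?f = - ?f * ?G"
    using fps_deriv_prod_one_minus[of "V - {0}"] assms(2)
    by (simp only: fps_of_poly_prod fps_of_poly_linear inv_sum_def finite_Diff) simp
  moreover have "pderiv (pCons 0 ?F) = 1"
    using exp_poly_shape[OF assms(2,3)] E by simp
  then have "?F + pCons 0 (pderiv ?F) = 1" by (simp add: pderiv_pCons)
  then have "fps_of_poly (?F + pCons 0 (pderiv ?F)) = 1" by simp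
  then have "?f + fps_X * fps_deriv ?f = 1"
    by (simp add: fps_of_poly_add fps_of_poly_pCons fps_of_poly_pderiv mult.commute)
  ultimately have fx: "?f = 1 + fps_X * (?f * ?G)"
    by (simp add: algebra_simps)
  have cf: "coeff ?F (Suc n) = (\<Sum>i\<le>n. coeff ?F i * inv_sum V (Suc (n - i)))" for n
  proof -
    have "coeff ?F (Suc n) = fps_nth ?f (Suc n)" by simp
    also have "\<dots> = fps_nth (1 + fps_X * (?f * ?G)) (Suc n)" using fx by (rule arg_cong)
    also have "\<dots> = (\<Sum>i\<le>n. coeff ?F i * inv_sum V (Suc (n - i)))"
      by (simp only: fps_add_nth fps_X_mult_nth) (simp add: fps_mult_nth atLeast0AtMost)
    finally show ?thesis .
  qed
  have cE: "coeff (exp_poly V) (Suc n) = coeff ?F n" for n by (simp add: E)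
  have F0: "coeff ?F 0 = 1" using exp_poly_shape[OF assms(2,3)] cE[of 0] by simp
  have Fz: "coeff ?F n = 0" if "n < q\<^sup>2 - 1" "n \<noteq> 0" "n \<noteq> q - 1" for n
  proof -
    have "Suc n < q\<^sup>2" "Suc n \<noteq> 1" "Suc n \<noteq> q" using that q by auto
    then have "coeff (exp_poly V) (Suc n) = 0"
      using exp_poly_shape[OF assms(2,3)] unfolding q_def by blast
    then show ?thesis by (simp add: cE)
  qed
  have q2: "q < q\<^sup>2" using q by (simp add: power2_eq_square)
  obtain r where r: "q = Suc (Suc r)" using q by (metis add_2_eq_Suc le_Suc_ex)
  have Fq: "coeff ?F (q - 1) = inv_sum V (q - 1)"
  proof -
    have "coeff ?F (q - 1) = (\<Sum>i\<le>r. coeff ?F i * inv_sum V (Suc (r - i)))"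
      using cf[of r] r by simp
    also have "\<dots> = (\<Sum>i\<in>{0}. coeff ?F i * inv_sum V (Suc (r - i)))"
      by (rule sum.mono_neutral_right) (use Fz q2 r in auto)
    finally show ?thesis using F0 r by simp
  qed
  then show "coeff (exp_poly V) q = inv_sum V (q - 1)" using cE[of "q - 1"] q by simp
  obtain s where s: "q\<^sup>2 = Suc (Suc s)" using q2 q by (metis add_2_eq_Suc le_Suc_ex order.trans less_imp_le)
  have "coeff ?F (q\<^sup>2 - 1) = (\<Sum>i\<le>s. coeff ?F i * inv_sum V (Suc (s - i)))"
    using cf[of s] s by simp
  also have "\<dots> = (\<Sum>i\<in>{0, q - 1}. coeff ?F i * inv_sum V (Suc (s - i)))"
    by (rule sum.mono_neutral_right) (use Fz q2 s in auto)
  also have "\<dots> = inv_sum V (Suc s) + inv_sum V (q - 1) * inv_sum V (Suc (s - (q - 1)))"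
    using F0 Fq r by simp
  \<comment> \<open>The remaining index q^2 - q is q times q - 1, so this power sum is itself a q-th
    power by Frobenius.\<close>
  also have "Suc (s - (q - 1)) = (q - 1) * q" using s q q2 by (simp add: power2_eq_square algebra_simps)
  also have "inv_sum V ((q - 1) * q) = inv_sum V (q - 1) ^ q"
    unfolding q_def by (rule fls_power_sum_frobenius)
  finally show "coeff (exp_poly V) (q\<^sup>2) = inv_sum V (q\<^sup>2 - 1) + inv_sum V (q - 1) ^ (q + 1)"
    using cE[of "q\<^sup>2 - 1"] s by simp
qed

text \<open>The coefficient of z^q, and for \<open>exp_coeff2\<close> that of z^(q^2), in the
  exponential polynomial (\<open>exp_poly_coeffs\<close>). Both are written as power sums because
  these converge to \<open>Ssum\<close> when a lattice is exhausted.\<close>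

definition exp_coeff1 :: "'a::{finite,field} fls set \<Rightarrow> 'a fls" where
  "exp_coeff1 V = inv_sum V (CARD('a) - 1)"

definition exp_coeff2 :: "'a::{finite,field} fls set \<Rightarrow> 'a fls" where
  "exp_coeff2 V = inv_sum V ((CARD('a))\<^sup>2 - 1) + inv_sum V (CARD('a) - 1) ^ (CARD('a) + 1)"

lemma exp_coeff_adjoin:
  fixes V :: "'a::{finite,field} fls set"
  assumes "finite V" "fq_subspace V" "x \<notin> V"
  defines "W \<equiv> inverse (exp_fun V x ^ (CARD('a) - 1))"
  shows "exp_coeff1 (adjoin V x) = exp_coeff1 V - W"
    and "exp_coeff2 (adjoin V x) = exp_coeff2 V - W * exp_coeff1 V ^ CARD('a)"
proof -
  note c = exp_poly_coeffs[OF assms(1,2)] exp_poly_coeffs[OF finite_adjoin[OF assms(1)] fq_subspace_adjoin[OF assms(2)]]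
  have "coeff (exp_poly (adjoin V x)) CARD('a) = coeff (exp_poly V) CARD('a) - W * coeff (exp_poly V) 1 ^ CARD('a)"
    unfolding exp_poly_adjoin[OF assms(1-3)] W_def by (simp add: coeff_frobenius)
  then show "exp_coeff1 (adjoin V x) = exp_coeff1 V - W"
    using exp_poly_shape[OF assms(1,2)] by (simp add: c exp_coeff1_def)
  have "coeff (exp_poly (adjoin V x)) ((CARD('a))\<^sup>2) = coeff (exp_poly V) ((CARD('a))\<^sup>2) - W * coeff (exp_poly V) CARD('a) ^ CARD('a)"
    unfolding exp_poly_adjoin[OF assms(1-3)] W_def by (simp add: coeff_frobenius power2_eq_square)
  then show "exp_coeff2 (adjoin V x) = exp_coeff2 V - W * exp_coeff1 V ^ CARD('a)"
    by (simp only: c exp_coeff1_def exp_coeff2_def)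
qed

lemma inv_sum_image_scale:
  assumes "l \<noteq> 0"
  shows "inv_sum ((*) l ` V) k = inverse (l ^ k) * inv_sum V k"
proof -
  have "(*) l ` V - {0} = (*) l ` (V - {0})" using assms by auto
  moreover have "inj_on ((*) l) (V - {0})" using assms by (auto simp: inj_on_def)
  ultimately show ?thesis
    by (simp add: inv_sum_def sum.reindex power_mult_distrib sum_distrib_left)
qed

section \<open>Sums over discrete sets\<close>

lemma absv_le_card_powi_iff:
  "absv (x :: 'a::{finite,field} fls) \<le> real CARD('a) powi (- n) \<longleftrightarrow> (\<forall>k<n. fls_nth x k = 0)"
proof (cases "x = 0")
  case False
  have "absv x \<le> real CARD('a) powi (- n) \<longleftrightarrow> n \<le> fls_subdegree x"
    using False card_real_gt_1[where 'a='a]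
      power_int_strict_increasing[of "- n" "- fls_subdegree x" "real CARD('a)"]
      power_int_increasing[of "- fls_subdegree x" "- n" "real CARD('a)"]
    by (force simp: absv_def not_le[symmetric])
  also have "\<dots> \<longleftrightarrow> (\<forall>k<n. fls_nth x k = 0)"
    using False fls_subdegree_geI[of x n] fls_eq0_below_subdegree[of _ x] by fastforce
  finally show ?thesis .
qed (use card_real_gt_1[where 'a='a] in \<open>simp add: zero_le_power_int\<close>)

lemma has_sum_flsI:
  fixes g :: "'b \<Rightarrow> 'a::{finite,field} fls"
  assumes "\<And>n::nat. \<exists>F. finite F \<and> F \<subseteq> A \<and>
    (\<forall>G. finite G \<longrightarrow> F \<subseteq> G \<longrightarrow> G \<subseteq> A \<longrightarrow> absv (sum g G - s) \<le> real CARD('a) powi (- int n))"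
  shows "(g has_sum s) A"
proof -
  have "eventually (\<lambda>G. dist (sum g G) s < e) (finite_subsets_at_top A)" if e: "e > 0" for e
  proof -
    have "\<exists>n. (1 / 2 :: real) ^ n < e" by (rule real_arch_pow_inv[OF e]) simp
    then obtain n where "(1 / 2 :: real) ^ n < e" by blast
    then have n: "inverse (2 ^ n) < e" by (simp add: power_divide inverse_eq_divide)
    obtain F where F: "finite F" "F \<subseteq> A"
      "\<And>G. finite G \<Longrightarrow> F \<subseteq> G \<Longrightarrow> G \<subseteq> A \<Longrightarrow> absv (sum g G - s) \<le> real CARD('a) powi (- int n)"
      using assms[of n] by blast
    have "dist (sum g G) s < e" if G: "finite G" "F \<subseteq> G" "G \<subseteq> A" for G
    proof (cases "sum g G = s")
      case False
      have "\<forall>k<int n. fls_nth (sum g G - s) k = 0"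
        using F(3)[OF G] unfolding absv_le_card_powi_iff .
      then have "int n \<le> fls_subdegree (sum g G - s)"
        using False by (intro fls_subdegree_geI) auto
      then have "dist (sum g G) s = inverse (2 ^ nat (fls_subdegree (sum g G - s)))"
        using False by (simp add: dist_fls_def)
      also have "\<dots> \<le> inverse (2 ^ n)"
        using \<open>int n \<le> fls_subdegree (sum g G - s)\<close> by (simp add: le_nat_iff power_increasing)
      finally show ?thesis using n by simp
    qed (use e in simp)
    then show ?thesis
      unfolding eventually_finite_subsets_at_top using F(1,2) by blast
  qed
  then show ?thesis unfolding has_sum_def by (rule tendstoI)
qed

text \<open>The sum is built coefficient by coefficient: each coefficient of a Laurent series
  receives contributions from finitely many terms only. A finite set outside which all terms are
  small already carries all coefficients of low order.\<close>

lemma infsum_fls_approx: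
  fixes g :: "'b \<Rightarrow> 'a::{finite,field} fls"
  assumes fin: "\<And>n::int. finite {x\<in>A. absv (g x) > real CARD('a) powi (- n)}"
    and F: "finite F" "F \<subseteq> A" "\<And>x. x \<in> A - F \<Longrightarrow> absv (g x) \<le> real CARD('a) powi (- N)"
  shows "absv (infsum g A - sum g F) \<le> real CARD('a) powi (- N)"
proof -
  let ?Z = "\<lambda>n. {x\<in>A. fls_nth (g x) n \<noteq> 0}"
  let ?h = "\<lambda>n. \<Sum>x\<in>?Z n. fls_nth (g x) n"
  have Z: "x \<in> ?Z n \<Longrightarrow> absv (g x) > real CARD('a) powi (- (n + 1))" for x n
    using absv_le_card_powi_iff[of "g x" "n + 1"] by (force simp: not_le[symmetric])
  have finZ: "finite (?Z n)" for n
    by (rule finite_subset[OF _ fin[of "n + 1"]]) (use Z in blast)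
  have low: "\<exists>K. \<forall>n<K. ?h n = 0"
  proof -
    let ?B = "{x\<in>A. absv (g x) > real CARD('a) powi (- 0)}"
    have finB: "finite ?B" by (rule fin)
    \<comment> \<open>Terms outside \<open>?B\<close> have no coefficients of negative index, and
      the finitely many terms in \<open>?B\<close> have a least order; hence the minimum with
      0.\<close>
    define K where "K = (if ?B = {} then 0 else min 0 (Min ((\<lambda>x. fls_subdegree (g x)) ` ?B)))"
    have "?Z n = {}" if "n < K" for n
    proof (rule ccontr)
      assume "?Z n \<noteq> {}"
      then obtain x where x: "x \<in> A" "fls_nth (g x) n \<noteq> 0" by auto
      have "n < 0" using that by (auto simp: K_def split: if_splits)
      have "\<not> absv (g x) \<le> real CARD('a) powi (- 0)"
        unfolding absv_le_card_powi_iff using x \<open>n < 0\<close> by auto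
      then have xB: "x \<in> ?B" using x by auto
      then have "K \<le> fls_subdegree (g x)"
        using finB by (auto simp: K_def min_le_iff_disj)
      also have "\<dots> \<le> n" using x by (intro fls_subdegree_leI)
      finally show False using that by simp
    qed
    then show ?thesis by (intro exI[of _ K]) auto
  qed
  define s where "s = Abs_fls ?h"
  have s: "fls_nth s n = ?h n" for n unfolding s_def by (rule nth_Abs_fls_ex_lower_bound[OF low])
  have approx: "absv (sum g G - s) \<le> real CARD('a) powi (- n)"
    if G: "finite G" "G \<subseteq> A" "\<And>x. x \<in> A - G \<Longrightarrow> absv (g x) \<le> real CARD('a) powi (- n)" for G n
    unfolding absv_le_card_powi_iff
  proof (intro allI impI)
    fix k assume k: "k < n"
    have "?Z k \<subseteq> G"
    proof
      fix x assume x: "x \<in> ?Z k"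
      show "x \<in> G"
      proof (rule ccontr)
        assume "x \<notin> G"
        then have "absv (g x) \<le> real CARD('a) powi (- n)" using G x by auto
        then show False unfolding absv_le_card_powi_iff using k x by auto
      qed
    qed
    then have "?h k = (\<Sum>x\<in>G. fls_nth (g x) k)"
      using G by (intro sum.mono_neutral_left) auto
    then show "fls_nth (sum g G - s) k = 0" by (simp add: s fls_nth_sum)
  qed
  have "(g has_sum s) A"
  proof (rule has_sum_flsI)
    fix n :: nat
    let ?F = "{x\<in>A. absv (g x) > real CARD('a) powi (- int n)}"
    have "absv (sum g G - s) \<le> real CARD('a) powi (- int n)" if "finite G" "?F \<subseteq> G" "G \<subseteq> A" for G
      by (rule approx) (use that in auto)
    then show "\<exists>F. finite F \<and> F \<subseteq> A \<and>
      (\<forall>G. finite G \<longrightarrow> F \<subseteq> G \<longrightarrow> G \<subseteq> A \<longrightarrow> absv (sum g G - s) \<le> real CARD('a) powi (- int n))"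
      using fin[of "int n"] by (intro exI[of _ ?F]) auto
  qed
  then have "infsum g A = s" by (rule infsumI)
  then show ?thesis using approx[OF F] by (simp add: absv_diff_commute)
qed

definition finite_balls :: "'a::{finite,field} fls set \<Rightarrow> bool" where
  "finite_balls L \<longleftrightarrow> (\<forall>n::int. finite {x\<in>L. absv x \<le> real CARD('a) powi n})"

abbreviation trunc :: "'a::{finite,field} fls set \<Rightarrow> int \<Rightarrow> 'a fls set" where
  "trunc L n \<equiv> {x\<in>L. absv x \<le> real CARD('a) powi n}"

lemma finite_ballsD: "finite_balls L \<Longrightarrow> finite (trunc L n)"
  by (simp add: finite_balls_def)

lemma absv_less_powi_iff:
  "absv (x :: 'a::{finite,field} fls) < real CARD('a) powi (n + 1) \<longleftrightarrow> absv x \<le> real CARD('a) powi n"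
proof (cases "x = 0")
  case False
  have "real CARD('a) powi a < real CARD('a) powi b \<longleftrightarrow> a < b"
    "real CARD('a) powi a \<le> real CARD('a) powi b \<longleftrightarrow> a \<le> b" for a b
    using card_real_gt_1[where 'a='a] power_int_strict_increasing[of a b "real CARD('a)"]
      power_int_strict_increasing[of b a "real CARD('a)"] power_int_increasing[of a b "real CARD('a)"]
    by (force simp: not_le[symmetric])+
  then show ?thesis using False by (auto simp: absv_def)
qed (use card_real_gt_1[where 'a='a] in \<open>simp add: zero_less_power_int zero_le_power_int\<close>)

lemma Ssum_approx:
  fixes L :: "'a::{finite,field} fls set"
  assumes "finite_balls L" "m \<ge> 1" "n \<ge> 0"
  shows "absv (Ssum L m - inv_sum (trunc L n) m) \<le> real CARD('a) powi (- (n + 1))"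
proof -
  let ?q = "real CARD('a)"
  have q: "?q > 1" by (rule card_real_gt_1)
  have key: "absv (inverse (x ^ m)) \<le> ?q powi (- (k + 1))" if "x \<noteq> 0" "\<not> absv x \<le> ?q powi k" "k \<ge> 0" for x :: "'a fls" and k
  proof -
    have "?q powi (k + 1) \<le> absv x"
      using that absv_less_powi_iff[of x k] by simp
    moreover have "1 \<le> ?q powi (k + 1)" using q that by (intro one_le_power_int) auto
    ultimately have "?q powi (k + 1) \<le> absv x ^ m"
      using assms(2) by (metis One_nat_def le_trans not_less_eq_eq order.trans power_increasing power_one_right)
    moreover have "?q powi (k + 1) > 0" using q by (simp add: zero_less_power_int)
    ultimately have "inverse (absv x ^ m) \<le> inverse (?q powi (k + 1))"
      by (intro le_imp_inverse_le)
    then show ?thesis by (simp only: absv_inverse absv_power power_int_minus)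
  qed
  have "finite {x\<in>L - {0}. absv (inverse (x ^ m)) > ?q powi (- k)}" for k
  proof -
    have "{x\<in>L - {0}. absv (inverse (x ^ m)) > ?q powi (- k)} \<subseteq> trunc L (max 0 k)"
    proof safe
      fix x assume x: "x \<in> L" "x \<notin> {}" "x \<noteq> 0" "?q powi (- k) < absv (inverse (x ^ m))"
      show "absv x \<le> ?q powi (max 0 k)"
      proof (rule ccontr)
        assume "\<not> absv x \<le> ?q powi (max 0 k)"
        then have "absv (inverse (x ^ m)) \<le> ?q powi (- (max 0 k + 1))" using key x by auto
        also have "\<dots> \<le> ?q powi (- k)" using q by (intro power_int_increasing) auto
        finally show False using x by simp
      qed
    qed
    then show ?thesis using finite_ballsD[OF assms(1)] finite_subset by blast
  qed
  then show ?thesis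
    unfolding Ssum_def inv_sum_def
    by (rule infsum_fls_approx) (use finite_ballsD[OF assms(1)] key assms(3) in auto)
qed


text \<open>The residue field is the field of constants, so a scalar multiple of \<open>x\<close>
  cancels the leading coefficient of \<open>y\<close>. The reduction arguments below rest on
  this.\<close>

lemma ex_smaller_absv_diff:
  fixes x y :: "'a::{finite,field} fls"
  assumes "x \<noteq> 0" "absv y \<le> absv x"
  shows "\<exists>c. absv (y - fls_const c * x) < absv x"
proof -
  let ?n = "fls_subdegree x"
  define c where "c = fls_nth y ?n / fls_nth x ?n"
  let ?z = "y - fls_const c * x"
  have ax: "absv x = real CARD('a) powi (- ?n)" using assms(1) by (simp add: absv_def)
  have "fls_nth ?z k = 0" if "k < ?n + 1" for k
  proof (cases "k = ?n")
    case True
    then show ?thesis using assms(1) by (simp add: c_def)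
  next
    case False
    then have "k < ?n" using that by simp
    then show ?thesis using assms(2) unfolding ax absv_le_card_powi_iff by simp
  qed
  then have "absv ?z \<le> real CARD('a) powi (- (?n + 1))"
    unfolding absv_le_card_powi_iff by blast
  then have "absv ?z < real CARD('a) powi (- (?n + 1) + 1)" unfolding absv_less_powi_iff .
  then show ?thesis unfolding ax by auto
qed

lemma trunc_image_scale:
  fixes L :: "'a::{finite,field} fls set"
  assumes "l \<noteq> 0"
  shows "trunc ((*) l ` L) (n - fls_subdegree l) = (*) l ` trunc L n"
proof -
  have "absv l = real CARD('a) powi (- fls_subdegree l)" using assms by (simp add: absv_def)
  moreover have "real CARD('a) powi (n - fls_subdegree l) =
      real CARD('a) powi (- fls_subdegree l) * real CARD('a) powi n"
    using card_real_gt_1[where 'a='a] by (subst power_int_add[symmetric]) (auto simp: algebra_simps)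
  moreover have "real CARD('a) powi (- fls_subdegree l) > 0"
    using card_real_gt_1[where 'a='a] by (simp add: zero_less_power_int)
  ultimately show ?thesis by (auto simp: absv_mult)
qed

lemma finite_balls_image_scale:
  fixes L :: "'a::{finite,field} fls set"
  assumes "finite_balls L" "l \<noteq> 0"
  shows "finite_balls ((*) l ` L)"
  unfolding finite_balls_def
proof
  fix n :: int
  have "trunc ((*) l ` L) n = (*) l ` trunc L (n + fls_subdegree l)"
    using trunc_image_scale[OF assms(2), of L "n + fls_subdegree l"] by simp
  then show "finite (trunc ((*) l ` L) n)"
    using finite_ballsD[OF assms(1)] by simp
qed

lemma powi_arbitrarily_small:
  fixes e :: real
  assumes "e > 0"
  obtains n :: nat where "real CARD('a::{finite,field}) powi (- int n) < e"
proof -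
  have "\<exists>n. (1 / real CARD('a)) ^ n < e"
    by (rule real_arch_pow_inv[OF assms]) (use card_real_gt_1[where 'a='a] in simp)
  then obtain n where "(1 / real CARD('a)) ^ n < e" by blast
  then show thesis
    using that[of n] by (simp add: power_int_minus power_divide inverse_eq_divide)
qed

lemma Ssum_image_scale:
  fixes L :: "'a::{finite,field} fls set"
  assumes "finite_balls L" "m \<ge> 1" "l \<noteq> 0"
  shows "Ssum ((*) l ` L) m = inverse (l ^ m) * Ssum L m"
proof (rule ccontr)
  let ?q = "real CARD('a)"
  let ?k = "inverse (l ^ m)" and ?s = "- fls_subdegree l"
  let ?d = "Ssum ((*) l ` L) m - ?k * Ssum L m"
  assume "Ssum ((*) l ` L) m \<noteq> ?k * Ssum L m"
  then have d: "?d \<noteq> 0" by simp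
  have k: "absv ?k > 0" using assms(3) by simp
  have q: "?q > 1" by (rule card_real_gt_1)
  \<comment> \<open>Both truncation errors are to be smaller than |?d|, one of them after
    multiplication by \<open>?k\<close>; then \<open>?d\<close>, being their difference, would be
    smaller than itself.\<close>
  define e where "e = min (absv ?d) (absv ?d / absv ?k)"
  have "e > 0" using d k assms(3) by (simp add: e_def)
  then obtain n0 where n0: "?q powi (- int n0) < e"
    using powi_arbitrarily_small[where 'a='a] by blast
  define n where "n = int n0 + \<bar>?s\<bar>"
  have "?q powi k < e" if "k \<le> - int n0" for k
    using n0 power_int_increasing[OF that, of ?q] q by simp
  then have small: "?q powi (- (n + 1)) < e" "?q powi (- (n + ?s + 1)) < e"
    by (auto simp: n_def)
  let ?S = "inv_sum (trunc L n) m"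
  have "trunc ((*) l ` L) (n + ?s) = (*) l ` trunc L n" using trunc_image_scale[OF assms(3)] by simp
  then have S: "inv_sum (trunc ((*) l ` L) (n + ?s)) m = ?k * ?S"
    using inv_sum_image_scale[OF assms(3)] by simp
  have "absv (Ssum ((*) l ` L) m - ?k * ?S) \<le> ?q powi (- (n + ?s + 1))"
    using Ssum_approx[OF finite_balls_image_scale[OF assms(1,3)] assms(2), of "n + ?s"] S
    by (simp add: n_def)
  then have 1: "absv (Ssum ((*) l ` L) m - ?k * ?S) < absv ?d" using small by (simp add: e_def)
  have "absv (Ssum L m - ?S) \<le> ?q powi (- (n + 1))"
    using Ssum_approx[OF assms(1,2), of n] by (simp add: n_def)
  then have "absv (Ssum L m - ?S) < absv ?d / absv ?k" using small by (simp add: e_def)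
  then have "absv ?k * absv (Ssum L m - ?S) < absv ?d"
    using k by (simp only: less_divide_eq mult.commute if_True)
  then have 2: "absv (?k * (Ssum L m - ?S)) < absv ?d" by (simp only: absv_mult)
  have d_eq: "?d = (Ssum ((*) l ` L) m - ?k * ?S) - ?k * (Ssum L m - ?S)"
    by (simp only: right_diff_distrib) simp
  have "absv ?d \<le> max (absv (Ssum ((*) l ` L) m - ?k * ?S)) (absv (?k * (Ssum L m - ?S)))"
    by (subst d_eq) (rule absv_diff_le)
  then show False using 1 2 by simp
qed

text \<open>Numerator and denominator of the quotient of power sums are homogeneous of the same
  weight q^2 - 1 = (q - 1)(q + 1), so the scaling factor cancels.\<close>

lemma jinv_image_scale:
  fixes L :: "'a::{finite,field} fls set"
  assumes "finite_balls L" "l \<noteq> 0"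
  shows "jinv ((*) l ` L) = jinv L"
proof -
  let ?q = "CARD('a)"
  have q: "?q \<ge> 2" by (rule card_finite_field_ge2)
  have q1: "?q - 1 \<ge> 1" "?q\<^sup>2 - 1 \<ge> 1" using q one_less_power[of ?q 2] by auto
  have e: "(?q - 1) * (?q + 1) = ?q\<^sup>2 - 1"
    using q by (simp add: power2_eq_square algebra_simps)
  have "Ssum ((*) l ` L) (?q\<^sup>2 - 1) / Ssum ((*) l ` L) (?q - 1) ^ (?q + 1) =
      (inverse (l ^ (?q\<^sup>2 - 1)) * Ssum L (?q\<^sup>2 - 1)) / (inverse (l ^ (?q\<^sup>2 - 1)) * Ssum L (?q - 1) ^ (?q + 1))"
    unfolding Ssum_image_scale[OF assms(1) q1(1) assms(2)] Ssum_image_scale[OF assms(1) q1(2) assms(2)]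
      power_mult_distrib power_inverse power_mult[symmetric] e ..
  also have "\<dots> = Ssum L (?q\<^sup>2 - 1) / Ssum L (?q - 1) ^ (?q + 1)" using assms(2) by simp
  finally show ?thesis by (simp only: jinv_def Let_def)
qed

section \<open>The discriminant of a lattice\<close>

text \<open>
  The quantity on the left converges to the denominator of the invariant when \<open>V\<close> and \<open>V'\<close>
  exhaust a lattice; the right-hand side has no cancellation, so its absolute value can be
  computed. The identity comes from writing \<open>exp_fun V' (T z)\<close> as a polynomial of degree \<open>q\<^sup>2\<close> in
  \<open>exp_fun M z\<close> and evaluating it at \<open>z = \<lambda>\<close>.
\<close>

lemma discriminant_identity:
  fixes M :: "'a::{finite,field} fls set"
  defines "q \<equiv> CARD('a)"
  assumes M: "finite M" "fq_subspace M" and lam: "lam \<notin> M" and V: "V = adjoin M lam"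
    and y1: "y1 \<notin> M" and y2: "y2 \<notin> adjoin M y1"
    and V': "V' = (*) Tx ` adjoin (adjoin M y1) y2"
  shows "Tx ^ q\<^sup>2 * exp_coeff2 V' - Tx * exp_coeff2 V - (Tx ^ q * exp_coeff1 V' - Tx * exp_coeff1 V) * exp_coeff1 V ^ q
    = exp_fun V' (Tx * lam) / exp_fun M lam ^ q\<^sup>2"
proof -
  have q: "q \<ge> 2" unfolding q_def by (rule card_finite_field_ge2)
  let ?M1 = "adjoin M y1"
  have M1: "finite ?M1" "fq_subspace ?M1" using M fq_subspace_adjoin by auto
  define u where "u = exp_fun M lam"
  \<comment> \<open>With e = \<open>exp_fun M\<close> one has \<open>exp_fun V\<close> = e - \<mu>
    e^q, which vanishes at \<open>lam\<close>. Modulo this relation and its q-th power the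
    polynomial in e reduces to a multiple of e^(q^2), and the coefficient is the left-hand side of
    the claim.\<close>
  define \<mu> where "\<mu> = inverse (u ^ (q - 1))"
  define W1 where "W1 = inverse (exp_fun M y1 ^ (q - 1))"
  define W2 where "W2 = inverse (exp_fun ?M1 y2 ^ (q - 1))"
  define a1 where "a1 = exp_coeff1 M"
  define a2 where "a2 = exp_coeff2 M"
  have u: "u \<noteq> 0" using M lam by (simp add: u_def exp_fun_eq_0_iff)
  have aV: "exp_coeff1 V = a1 - \<mu>" "exp_coeff2 V = a2 - \<mu> * a1 ^ q"
    using exp_coeff_adjoin[OF M lam] by (simp_all add: V q_def \<mu>_def u_def a1_def a2_def)
  let ?U = "adjoin ?M1 y2"
  have aU: "exp_coeff1 ?U = a1 - W1 - W2" "exp_coeff2 ?U = a2 - W1 * a1 ^ q - W2 * (a1 - W1) ^ q"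
    using exp_coeff_adjoin[OF M y1] exp_coeff_adjoin[OF M1 y2]
    by (simp_all add: q_def W1_def W2_def a1_def a2_def)
  have scale: "inv_sum V' k = inverse (Tx ^ k) * inv_sum ?U k" for k
    unfolding V' by (rule inv_sum_image_scale) simp
  have q1: "(q - 1) * (q + 1) = q\<^sup>2 - 1" using q by (simp add: power2_eq_square algebra_simps)
  have S1: "exp_coeff1 V' = inverse (Tx ^ (q - 1)) * exp_coeff1 ?U"
    unfolding exp_coeff1_def q_def scale ..
  have S2: "exp_coeff2 V' = inverse (Tx ^ (q\<^sup>2 - 1)) * exp_coeff2 ?U"
    unfolding exp_coeff2_def q_def[symmetric] scale power_mult_distrib power_inverse power_mult[symmetric] q1
    by (simp add: distrib_left)
  have pT: "Tx ^ Suc n * inverse (Tx ^ n) = (Tx :: 'a fls)" for n by simp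
  have "Suc (q - 1) = q" "Suc (q\<^sup>2 - 1) = q\<^sup>2" using q by auto
  then have T1: "Tx ^ q * exp_coeff1 V' = Tx * exp_coeff1 ?U" and T2: "Tx ^ q\<^sup>2 * exp_coeff2 V' = Tx * exp_coeff2 ?U"
    unfolding S1 S2 mult.assoc[symmetric] using pT[of "q - 1"] pT[of "q\<^sup>2 - 1"] by simp_all
  have eU: "exp_fun ?U lam = (u - u ^ q * W1) - (u - u ^ q * W1) ^ q * W2"
    using exp_fun_adjoin[OF M y1] exp_fun_adjoin[OF M1 y2] by (simp add: u_def q_def W1_def W2_def)
  have e: "exp_fun V' (Tx * lam) = Tx * exp_fun ?U lam"
    unfolding V' by (subst exp_fun_image_scale) simp_all
  have fr: "(x - y) ^ q = x ^ q - y ^ q" for x y :: "'a fls"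
    unfolding q_def by (rule frobenius_fls_diff)
  have qq: "(x ^ q) ^ q = x ^ q\<^sup>2" for x :: "'a fls" by (simp add: power_mult power2_eq_square)
  have m1: "u ^ q / u ^ q\<^sup>2 = \<mu> ^ q"
  proof -
    have "q + q * (q - 1) = q\<^sup>2" using q by (simp add: power2_eq_square algebra_simps)
    then have "u ^ q\<^sup>2 = u ^ q * (u ^ (q - 1)) ^ q"
      by (metis power_add power_mult mult.commute)
    then show ?thesis using u by (simp add: \<mu>_def power_inverse field_simps)
  qed
  have m2: "u / u ^ q\<^sup>2 = \<mu> * \<mu> ^ q"
  proof -
    have "u ^ q = u * u ^ (q - 1)" using q by (metis Suc_diff_1 less_le_trans pos2 power_Suc)
    then have "u / u ^ q = \<mu>"
      using u by (simp add: \<mu>_def field_simps)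
    moreover have "u / u ^ q\<^sup>2 = (u / u ^ q) * (u ^ q / u ^ q\<^sup>2)" using u by simp
    ultimately show ?thesis using m1 by simp
  qed
  have "exp_fun V' (Tx * lam) / u ^ q\<^sup>2 =
      Tx * (u / u ^ q\<^sup>2 - (W1 + W2) * (u ^ q / u ^ q\<^sup>2) + W2 * W1 ^ q * (u ^ q\<^sup>2 / u ^ q\<^sup>2))"
    unfolding e eU fr power_mult_distrib qq by (simp add: diff_divide_distrib add_divide_distrib algebra_simps)
  also have "\<dots> = Tx * (\<mu> * \<mu> ^ q - (W1 + W2) * \<mu> ^ q + W2 * W1 ^ q)"
    unfolding m1 m2 using u by simp
  also have "\<dots> = Tx * exp_coeff2 ?U - Tx * exp_coeff2 V - (Tx * exp_coeff1 ?U - Tx * exp_coeff1 V) * exp_coeff1 V ^ q"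
    unfolding aV aU fr by (simp add: algebra_simps)
  finally show ?thesis unfolding T1 T2 u_def by simp
qed

text \<open>A factor 1 - z/v with |z| < |v| has absolute value 1, so only vectors no longer than
  \<open>z\<close> matter.\<close>

lemma absv_exp_fun_restrict:
  assumes "finite V" "V0 \<subseteq> V" "\<And>v. v \<in> V - V0 \<Longrightarrow> absv z < absv v"
  shows "absv (exp_fun V z) = absv (exp_fun V0 z)"
proof -
  have "(\<Prod>v\<in>V - {0}. absv (1 - z / v)) = (\<Prod>v\<in>V0 - {0}. absv (1 - z / v))"
  proof (rule prod.mono_neutral_right)
    show "\<forall>v\<in>V - {0} - (V0 - {0}). absv (1 - z / v) = 1"
    proof
      fix v assume "v \<in> V - {0} - (V0 - {0})"
      then have "absv (z / v) < 1" using assms(3)[of v] by (auto simp: absv_divide)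
      then show "absv (1 - z / v) = 1" using absv_diff_eq_left[of "z / v" 1] by simp
    qed
  qed (use assms in auto)
  then show ?thesis by (simp add: exp_fun_def absv_mult absv_prod)
qed

text \<open>The situation after rescaling. \<open>codim1\<close> says that the x in \<open>L\<close>
  with T x in \<open>L\<close> form a subspace of codimension one, with \<open>lam\<close> spanning
  a complement. \<open>degrees\<close> makes each large ball exactly q times as big as the preceding
  one, on which the index count in \<open>Z_eq\<close> relies.\<close>

locale normalised_lattice =
  fixes L :: "'a::{finite,field} fls set" and lam :: "'a fls"
  assumes fq_subspace: "fq_subspace L" and finite_balls: "finite_balls L"
    and one: "1 \<in> L" and minimal: "\<And>x. x \<in> L \<Longrightarrow> x \<noteq> 0 \<Longrightarrow> absv x \<ge> 1"
    and lam: "lam \<in> L" "Tx * lam \<notin> L"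
    and codim1: "\<And>x. x \<in> L \<Longrightarrow> \<exists>c. Tx * (x - fls_const c * lam) \<in> L"
    and degrees: "\<exists>n0. \<forall>n\<ge>n0. \<exists>x\<in>L. absv x = real CARD('a) powi n"
begin

text \<open>The kernel, on a ball, of x |-> T x modulo \<open>L\<close>: a truncation of the
  subspace M of the overview.\<close>

definition ker :: "int \<Rightarrow> 'a fls set" where
  "ker n = {x \<in> trunc L n. Tx * x \<in> L}"

lemma finite_trunc: "finite (trunc L n)" using finite_balls by (rule finite_ballsD)

lemma finite_ker [simp]: "finite (ker n)"
  unfolding ker_def using finite_trunc[of n] by (rule rev_finite_subset) auto

lemma absv_scale_le: "absv (fls_const c * x) \<le> absv x" for x :: "'a fls"
  by (cases "c = 0") (auto simp: absv_mult)

lemma fq_subspace_trunc: "fq_subspace (trunc L n)"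
proof (rule fq_subspaceI)
  show "0 \<in> trunc L n" using fq_subspace_0[OF fq_subspace] by (simp add: zero_le_power_int)
  show "x + y \<in> trunc L n" if "x \<in> trunc L n" "y \<in> trunc L n" for x y
    using that fq_subspace_add[OF fq_subspace] absv_add_le[of x y] by (auto simp: max_def split: if_splits)
  show "fls_const c * x \<in> trunc L n" if "x \<in> trunc L n" for c x
    using that fq_subspace_scale[OF fq_subspace] absv_scale_le[of c x] by auto
qed

lemma fq_subspace_ker: "fq_subspace (ker n)"
proof (rule fq_subspaceI)
  show "0 \<in> ker n" using fq_subspace_0[OF fq_subspace_trunc] fq_subspace_0[OF fq_subspace] by (auto simp: ker_def)
  show "x + y \<in> ker n" if "x \<in> ker n" "y \<in> ker n" for x y
    using that fq_subspace_add[OF fq_subspace_trunc[of n], of x y] fq_subspace_add[OF fq_subspace, of "Tx * x" "Tx * y"]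
    by (auto simp: ker_def distrib_left)
  show "fls_const c * x \<in> ker n" if "x \<in> ker n" for c x
    using that fq_subspace_scale[OF fq_subspace_trunc[of n], of x c] fq_subspace_scale[OF fq_subspace, of "Tx * x" c]
    by (auto simp: ker_def mult.left_commute)
qed

lemma lam_not_ker: "lam \<notin> ker n"
  using lam by (simp add: ker_def)

lemma trunc_eq_adjoin_ker:
  assumes "absv lam \<le> real CARD('a) powi n"
  shows "trunc L n = adjoin (ker n) lam"
proof (rule set_eqI)
  fix x
  have lb: "lam \<in> trunc L n" using lam assms by simp
  show "x \<in> trunc L n \<longleftrightarrow> x \<in> adjoin (ker n) lam"
  proof
    assume x: "x \<in> trunc L n"
    then obtain c where "Tx * (x - fls_const c * lam) \<in> L" using codim1 by blast
    moreover have "x - fls_const c * lam \<in> trunc L n"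
      using fq_subspace_diff[OF fq_subspace_trunc x fq_subspace_scale[OF fq_subspace_trunc lb]] .
    ultimately have "x - fls_const c * lam \<in> ker n" by (simp add: ker_def)
    then show "x \<in> adjoin (ker n) lam" unfolding in_adjoin_iff_diff by blast
  next
    have "ker n \<subseteq> trunc L n" by (auto simp: ker_def)
    then show "x \<in> adjoin (ker n) lam \<Longrightarrow> x \<in> trunc L n"
      using adjoin_subset[OF fq_subspace_trunc _ lb] by blast
  qed
qed

lemma card_trunc_Suc:
  assumes "x \<in> L" "absv x = real CARD('a) powi (n + 1)"
  shows "card (trunc L (n + 1)) = CARD('a) * card (trunc L n)"
proof -
  have xb: "x \<notin> trunc L n" using absv_less_powi_iff[of x n] assms by auto
  have "trunc L (n + 1) = adjoin (trunc L n) x"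
  proof (rule set_eqI)
    fix y
    show "y \<in> trunc L (n + 1) \<longleftrightarrow> y \<in> adjoin (trunc L n) x"
    proof
      assume y: "y \<in> trunc L (n + 1)"
      have "x \<noteq> 0" using assms card_real_gt_1[where 'a='a] by auto
      then obtain c where "absv (y - fls_const c * x) < absv x"
        using ex_smaller_absv_diff[of x y] y assms by auto
      then have "absv (y - fls_const c * x) \<le> real CARD('a) powi n"
        using assms by (simp add: absv_less_powi_iff)
      moreover have "y - fls_const c * x \<in> L"
        using y assms by (intro fq_subspace_diff[OF fq_subspace] fq_subspace_scale[OF fq_subspace]) auto
      ultimately show "y \<in> adjoin (trunc L n) x" unfolding in_adjoin_iff_diff by blast
    next
      have "trunc L n \<subseteq> trunc L (n + 1)"
        using card_real_gt_1[where 'a='a] power_int_increasing[of n "n + 1" "real CARD('a)"] by force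
      then show "y \<in> adjoin (trunc L n) x \<Longrightarrow> y \<in> trunc L (n + 1)"
        using adjoin_subset[OF fq_subspace_trunc[of "n + 1"], of "trunc L n" x] assms by auto
    qed
  qed
  then show ?thesis using card_adjoin[OF fq_subspace_trunc xb] by simp
qed

text \<open>The right-hand side of \<open>discriminant_identity\<close> for balls of radius q^n and
  q^(n+1); the second radius is larger because multiplication by T raises the degree by one.\<close>

definition Z :: "int \<Rightarrow> 'a fls" where
  "Z n = exp_fun (trunc L (n + 1)) (Tx * lam) / exp_fun (ker n) lam ^ (CARD('a))\<^sup>2"

text \<open>\<open>discriminant_identity\<close> applies once \<open>ker n\<close> has codimension
  exactly two in T^(-1) times the ball of radius q^(n+1). One dimension comes from the passage from
  radius q^n to q^(n+1), the other from \<open>lam\<close>.\<close>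

lemma Z_eq:
  assumes n: "absv lam \<le> real CARD('a) powi n" and x: "x \<in> L" "absv x = real CARD('a) powi (n + 1)"
  shows "Z n = Tx ^ (CARD('a))\<^sup>2 * exp_coeff2 (trunc L (n + 1)) - Tx * exp_coeff2 (trunc L n)
    - (Tx ^ CARD('a) * exp_coeff1 (trunc L (n + 1)) - Tx * exp_coeff1 (trunc L n)) * exp_coeff1 (trunc L n) ^ CARD('a)"
proof -
  let ?U = "(*) (inverse Tx) ` trunc L (n + 1)"
  have TU: "(*) Tx ` ?U = trunc L (n + 1)" by (simp add: image_image mult.assoc[symmetric])
  have finU: "finite ?U" using finite_trunc by simp
  have subU: "fq_subspace ?U"
  proof (rule fq_subspaceI)
    show "0 \<in> ?U" using fq_subspace_0[OF fq_subspace_trunc] by (intro image_eqI[of _ _ 0]) simp_all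
  next
    fix x y assume "x \<in> ?U" "y \<in> ?U"
    then obtain x' y' where "x = inverse Tx * x'" "y = inverse Tx * y'"
      and b: "x' \<in> trunc L (n + 1)" "y' \<in> trunc L (n + 1)" by blast
    then have "x + y = inverse Tx * (x' + y')" by (simp add: distrib_left)
    then show "x + y \<in> ?U" using fq_subspace_add[OF fq_subspace_trunc b] by (rule image_eqI)
  next
    fix c x assume "x \<in> ?U"
    then obtain x' where "x = inverse Tx * x'" and b: "x' \<in> trunc L (n + 1)" by blast
    then have "fls_const c * x = inverse Tx * (fls_const c * x')" by (simp add: mult.left_commute)
    then show "fls_const c * x \<in> ?U" using fq_subspace_scale[OF fq_subspace_trunc b] by (rule image_eqI)
  qed
  have kerU: "ker n \<subseteq> ?U"
  proof
    fix y assume y: "y \<in> ker n"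
    have "absv (Tx * y) \<le> real CARD('a) powi (n + 1)"
      using y card_real_gt_1[where 'a='a] by (simp add: ker_def absv_mult power_int_add mult.commute mult_left_mono)
    then show "y \<in> ?U" using y by (intro image_eqI[of _ _ "Tx * y"]) (auto simp: ker_def mult.assoc[symmetric])
  qed
  have bk: "trunc L n = adjoin (ker n) lam" by (rule trunc_eq_adjoin_ker[OF n])
  have "card ?U = card (trunc L (n + 1))" by (rule card_image) (auto simp: inj_on_def)
  also have "\<dots> = CARD('a) * (CARD('a) * card (ker n))"
    using card_trunc_Suc[OF x] card_adjoin[OF fq_subspace_ker lam_not_ker] by (simp add: bk)
  finally have cU: "card ?U = CARD('a) * (CARD('a) * card (ker n))" .
  have q: "CARD('a) \<ge> 2" by (rule card_finite_field_ge2)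
  have ck: "card (ker n) > 0"
    using fq_subspace_0[OF fq_subspace_ker] by (auto simp: card_gt_0_iff)
  have "q1 * card (ker n) > card (ker n)" if "q1 \<ge> 2" for q1
    using ck that by simp
  then have lt: "card (ker n) < CARD('a) * card (ker n)" using q .
  then have "CARD('a) * card (ker n) < card ?U" using cU q by simp
  then have "ker n \<noteq> ?U" using lt by auto
  then obtain y1 where y1: "y1 \<in> ?U" "y1 \<notin> ker n" using kerU by blast
  let ?U1 = "adjoin (ker n) y1"
  have U1: "?U1 \<subseteq> ?U" by (rule adjoin_subset[OF subU kerU y1(1)])
  have cU1: "card ?U1 = CARD('a) * card (ker n)" by (rule card_adjoin[OF fq_subspace_ker y1(2)])
  have "?U1 \<noteq> ?U" using cU cU1 ck q by auto
  then obtain y2 where y2: "y2 \<in> ?U" "y2 \<notin> ?U1" using U1 by blast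
  have "adjoin ?U1 y2 \<subseteq> ?U" by (rule adjoin_subset[OF subU U1 y2(1)])
  moreover have "card (adjoin ?U1 y2) = card ?U"
    using card_adjoin[OF fq_subspace_adjoin[OF fq_subspace_ker] y2(2)] cU cU1 by simp
  ultimately have "adjoin ?U1 y2 = ?U" using finU by (intro card_subset_eq)
  then have "trunc L (n + 1) = (*) Tx ` adjoin ?U1 y2" using TU by simp
  from discriminant_identity[OF finite_ker fq_subspace_ker lam_not_ker bk y1(2) y2(2) this]
  show ?thesis unfolding Z_def by simp
qed

lemma trunc_mono: "m \<le> n \<Longrightarrow> trunc L m \<subseteq> trunc L n"
  using card_real_gt_1[where 'a='a] power_int_increasing[of m n "real CARD('a)"] by force

text \<open>Vectors longer than T lam do not affect the numerator, and vectors longer than lam do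
  not affect the denominator, so enlarging the radius changes neither absolute value.\<close>

lemma absv_Z_const:
  assumes "absv lam \<le> real CARD('a) powi k" "k \<le> n"
  shows "absv (Z n) = absv (Z k)"
proof -
  have "absv (Tx * lam) \<le> real CARD('a) powi (k + 1)"
    using assms(1) card_real_gt_1[where 'a='a] by (simp add: absv_mult power_int_add mult.commute mult_left_mono)
  then have "absv (exp_fun (trunc L (n + 1)) (Tx * lam)) = absv (exp_fun (trunc L (k + 1)) (Tx * lam))"
    using trunc_mono[of "k + 1" "n + 1"] assms(2) by (intro absv_exp_fun_restrict finite_trunc) auto
  moreover have "absv (exp_fun (ker n) lam) = absv (exp_fun (ker k) lam)"
    using trunc_mono[of k n] assms by (intro absv_exp_fun_restrict finite_ker) (auto simp: ker_def)
  ultimately show ?thesis by (simp add: Z_def absv_divide absv_power)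
qed

lemma Z_nonzero: "Z n \<noteq> 0"
  using exp_fun_eq_0_iff[OF finite_trunc fq_subspace_trunc, of "n + 1" "Tx * lam"] lam(2)
    exp_fun_eq_0_iff[OF finite_ker fq_subspace_ker, of n lam] lam_not_ker
  by (simp add: Z_def)

lemma trunc_0: "trunc L 0 = range fls_const"
proof (intro equalityI subsetI)
  fix x assume x: "x \<in> trunc L 0"
  then obtain c where c: "absv (x - fls_const c * 1) < absv 1"
    using ex_smaller_absv_diff[of 1 x] by auto
  moreover have "x - fls_const c * 1 \<in> L"
    using x by (intro fq_subspace_diff[OF fq_subspace] fq_subspace_scale[OF fq_subspace] one) auto
  ultimately have "x - fls_const c * 1 = 0" using minimal by fastforce
  then show "x \<in> range fls_const" by simp
next
  fix x :: "'a fls" assume "x \<in> range fls_const"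
  then obtain c where "x = fls_const c * 1" by auto
  then show "x \<in> trunc L 0" using fq_subspace_scale[OF fq_subspace one, of c] absv_const_le[of c] by simp
qed

text \<open>The nonzero constants contribute q - 1 = -1. As all other lattice vectors are longer,
  this leading term shows that the full power sum of index q - 1 has absolute value 1.\<close>

lemma inv_sum_trunc_0: "inv_sum (trunc L 0) (CARD('a) - 1) = -1"
proof -
  have "range fls_const - {0} = (fls_const ` (UNIV - {0}) :: 'a fls set)"
    by (auto simp: fls_const_nonzero)
  then have "inv_sum (trunc L 0) (CARD('a) - 1) = (\<Sum>c\<in>UNIV - {0::'a}. inverse (fls_const c ^ (CARD('a) - 1)))"
    unfolding inv_sum_def trunc_0 by (simp only: ) (subst sum.reindex, auto simp: inj_on_def)
  also have "\<dots> = (\<Sum>c\<in>UNIV - {0::'a}. 1)"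
    by (rule sum.cong[OF refl], subst fls_const_power_card_minus_1) auto
  also have "\<dots> = of_nat (CARD('a) - 1)" by (simp add: card_Diff_singleton)
  also have "\<dots> = of_nat CARD('a) - 1"
    using card_finite_field_ge2[where 'a='a] by (simp add: of_nat_diff)
  finally show ?thesis by (simp add: card_eq_0_fls)
qed

text \<open>|T^q - T| = q^q and |S1| = 1 account for the exponent q (q + 1). What remains is
  |\<Delta>|, where \<Delta> is the limit of \<open>Z n\<close>; a limit of elements of constant
  nonzero absolute value has that same absolute value.\<close>

lemma absv_jinv:
  assumes k: "absv lam \<le> real CARD('a) powi k" "k \<ge> 0"
  shows "absv (jinv L) = real CARD('a) ^ ((CARD('a))\<^sup>2 + CARD('a)) / absv (Z k)"
proof -
  define q where "q = CARD('a)"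
  have q: "q \<ge> 2" unfolding q_def by (rule card_finite_field_ge2)
  have rq: "real q > 1" using q by simp
  have q1: "q - 1 \<ge> 1" "q\<^sup>2 - 1 \<ge> 1" using q one_less_power[of q 2] by auto
  define D where "D = (Tx ^ q - Tx :: 'a fls)"
  define S1 where "S1 = Ssum L (q - 1)"
  define S2 where "S2 = Ssum L (q\<^sup>2 - 1)"
  define A2 where "A2 = S2 + S1 ^ (q + 1)"
  define \<Delta> where "\<Delta> = (Tx ^ q\<^sup>2 - Tx) * A2 - D * (S1 * S1 ^ q)"
  have fr: "(x - y) ^ q = x ^ q - y ^ q" for x y :: "'a fls"
    unfolding q_def by (rule frobenius_fls_diff)
  have qq: "(x ^ q) ^ q = x ^ q\<^sup>2" for x :: "'a fls" by (simp add: power_mult power2_eq_square)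
  have avD: "absv D = real q ^ q"
  proof -
    have "real q ^ 1 < real q ^ q" using rq q by (intro power_strict_increasing) auto
    then show ?thesis unfolding D_def
      by (subst absv_diff_eq_left) (auto simp: absv_power q_def)
  qed
  then have D0: "D \<noteq> 0" using rq by auto
  have avS1: "absv S1 = 1"
  proof -
    have "absv (S1 - (-1)) \<le> real CARD('a) powi (- (0 + 1))"
      using Ssum_approx[OF finite_balls q1(1)[unfolded q_def], of 0] inv_sum_trunc_0 by (simp add: S1_def q_def)
    also have "\<dots> < 1" using card_real_gt_1[where 'a='a] by (simp add: power_int_minus field_simps)
    finally have "absv (S1 - (-1)) < absv (-1 :: 'a fls)" by simp
    then have "absv ((S1 - (-1)) + (-1)) = absv (-1 :: 'a fls)" by (rule absv_add_eq_right)
    then show ?thesis by simp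
  qed
  then have S10: "S1 \<noteq> 0" by auto
  have TD: "Tx ^ q\<^sup>2 - Tx = D ^ q + D" unfolding D_def fr qq by simp
  have jinv: "jinv L = inverse (\<Delta> / (D * S1) ^ (q + 1))"
  proof -
    have "inverse D + (D ^ q + D) / D ^ (q + 1) * (S2 / S1 ^ (q + 1)) =
        (D ^ q * S1 ^ (q + 1) + (D ^ q + D) * S2) / (D * S1) ^ (q + 1)"
      using D0 S10 by (simp add: field_simps)
    also have "D ^ q * S1 ^ (q + 1) + (D ^ q + D) * S2 = \<Delta>"
      unfolding \<Delta>_def TD A2_def by (simp add: algebra_simps)
    finally have "inverse D + (D ^ q + D) / D ^ (q + 1) * (S2 / S1 ^ (q + 1)) = \<Delta> / (D * S1) ^ (q + 1)" .
    moreover have "jinv L = inverse (inverse D + (Tx ^ q\<^sup>2 - Tx) / D ^ (q + 1) * (S2 / S1 ^ (q + 1)))"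
      by (simp only: jinv_def Let_def D_def S1_def S2_def q_def)
    ultimately show ?thesis unfolding TD by simp
  qed
  have absv\<Delta>: "absv \<Delta> = absv (Z k)"
  proof -
    \<comment> \<open>The size of T^(q^2), the largest coefficient in \<open>Z n\<close> - \<Delta>.
      All power sums are accurate up to \<epsilon>, so the total error is at most C
      \<epsilon>.\<close>
    define C where "C = real q ^ q\<^sup>2"
    have C: "C \<ge> real q" "C > 0" "C \<ge> real q ^ q" "C \<ge> 1"
      using rq q power_increasing[of 1 "q\<^sup>2" "real q"] power_increasing[of q "q\<^sup>2" "real q"]
      by (auto simp: C_def power2_eq_square one_le_power)
    have "absv (Z k) / C > 0" using Z_nonzero C by simp
    then obtain n0 where n0: "real q powi (- int n0) < absv (Z k) / C"
      using powi_arbitrarily_small[where 'a='a] unfolding q_def by blast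
    obtain n1 where n1: "\<And>n. n \<ge> n1 \<Longrightarrow> \<exists>x\<in>L. absv x = real CARD('a) powi n"
      using degrees by blast
    define n where "n = max (int n0) (max n1 k)"
    have n: "n \<ge> int n0" "n \<ge> n1" "n \<ge> k" by (auto simp: n_def)
    define \<epsilon> where "\<epsilon> = real q powi (- (n + 1))"
    have e0: "\<epsilon> > 0" using rq by (simp add: \<epsilon>_def zero_less_power_int)
    have e1: "\<epsilon> \<le> 1" using rq n k(2) power_int_increasing[of "- (n + 1)" 0 "real q"]
      by (simp add: \<epsilon>_def)
    have "\<epsilon> \<le> real q powi (- int n0)" unfolding \<epsilon>_def
      using rq n by (intro power_int_increasing) auto
    then have "C * \<epsilon> \<le> C * real q powi (- int n0)" using C(2) by (intro mult_left_mono) auto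
    also have "\<dots> < absv (Z k)" using n0 C(2) by (simp add: field_simps)
    finally have small: "C * \<epsilon> < absv (Z k)" .
    have kn: "absv lam \<le> real CARD('a) powi n"
      using k(1) n(3) card_real_gt_1[where 'a='a] by (meson order.trans power_int_increasing less_imp_le)
    obtain x where x: "x \<in> L" "absv x = real CARD('a) powi (n + 1)" using n1[of "n + 1"] n by auto
    have ap: "absv (Ssum L m - inv_sum (trunc L i) m) \<le> \<epsilon>" if "m \<ge> 1" "i \<ge> n" for m i
    proof -
      have "absv (Ssum L m - inv_sum (trunc L i) m) \<le> real CARD('a) powi (- (i + 1))"
        using that n k by (intro Ssum_approx[OF finite_balls]) auto
      also have "\<dots> \<le> \<epsilon>" unfolding \<epsilon>_def q_def
        using that card_real_gt_1[where 'a='a] by (intro power_int_increasing) auto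
      finally show ?thesis .
    qed
    have le1: "absv (x ^ m) \<le> 1" if "absv x \<le> 1" for x :: "'a fls" and m
      using that by (simp add: absv_power power_le_one)
    have leq: "absv (x ^ q) \<le> \<epsilon>" if "absv x \<le> \<epsilon>" for x :: "'a fls"
    proof -
      have "absv x ^ q \<le> \<epsilon> ^ q" using that by (intro power_mono) auto
      also have "\<dots> \<le> \<epsilon> ^ 1" using e0 e1 q by (intro power_decreasing) auto
      finally show ?thesis by (simp add: absv_power)
    qed
    have mle: "absv (x * y) \<le> r * s" if "absv x \<le> r" "absv y \<le> s" "r \<ge> 0" for x y :: "'a fls" and r s
      using that by (simp add: absv_mult mult_mono)
    have a1: "absv (exp_coeff1 (trunc L i) - S1) \<le> \<epsilon>" if "i \<ge> n" for i
      using ap[OF q1(1) that] by (simp add: exp_coeff1_def S1_def q_def absv_diff_commute)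
    have a1le: "absv (exp_coeff1 (trunc L i)) \<le> 1" if "i \<ge> n" for i
      using a1[OF that] absv_add_le[of "exp_coeff1 (trunc L i) - S1" S1] avS1 e1 by simp
    have a2: "absv (exp_coeff2 (trunc L i) - A2) \<le> \<epsilon>" if i: "i \<ge> n" for i
    proof -
      let ?s = "exp_coeff1 (trunc L i)"
      have e: "exp_coeff2 (trunc L i) - A2 = (inv_sum (trunc L i) (q\<^sup>2 - 1) - S2) + (?s ^ q * (?s - S1) + (?s - S1) ^ q * S1)"
        unfolding fr by (simp add: A2_def exp_coeff2_def q_def exp_coeff1_def algebra_simps)
      have "absv (?s ^ q * (?s - S1)) \<le> 1 * \<epsilon>" "absv ((?s - S1) ^ q * S1) \<le> \<epsilon> * 1"
        using a1[OF i] a1le[OF i] avS1 e0 by (intro mle le1 leq; simp)+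
      then have "absv (?s ^ q * (?s - S1) + (?s - S1) ^ q * S1) \<le> \<epsilon>"
        using absv_add_le order.trans by (smt (verit, best) mult_1 mult_1_right)
      moreover have "absv (inv_sum (trunc L i) (q\<^sup>2 - 1) - S2) \<le> \<epsilon>"
        using ap[OF q1(2) i] by (simp add: S2_def absv_diff_commute)
      ultimately show ?thesis unfolding e using absv_add_le by (smt (verit, best))
    qed
    define a1n where "a1n = exp_coeff1 (trunc L n)"
    define a1m where "a1m = exp_coeff1 (trunc L (n + 1))"
    define a2n where "a2n = exp_coeff2 (trunc L n)"
    define a2m where "a2m = exp_coeff2 (trunc L (n + 1))"
    have Zn: "Z n = Tx ^ q\<^sup>2 * a2m - Tx * a2n - (Tx ^ q * a1m - Tx * a1n) * a1n ^ q"
      using Z_eq[OF kn x] by (simp add: q_def a1n_def a1m_def a2n_def a2m_def)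
    have diff: "Z n - \<Delta> = (Tx ^ q\<^sup>2 * (a2m - A2) - Tx * (a2n - A2)) -
        ((Tx ^ q * (a1m - S1) - Tx * (a1n - S1)) * a1n ^ q + D * (S1 * (a1n - S1) ^ q))"
      unfolding Zn \<Delta>_def fr D_def by (simp add: algebra_simps)
    have d: "absv (a1n - S1) \<le> \<epsilon>" "absv (a1m - S1) \<le> \<epsilon>" "absv (a2n - A2) \<le> \<epsilon>" "absv (a2m - A2) \<le> \<epsilon>"
      and d1: "absv a1n \<le> 1"
      using a1 a2 a1le by (auto simp: a1n_def a1m_def a2n_def a2m_def)
    have T: "absv (Tx ^ q\<^sup>2 :: 'a fls) \<le> C" "absv (Tx :: 'a fls) \<le> C" "absv (Tx ^ q :: 'a fls) \<le> C" "absv D \<le> C"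
      using C by (auto simp: C_def absv_power q_def[symmetric] avD)
    have mx: "absv (x - y) \<le> C * \<epsilon>" "absv (x + y) \<le> C * \<epsilon>"
      if "absv x \<le> C * \<epsilon>" "absv y \<le> C * \<epsilon>" for x y :: "'a fls"
      using that absv_diff_le[of x y] absv_add_le[of x y] by (auto simp: le_max_iff_disj intro: order.trans)
    have p: "absv (Tx ^ q * (a1m - S1) - Tx * (a1n - S1)) \<le> C * \<epsilon>"
      using T d C by (intro mx mle) auto
    have p2: "absv (Tx ^ q\<^sup>2 * (a2m - A2)) \<le> C * \<epsilon>" "absv (Tx * (a2n - A2)) \<le> C * \<epsilon>"
      using T d C by (intro mle; simp)+
    have "absv ((Tx ^ q * (a1m - S1) - Tx * (a1n - S1)) * a1n ^ q) \<le> (C * \<epsilon>) * 1"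
      using p le1[OF d1] C e0 by (intro mle) auto
    moreover have "absv (S1 * (a1n - S1) ^ q) \<le> 1 * \<epsilon>"
      using avS1 leq[OF d(1)] by (intro mle) auto
    then have "absv (D * (S1 * (a1n - S1) ^ q)) \<le> C * \<epsilon>"
      using T C by (intro mle) auto
    ultimately have "absv (Z n - \<Delta>) \<le> C * \<epsilon>"
      unfolding diff using p2 by (intro mx) auto
    also have "\<dots> < absv (Z n)" using small absv_Z_const[OF k(1) n(3)] by simp
    finally have "absv (Z n - \<Delta>) < absv (Z n)" .
    then have "absv (Z n - (Z n - \<Delta>)) = absv (Z n)" by (rule absv_diff_eq_left)
    then show ?thesis using absv_Z_const[OF k(1) n(3)] by simp
  qed
  have "absv (jinv L) = (real q ^ q * 1) ^ (q + 1) / absv (Z k)"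
    unfolding jinv by (simp add: absv_inverse absv_divide absv_power absv_mult avD avS1 absv\<Delta> )
  also have "(real q ^ q * 1) ^ (q + 1) = real q ^ (q\<^sup>2 + q)"
    by (simp add: power_mult[symmetric] power_add power2_eq_square)
  finally show ?thesis by (simp add: q_def)
qed

end

section \<open>Polynomials of bounded degree and the exact size of their exponential
  function\<close>

fun low_degree :: "nat \<Rightarrow> 'a::{finite,field} fls set" where
  "low_degree 0 = {0}"
| "low_degree (Suc m) = adjoin (low_degree m) (Tx ^ m)"

text \<open>The exponent of q in |\<open>exp_fun (low_degree m)\<close> (T^m)|: the case s = m of
  \<open>absv_exp_fun_low_degree\<close>.\<close>

definition geom_exp :: "nat \<Rightarrow> nat \<Rightarrow> nat" where
  "geom_exp q m = (\<Sum>i\<in>{1..m}. q ^ i)"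

lemma geom_exp_0 [simp]: "geom_exp q 0 = 0"
  and geom_exp_Suc [simp]: "geom_exp q (Suc m) = geom_exp q m + q ^ Suc m"
  by (simp_all add: geom_exp_def)

lemma finite_low_degree [simp]: "finite (low_degree m)"
  by (induction m) auto

lemma fq_subspace_low_degree: "fq_subspace (low_degree m)"
  by (induction m) (auto simp: fq_subspace_zero fq_subspace_adjoin)

lemma absv_Tx_power: "absv (Tx ^ m :: 'a::{finite,field} fls) = real CARD('a) ^ m"
  by (simp add: absv_power)

lemma low_degree_absv_less: "x \<in> low_degree m \<Longrightarrow> absv (x :: 'a::{finite,field} fls) < real CARD('a) ^ m"
proof (induction m arbitrary: x)
  case (Suc m)
  let ?q = "real CARD('a)"
  obtain c v where x: "v \<in> low_degree m" "x = v + fls_const c * Tx ^ m"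
    using Suc.prems by (auto simp: in_adjoin_iff)
  have "absv x \<le> max (absv v) (absv (fls_const c * Tx ^ m))" unfolding x(2) by (rule absv_add_le)
  also have "\<dots> \<le> ?q ^ m"
    using Suc.IH[OF x(1)] by (cases "c = 0") (auto simp: absv_mult absv_Tx_power)
  also have "\<dots> < ?q ^ Suc m" using card_real_gt_1[where 'a='a] by (intro power_strict_increasing) auto
  finally show ?case .
qed simp

lemma Tx_power_not_low_degree: "Tx ^ m \<notin> (low_degree m :: 'a::{finite,field} fls set)"
  using low_degree_absv_less[of "Tx ^ m" m] by (auto simp: absv_Tx_power)

lemma low_degree_subset:
  assumes "fq_subspace L" "\<And>j. j < m \<Longrightarrow> Tx ^ j \<in> L"
  shows "low_degree m \<subseteq> L"
  using assms(2)
proof (induction m)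
  case 0
  then show ?case using fq_subspace_0[OF assms(1)] by simp
next
  case (Suc m)
  then show ?case using adjoin_subset[OF assms(1), of "low_degree m" "Tx ^ m"] by auto
qed

text \<open>Each nonzero polynomial v of degree below m contributes the factor |y / v|, since |v| <
  |y|. The proof counts these through the recursion, in which the q-th power term dominates.\<close>

lemma absv_exp_fun_low_degree:
  fixes y :: "'a::{finite,field} fls"
  assumes "absv y = real CARD('a) ^ s" "m \<le> s"
  shows "absv (exp_fun (low_degree m) y) = real CARD('a) ^ ((s - m) * CARD('a) ^ m + geom_exp CARD('a) m)"
  using assms
proof (induction m arbitrary: s y)
  case (Suc m)
  let ?q = "CARD('a)"
  have q: "?q \<ge> 2" by (rule card_finite_field_ge2)
  let ?E = "(s - m) * ?q ^ m + geom_exp ?q m"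
  let ?w = "exp_fun (low_degree m) (Tx ^ m) :: 'a fls"
  have y: "absv (exp_fun (low_degree m) y) = real ?q ^ ?E" using Suc.prems by (intro Suc.IH) auto
  have w: "absv ?w = real ?q ^ geom_exp ?q m" using Suc.IH[of "Tx ^ m" m] by (simp add: absv_Tx_power)
  have E: "?E \<ge> geom_exp ?q m" "?E > geom_exp ?q m" using Suc.prems by auto
  have s: "s - m = Suc (s - Suc m)" using Suc.prems by simp
  obtain r where r: "?q = Suc r" using q by (metis Suc_diff_1 less_le_trans pos2)
  have F: "?E + (?q - 1) * (?E - geom_exp ?q m) = (s - Suc m) * ?q ^ Suc m + geom_exp ?q (Suc m)"
    unfolding s geom_exp_Suc r by (simp add: algebra_simps)
  have main: "absv (exp_fun (low_degree m) y ^ ?q * inverse (?w ^ (?q - 1))) = real ?q ^ (?E + (?q - 1) * (?E - geom_exp ?q m))"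
  proof -
    have "real ?q ^ (?E + (?q - 1) * (?E - geom_exp ?q m)) * (real ?q ^ geom_exp ?q m) ^ (?q - 1) = (real ?q ^ ?E) ^ ?q"
    proof -
      have dist: "a + b * (a - c) + c * b = a + b * a" if "c \<le> a" for a b c :: nat
      proof -
        have "b * (a - c) + c * b = b * ((a - c) + c)" by (simp only: distrib_left mult.commute)
        then show ?thesis using that by simp
      qed
      have "?E + (?q - 1) * (?E - geom_exp ?q m) + geom_exp ?q m * (?q - 1) = ?E + (?q - 1) * ?E"
        using E(1) by (rule dist)
      also have "\<dots> = ?E * ?q" by (simp only: r diff_Suc_1 mult_Suc_right mult_Suc mult.commute)
      finally show ?thesis by (simp only: power_add[symmetric] power_mult[symmetric])
    qed
    moreover have "(real ?q ^ geom_exp ?q m) ^ (?q - 1) > 0" using q by simp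
    ultimately show ?thesis
      by (simp only: absv_mult absv_inverse absv_power y w) (simp add: field_simps)
  qed
  have "real ?q ^ ?E < real ?q ^ (?E + (?q - 1) * (?E - geom_exp ?q m))"
    using q E by (intro power_strict_increasing) auto
  then show ?case
    unfolding low_degree.simps exp_fun_adjoin[OF finite_low_degree fq_subspace_low_degree Tx_power_not_low_degree]
    by (subst absv_diff_eq_right) (simp_all only: y main F)
qed simp

text \<open>Replacing \<open>z\<close> by its difference \<open>?y\<close> to a nearest vector does
  not change \<open>exp_fun V\<close>. Then no factor 1 - ?y/v is smaller than 1 in absolute value,
  which leaves |?y| as a lower bound.\<close>

lemma absv_exp_fun_ge:
  fixes z :: "'a::{finite,field} fls"
  assumes V: "finite V" "fq_subspace V" and min: "\<And>v. v \<in> V \<Longrightarrow> v \<noteq> 0 \<Longrightarrow> absv v \<ge> 1"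
    and r: "\<And>v. v \<in> V \<Longrightarrow> r \<le> absv (z - v)"
  shows "r \<le> absv (exp_fun V z)"
proof -
  have "V \<noteq> {}" using fq_subspace_0[OF V(2)] by auto
  then obtain v0 where v0: "v0 \<in> V" "\<And>v. v \<in> V \<Longrightarrow> absv (z - v0) \<le> absv (z - v)"
    using ex_min_if_finite[of "(\<lambda>v. absv (z - v)) ` V"] V(1)
    by (metis (no_types, lifting) arg_min_least arg_min_if_finite(1))
  let ?y = "z - v0"
  have ge: "1 \<le> absv (1 - ?y / v)" if v: "v \<in> V - {0}" for v
  proof (cases "absv ?y < absv v")
    case True
    then have "absv (?y / v) < 1" using v by (simp add: absv_divide)
    then show ?thesis using absv_diff_eq_left[of "?y / v" 1] by simp
  next
    \<comment> \<open>Here \<open>v0 + v\<close> is another vector of \<open>V\<close>, hence not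
      closer to \<open>z\<close> than \<open>v0\<close>; this bounds |v - ?y| from below by
      |?y|.\<close>
    case False
    have "absv v \<le> absv ?y" using False by simp
    also have "\<dots> \<le> absv (z - (v0 + v))" using v v0(1) by (intro v0(2) fq_subspace_add[OF V(2)]) auto
    also have "z - (v0 + v) = v * - (1 - ?y / v)" using v by (simp add: field_simps)
    also have "absv \<dots> = absv v * absv (1 - ?y / v)" by (simp only: absv_mult absv_minus)
    finally show ?thesis using v by simp
  qed
  have "exp_fun V z = exp_fun V ?y" using v0(1) by (simp add: exp_fun_diff[OF V] iffD2[OF exp_fun_eq_0_iff[OF V]])
  also have "absv \<dots> = absv ?y * (\<Prod>v\<in>V - {0}. absv (1 - ?y / v))"
    by (simp add: exp_fun_def absv_mult absv_prod)
  finally have "absv (exp_fun V z) = absv ?y * (\<Prod>v\<in>V - {0}. absv (1 - ?y / v))" .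
  moreover have "1 \<le> (\<Prod>v\<in>V - {0}. absv (1 - ?y / v))" using ge by (rule prod_ge_1)
  then have "absv ?y * 1 \<le> absv ?y * (\<Prod>v\<in>V - {0}. absv (1 - ?y / v))" by (intro mult_left_mono) auto
  ultimately show ?thesis using r[OF v0(1)] by simp
qed

context normalised_lattice
begin

lemma trunc_subset_low_degree:
  assumes T: "\<And>j. j \<le> m \<Longrightarrow> Tx ^ j \<in> L" and "x \<in> trunc L (int j)" "j \<le> m"
  shows "x \<in> low_degree (Suc j)"
  using assms(2,3)
proof (induction j arbitrary: x)
  case 0
  then obtain c where "x = fls_const c" using trunc_0 by auto
  then show ?case using adjoinI[of 0 "{0}" c 1] by simp
next
  case (Suc j)
  have "absv x \<le> real CARD('a) ^ Suc j"
    using Suc.prems(1) by (simp only: mem_Collect_eq power_int_of_nat)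
  then have "absv x \<le> absv (Tx ^ Suc j :: 'a fls)" by (simp only: absv_Tx_power)
  then obtain c where c: "absv (x - fls_const c * Tx ^ Suc j) < absv (Tx ^ Suc j :: 'a fls)"
    using ex_smaller_absv_diff[of "Tx ^ Suc j" x] by auto
  then have "absv (x - fls_const c * Tx ^ Suc j) < real CARD('a) powi (int j + 1)"
    by (simp add: absv_mult absv_power power_int_add mult.commute)
  then have "x - fls_const c * Tx ^ Suc j \<in> trunc L (int j)"
    using Suc.prems T[of "Suc j"] by (auto simp: absv_less_powi_iff intro!: fq_subspace_diff[OF fq_subspace] fq_subspace_scale[OF fq_subspace])
  then have "x - fls_const c * Tx ^ Suc j \<in> low_degree (Suc j)" using Suc by auto
  then show ?case unfolding low_degree.simps(2)[of "Suc j"] in_adjoin_iff_diff by blast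
qed

text \<open>Vectors of length at most q^m are polynomials of degree at most m. A nonzero coefficient
  at T^m would put T^(m+1) into \<open>L\<close>, because the lower powers stay in \<open>L\<close>
  after multiplication by T.\<close>

lemma ker_eq_low_degree:
  assumes m: "lam = Tx ^ m" and T: "\<And>j. j \<le> m \<Longrightarrow> Tx ^ j \<in> L"
  shows "ker (int m) = low_degree m"
proof (intro equalityI subsetI)
  note * = trunc_subset_low_degree[OF T]
  have mul: "Tx * v \<in> L" if "v \<in> low_degree m" for v
  proof -
    have "fq_subspace {x\<in>L. Tx * x \<in> L}"
      using fq_subspace_0[OF fq_subspace] fq_subspace_add[OF fq_subspace] fq_subspace_scale[OF fq_subspace]
      by (intro fq_subspaceI) (auto simp: distrib_left mult.left_commute[of Tx "fls_const _"])
    then have "low_degree m \<subseteq> {x\<in>L. Tx * x \<in> L}"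
      by (rule low_degree_subset) (use T[of "Suc _"] T in auto)
    then show ?thesis using that by auto
  qed
  fix x :: "'a fls"
  {
    assume x: "x \<in> ker (int m)"
    then have "x \<in> low_degree (Suc m)" using * by (auto simp: ker_def)
    then obtain c v where v: "v \<in> low_degree m" "x = v + fls_const c * Tx ^ m" by (auto simp: in_adjoin_iff)
    have "Tx * x - Tx * v \<in> L" using x mul[OF v(1)] by (intro fq_subspace_diff[OF fq_subspace]) (auto simp: ker_def)
    moreover have "Tx * x - Tx * v = fls_const c * (Tx * lam)" by (simp add: v(2) m algebra_simps)
    ultimately have "c = 0" using fq_subspace_scale_iff[OF fq_subspace, of c] lam(2) by metis
    then show "x \<in> low_degree m" using v by simp
  }
  {
    assume x: "x \<in> low_degree m"
    have "absv x \<le> real CARD('a) powi int m" using low_degree_absv_less[OF x] by simp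
    moreover have "x \<in> L" using low_degree_subset[OF fq_subspace, of m] T x by (auto simp: less_imp_le)
    ultimately show "x \<in> ker (int m)" using mul[OF x] by (simp add: ker_def)
  }
qed

lemma absv_jinv_power:
  assumes m: "lam = Tx ^ m" and T: "\<And>j. j \<le> m \<Longrightarrow> Tx ^ j \<in> L"
  shows "absv (jinv L) = real CARD('a) ^ ((CARD('a))\<^sup>2 + CARD('a) + geom_exp CARD('a) m * (CARD('a))\<^sup>2)
    / absv (exp_fun (trunc L (int m + 1)) (Tx ^ Suc m))"
proof -
  have "absv (exp_fun (ker (int m)) lam) = real CARD('a) ^ geom_exp CARD('a) m"
    using absv_exp_fun_low_degree[of "Tx ^ m" m m] by (simp add: ker_eq_low_degree[OF m T] m absv_Tx_power)
  then have "absv (Z (int m)) = absv (exp_fun (trunc L (int m + 1)) (Tx ^ Suc m)) / real CARD('a) ^ (geom_exp CARD('a) m * (CARD('a))\<^sup>2)"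
    unfolding Z_def absv_divide absv_power by (simp add: m power_mult)
  moreover have "absv (jinv L) = real CARD('a) ^ ((CARD('a))\<^sup>2 + CARD('a)) / absv (Z (int m))"
    by (rule absv_jinv) (auto simp: m absv_Tx_power)
  ultimately show ?thesis by (simp add: power_add)
qed

lemma absv_jinv_le:
  assumes m: "lam = Tx ^ m" and T: "\<And>j. j \<le> m \<Longrightarrow> Tx ^ j \<in> L"
    and e: "\<And>x. x \<in> L \<Longrightarrow> absv (Tx ^ Suc m - x) \<ge> inverse (real CARD('a) ^ e)"
  shows "absv (jinv L) \<le> real CARD('a) ^ ((CARD('a))\<^sup>2 + CARD('a) + geom_exp CARD('a) m * (CARD('a))\<^sup>2 + e)"
proof -
  have q: "real CARD('a) > 0" using card_real_gt_1[where 'a='a] by simp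
  let ?n = "(CARD('a))\<^sup>2 + CARD('a) + geom_exp CARD('a) m * (CARD('a))\<^sup>2"
  have ge: "inverse (real CARD('a) ^ e) \<le> absv (exp_fun (trunc L (int m + 1)) (Tx ^ Suc m))"
    by (rule absv_exp_fun_ge[OF finite_trunc fq_subspace_trunc]) (use minimal e in auto)
  have pos: "0 < absv (exp_fun (trunc L (int m + 1)) (Tx ^ Suc m))"
    by (rule less_le_trans[OF _ ge]) (use q in simp)
  have "absv (jinv L) = real CARD('a) ^ ?n / absv (exp_fun (trunc L (int m + 1)) (Tx ^ Suc m))"
    using m T by (rule absv_jinv_power)
  also have "\<dots> \<le> real CARD('a) ^ ?n / inverse (real CARD('a) ^ e)"
    by (rule divide_left_mono[OF ge _ mult_pos_pos[OF pos]]) (use q in auto)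
  finally have "absv (jinv L) \<le> real CARD('a) ^ ?n / inverse (real CARD('a) ^ e)" .
  then show ?thesis by (simp add: power_add field_simps)
qed

end

section \<open>The quadratic field and its ring of integers\<close>

lemma polyA_pCons: "polyA (pCons c p) = fls_const c + Tx * polyA p"
  by (cases "c = 0 \<and> p = 0") (auto simp: polyA_def map_poly_pCons)

lemma polyA_0 [simp]: "polyA 0 = 0" by (simp add: polyA_def)

lemma polyA_const: "polyA [:c:] = fls_const c"
  using polyA_pCons[of c 0] by simp

lemma polyA_1 [simp]: "polyA 1 = 1"
  using polyA_const[of 1] by (simp add: one_pCons)

lemma polyA_add: "polyA (p + r) = polyA p + polyA r"
proof (induction p arbitrary: r)
  case (pCons c p)
  obtain e s where r: "r = pCons e s" by (cases r)
  show ?case unfolding r by (simp add: polyA_pCons pCons.IH algebra_simps fls_plus_const[symmetric])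
qed simp

lemma polyA_smult: "polyA (smult c p) = fls_const c * polyA p"
  by (induction p) (simp_all add: polyA_pCons distrib_left mult.left_commute)

lemma polyA_mult: "polyA (p * r) = polyA p * polyA r"
  by (induction p) (simp_all add: polyA_pCons polyA_add polyA_smult algebra_simps)

lemma polyA_minus: "polyA (- p) = - polyA p"
  using polyA_add[of p "- p"] by (simp add: add_eq_0_iff)

lemma polyA_diff: "polyA (p - r) = polyA p - polyA r"
  using polyA_add[of p "- r"] by (simp add: polyA_minus)

lemma polyA_monom: "polyA (monom c n) = fls_const c * Tx ^ n"
  by (induction n) (simp_all add: monom_0 monom_Suc polyA_pCons polyA_const mult.left_commute)

lemma absv_polyA:
  fixes p :: "'a::{finite,field} poly"
  assumes "p \<noteq> 0"
  shows "absv (polyA p) = real CARD('a) ^ degree p"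
  using assms
proof (induction p)
  case (pCons c p)
  show ?case
  proof (cases "p = 0")
    case True
    then show ?thesis using pCons by (simp add: polyA_const)
  next
    case False
    have "absv (fls_const c) < absv (Tx * polyA p)"
      using False pCons.IH card_real_gt_1[where 'a='a] absv_const_le[of c]
      by (auto simp: absv_mult intro!: less_le_trans[OF le_less_trans[OF absv_const_le, of "real CARD('a)"]]
        simp del: of_nat_power)
    then show ?thesis using False pCons.IH by (simp add: polyA_pCons absv_add_eq_right absv_mult)
  qed
qed simp

lemma polyA_eq_0_iff [simp]: "polyA p = 0 \<longleftrightarrow> p = (0 :: 'a::{finite,field} poly)"
  using absv_polyA[of p] card_real_gt_1[where 'a='a] by (cases "p = 0") auto

lemma polyA_sum:
  fixes p :: "'a::{finite,field} poly"
  assumes "degree p \<le> n"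
  shows "polyA p = (\<Sum>j\<le>n. fls_const (coeff p j) * Tx ^ j)"
proof -
  from assms
  have "p = (\<Sum>j\<le>n. monom (coeff p j) j)" by (simp add: poly_as_sum_of_monoms')
  moreover have "polyA (\<Sum>j\<in>A. g j) = (\<Sum>j\<in>A. polyA (g j))" for A :: "nat set" and g :: "nat \<Rightarrow> 'a poly"
    by (induction A rule: infinite_finite_induct) (auto simp: polyA_add)
  ultimately have "polyA p = (\<Sum>j\<le>n. polyA (monom (coeff p j) j))" by metis
  then show ?thesis by (simp only: polyA_monom)
qed

lemma ksetI: "r \<noteq> 0 \<Longrightarrow> x = polyA p / polyA r \<Longrightarrow> x \<in> (kset :: 'a::{finite,field} fls set)"
  unfolding kset_def Aset_def by (intro CollectI exI[of _ "polyA p"] exI[of _ "polyA r"], simp)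

lemma ksetE:
  assumes "x \<in> (kset :: 'a::{finite,field} fls set)"
  obtains p r where "r \<noteq> 0" "x = polyA p / polyA r"
  using assms unfolding kset_def Aset_def by auto

lemma kset_polyA: "polyA p \<in> (kset :: 'a::{finite,field} fls set)"
  by (rule ksetI[of 1 _ p]) auto

lemma kset_const: "fls_const c \<in> (kset :: 'a::{finite,field} fls set)"
  using kset_polyA[of "[:c:]"] by (simp add: polyA_const)

lemma kset_Tx_power: "Tx ^ n \<in> (kset :: 'a::{finite,field} fls set)"
  using kset_polyA[of "monom 1 n"] by (simp add: polyA_monom)

lemma kset_0: "0 \<in> (kset :: 'a::{finite,field} fls set)"
  using kset_polyA[of 0] by simp

lemma kset_1: "1 \<in> (kset :: 'a::{finite,field} fls set)"
  using kset_polyA[of 1] by simp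

lemma kset_add:
  assumes "x \<in> (kset :: 'a::{finite,field} fls set)" "y \<in> kset"
  shows "x + y \<in> kset"
proof -
  obtain p r p' r' where r: "r \<noteq> 0" "r' \<noteq> 0" and x: "x = polyA p / polyA r" "y = polyA p' / polyA r'"
    using assms by (metis ksetE)
  show ?thesis
    by (rule ksetI[of "r * r'" _ "p * r' + p' * r"])
       (use r in \<open>auto simp: x polyA_add polyA_mult add_frac_eq\<close>)
qed

lemma kset_mult:
  assumes "x \<in> (kset :: 'a::{finite,field} fls set)" "y \<in> kset"
  shows "x * y \<in> kset"
proof -
  obtain p r p' r' where r: "r \<noteq> 0" "r' \<noteq> 0" and x: "x = polyA p / polyA r" "y = polyA p' / polyA r'"
    using assms by (metis ksetE)
  show ?thesis
    by (rule ksetI[of "r * r'" _ "p * p'"]) (use r in \<open>auto simp: x polyA_mult\<close>)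
qed

lemma kset_minus: "x \<in> (kset :: 'a::{finite,field} fls set) \<Longrightarrow> - x \<in> kset"
  using kset_mult[OF kset_const[of "- 1"], of x] by simp

lemma kset_diff: "x \<in> (kset :: 'a::{finite,field} fls set) \<Longrightarrow> y \<in> kset \<Longrightarrow> x - y \<in> kset"
  using kset_add[of x "- y"] kset_minus[of y] by simp

lemma kset_inverse:
  assumes "x \<in> (kset :: 'a::{finite,field} fls set)"
  shows "inverse x \<in> kset"
proof (cases "x = 0")
  case True
  then show ?thesis using kset_0 by simp
next
  case False
  obtain p r where r: "r \<noteq> 0" and x: "x = polyA p / polyA r" using assms by (rule ksetE)
  show ?thesis by (rule ksetI[of p _ r]) (use False x in auto)
qed

lemma kset_divide: "x \<in> (kset :: 'a::{finite,field} fls set) \<Longrightarrow> y \<in> kset \<Longrightarrow> x / y \<in> kset"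
  using kset_mult[of x "inverse y"] kset_inverse[of y] by (simp add: divide_inverse)

lemmas kset_intros = kset_polyA kset_const kset_Tx_power kset_0 kset_1 kset_add kset_mult kset_minus
  kset_diff kset_inverse kset_divide

locale quad =
  fixes f :: "'a::{finite,field} fls" and a :: "'a poly" and b :: 'a and d :: nat
  assumes d: "d \<ge> 1" and deg_a: "degree a = d" and monic: "lead_coeff a = 1" and b: "b \<noteq> 0"
    and f_eq: "f ^ 2 = polyA a * f + fls_const b"
    and f_k: "f \<notin> kset" and f_deg: "fls_subdegree f = - int d"
begin

abbreviation "R \<equiv> Ainf1 f d"
abbreviation "K \<equiv> Kset f"
abbreviation "f' \<equiv> polyA a - f"

lemma f_nonzero: "f \<noteq> 0" using f_k kset_0 by auto

lemma absv_f: "absv f = real CARD('a) ^ d"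
  using f_nonzero f_deg by (simp add: absv_def)

lemma f_f': "f * f' = - fls_const b"
  using f_eq by (simp add: algebra_simps power2_eq_square)

lemma f'_eq: "f' * f' = polyA a * f' + fls_const b"
  using f_f' by (simp add: algebra_simps)

lemma absv_f': "absv f' = inverse (real CARD('a) ^ d)"
proof -
  have "absv f * absv f' = 1" using f_f' b by (simp add: absv_mult[symmetric])
  then show ?thesis by (metis absv_f inverse_unique)
qed

lemma card_power_gt_1: "real CARD('a) ^ d > 1"
  using card_real_gt_1[where 'a='a] d by (intro one_less_power) auto

lemma absv_f_minus_f': "absv (f - f') = real CARD('a) ^ d"
proof -
  have "absv f' < absv f"
    unfolding absv_f absv_f' using card_power_gt_1 by (simp add: field_simps less_1_mult)
  then have "absv (f - f') = absv f" by (rule absv_diff_eq_left)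
  then show ?thesis by (simp add: absv_f)
qed

lemma K_rep_unique:
  assumes "u + v * f = u' + v' * f" "u \<in> kset" "v \<in> kset" "u' \<in> kset" "v' \<in> kset"
  shows "u = u' \<and> v = v'"
proof (rule ccontr)
  assume n: "\<not> (u = u' \<and> v = v')"
  then have "v \<noteq> v'" using assms(1) by auto
  have "(v - v') * f = u' - u" using assms(1) by (simp add: algebra_simps)
  then have "f = (u' - u) / (v - v')" using \<open>v \<noteq> v'\<close> by (simp add: field_simps)
  then show False using f_k assms kset_intros by metis
qed

text \<open>The nontrivial automorphism of K over k, given through the unique coordinates with
  respect to 1 and f. As f' also lies in k_infinity, x |-> |cnjg x| is the absolute value at the
  second infinite place.\<close>

definition cnjg :: "'a fls \<Rightarrow> 'a fls" where
  "cnjg x = (THE y. \<exists>u\<in>kset. \<exists>v\<in>kset. x = u + v * f \<and> y = u + v * f')"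

lemma cnjg_eq: "u \<in> kset \<Longrightarrow> v \<in> kset \<Longrightarrow> cnjg (u + v * f) = u + v * f'"
  unfolding cnjg_def using K_rep_unique by (intro the_equality) blast+

lemma KI: "u \<in> kset \<Longrightarrow> v \<in> kset \<Longrightarrow> u + v * f \<in> K"
  unfolding Kset_def by auto

lemma KE: 
  assumes "x \<in> K"
  obtains u v where "u \<in> kset" "v \<in> kset" "x = u + v * f" "cnjg x = u + v * f'"
  using assms cnjg_eq unfolding Kset_def by auto

lemma K_kset: "u \<in> kset \<Longrightarrow> u \<in> K" and cnjg_kset: "u \<in> kset \<Longrightarrow> cnjg u = u"
  using KI[of u 0] cnjg_eq[of u 0] kset_0 by auto

lemma K_f: "f \<in> K" and cnjg_f: "cnjg f = f'"
  using KI[of 0 1] cnjg_eq[of 0 1] kset_0 kset_1 by auto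

lemma K_add_cnjg:
  assumes "x \<in> K" "y \<in> K"
  shows "x + y \<in> K \<and> cnjg (x + y) = cnjg x + cnjg y"
proof -
  obtain u v where x: "u \<in> kset" "v \<in> kset" "x = u + v * f" "cnjg x = u + v * f'"
    using assms(1) by (rule KE)
  obtain u' v' where y: "u' \<in> kset" "v' \<in> kset" "y = u' + v' * f" "cnjg y = u' + v' * f'"
    using assms(2) by (rule KE)
  have k: "u + u' \<in> kset" "v + v' \<in> kset" using x y by (intro kset_intros; simp)+
  have "x + y = (u + u') + (v + v') * f" unfolding x(3) y(3) by (simp add: algebra_simps)
  moreover have "cnjg x + cnjg y = (u + u') + (v + v') * f'" unfolding x(4) y(4) by (simp add: algebra_simps)
  ultimately show ?thesis using KI[OF k] cnjg_eq[OF k] by simp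
qed

lemma K_mult_cnjg:
  assumes "x \<in> K" "y \<in> K"
  shows "x * y \<in> K \<and> cnjg (x * y) = cnjg x * cnjg y"
proof -
  obtain u v where x: "u \<in> kset" "v \<in> kset" "x = u + v * f" "cnjg x = u + v * f'"
    using assms(1) by (rule KE)
  obtain u' v' where y: "u' \<in> kset" "v' \<in> kset" "y = u' + v' * f" "cnjg y = u' + v' * f'"
    using assms(2) by (rule KE)
  let ?U = "u * u' + v * v' * fls_const b" and ?V = "u * v' + v * u' + v * v' * polyA a"
  have ring: "(u + v * g) * (u' + v' * g) = ?U + ?V * g" if "g * g = polyA a * g + fls_const b" for g
  proof -
    have "(u + v * g) * (u' + v' * g) = u * u' + (u * v' + v * u') * g + v * v' * (g * g)"
      by (simp add: algebra_simps)
    then show ?thesis unfolding that by (simp add: algebra_simps)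
  qed
  have k: "?U \<in> kset" "?V \<in> kset" using x y by (intro kset_intros; simp)+
  have "x * y = ?U + ?V * f" unfolding x(3) y(3) by (rule ring) (use f_eq in \<open>simp add: power2_eq_square\<close>)
  moreover have "cnjg x * cnjg y = ?U + ?V * f'" unfolding x(4) y(4) by (rule ring[OF f'_eq])
  ultimately show ?thesis using KI[OF k] cnjg_eq[OF k] by simp
qed

lemmas K_add = K_add_cnjg[THEN conjunct1] and cnjg_add = K_add_cnjg[THEN conjunct2]
lemmas K_mult = K_mult_cnjg[THEN conjunct1] and cnjg_mult = K_mult_cnjg[THEN conjunct2]

lemma K_Tx_power: "Tx ^ n \<in> K" and cnjg_Tx_power: "cnjg (Tx ^ n) = Tx ^ n"
  using K_kset[OF kset_Tx_power] cnjg_kset[OF kset_Tx_power] by auto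

lemma K_Tx: "Tx \<in> K" and cnjg_Tx: "cnjg Tx = Tx"
  using K_Tx_power[of 1] cnjg_Tx_power[of 1] by auto

lemma K_const: "fls_const c \<in> K" and cnjg_const: "cnjg (fls_const c) = fls_const c"
  using K_kset[OF kset_const] cnjg_kset[OF kset_const] by auto

lemma K_polyA: "polyA p \<in> K" and cnjg_polyA: "cnjg (polyA p) = polyA p"
  using K_kset[OF kset_polyA] cnjg_kset[OF kset_polyA] by auto

lemma K_minus: "x \<in> K \<Longrightarrow> - x \<in> K" and cnjg_minus: "x \<in> K \<Longrightarrow> cnjg (- x) = - cnjg x"
  using K_mult[OF K_const[of "-1"], of x] cnjg_mult[OF K_const[of "-1"], of x] cnjg_const[of "-1"] by auto

lemma cnjg_diff: "x \<in> K \<Longrightarrow> y \<in> K \<Longrightarrow> cnjg (x - y) = cnjg x - cnjg y"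
  using K_add[of x "- y"] cnjg_add[of x "- y"] K_minus[of y] cnjg_minus[of y] by auto

lemma K_power: "x \<in> K \<Longrightarrow> x ^ n \<in> K" and cnjg_power: "x \<in> K \<Longrightarrow> cnjg (x ^ n) = cnjg x ^ n"
  using K_kset[OF kset_1] cnjg_kset[OF kset_1]
  by (induction n) (auto simp: K_mult cnjg_mult)

lemma cnjg_eq_0_iff:
  assumes "x \<in> K" shows "cnjg x = 0 \<longleftrightarrow> x = 0"
proof
  assume s: "cnjg x = 0"
  obtain u v where x: "u \<in> kset" "v \<in> kset" "x = u + v * f" "cnjg x = u + v * f'"
    using assms by (rule KE)
  have eq: "(u + v * polyA a) + (- v) * f = 0 + 0 * f" using s x(4) by (simp add: algebra_simps)
  have "u + v * polyA a = 0 \<and> - v = 0"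
    by (rule K_rep_unique[OF eq]) (use x(1,2) in \<open>auto intro!: kset_intros\<close>)
  then have "v = 0" "u = 0" by auto
  then show "x = 0" using x(3) by simp
qed (use cnjg_kset[OF kset_0] in simp)

lemma K_inverse:
  assumes "x \<in> K" shows "inverse x \<in> K"
proof (cases "x = 0")
  case True
  then show ?thesis using K_kset[OF kset_0] by simp
next
  case False
  obtain u v where x: "u \<in> kset" "v \<in> kset" "x = u + v * f" "cnjg x = u + v * f'"
    using assms by (rule KE)
  have "x * cnjg x = u * u + u * v * (f + f') + v * v * (f * f')"
    unfolding x(4) unfolding x(3) by (simp add: algebra_simps)
  also have "\<dots> = u * u + u * v * polyA a + v * v * fls_const (- b)"
    unfolding f_f' by simp
  finally have n: "x * cnjg x \<in> kset" using x by (auto intro!: kset_intros)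
  have "cnjg x = (u + v * polyA a) + (- v) * f" unfolding x(4) by (simp add: algebra_simps)
  moreover have "(u + v * polyA a) + (- v) * f \<in> K"
    using x(1,2) by (intro KI kset_intros) auto
  ultimately have "cnjg x \<in> K" by simp
  moreover have "inverse x = cnjg x * inverse (x * cnjg x)"
    using False cnjg_eq_0_iff[OF assms] by (simp add: field_simps)
  ultimately show ?thesis using K_mult K_kset kset_inverse[OF n] by metis
qed

lemma K_divide: "x \<in> K \<Longrightarrow> y \<in> K \<Longrightarrow> x / y \<in> K"
  using K_mult[of x "inverse y"] K_inverse[of y] by (simp add: divide_inverse)

lemma cnjg_divide:
  assumes "x \<in> K" "y \<in> K" "y \<noteq> 0"
  shows "cnjg (x / y) = cnjg x / cnjg y"
  using cnjg_mult[OF K_divide[OF assms(1,2)] assms(2)] assms cnjg_eq_0_iff[OF assms(2)]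
  by (simp add: field_simps)

section \<open>The order A[f] and its elements of bounded conjugate\<close>

definition Af :: "'a fls set" where
  "Af = {polyA u + polyA v * f | u v. True}"

lemma AfI: "polyA u + polyA v * f \<in> Af" by (auto simp: Af_def)

lemma Af_K: "x \<in> Af \<Longrightarrow> x \<in> K"
  unfolding Af_def using KI kset_polyA by blast

lemma cnjg_Af: "cnjg (polyA u + polyA v * f) = polyA u + polyA v * f'"
  by (intro cnjg_eq kset_polyA)

lemma Af_add: "x \<in> Af \<Longrightarrow> y \<in> Af \<Longrightarrow> x + y \<in> Af"
proof -
  assume "x \<in> Af" "y \<in> Af"
  then obtain u v u' v' where e: "x = polyA u + polyA v * f" "y = polyA u' + polyA v' * f"
    unfolding Af_def by blast
  have "x + y = polyA (u + u') + polyA (v + v') * f" unfolding e by (simp add: polyA_add algebra_simps)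
  then show ?thesis using AfI by metis
qed

lemma Af_mult: "x \<in> Af \<Longrightarrow> y \<in> Af \<Longrightarrow> x * y \<in> Af"
proof -
  assume "x \<in> Af" "y \<in> Af"
  then obtain u v u' v' where e: "x = polyA u + polyA v * f" "y = polyA u' + polyA v' * f"
    unfolding Af_def by blast
  have "x * y = polyA u * polyA u' + (polyA u * polyA v' + polyA v * polyA u') * f + polyA v * polyA v' * f\<^sup>2"
    unfolding e by (simp add: algebra_simps power2_eq_square)
  also have "\<dots> = polyA (u * u' + smult b (v * v')) + polyA (u * v' + v * u' + v * v' * a) * f"
    unfolding f_eq by (simp add: polyA_add polyA_mult polyA_smult algebra_simps)
  finally show ?thesis using AfI by metis
qed

lemma Af_polyA: "polyA u \<in> Af" using AfI[of u 0] by simp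

lemma Af_f: "f \<in> Af" using AfI[of 0 1] by simp

lemma Af_power: "x \<in> Af \<Longrightarrow> x ^ n \<in> Af"
  using Af_polyA[of 1] by (induction n) (auto simp: Af_mult)

lemma Af_Tx_power: "Tx ^ n \<in> Af"
  using Af_polyA[of "monom 1 n"] by (simp add: polyA_monom)

lemma Af_const: "fls_const c \<in> Af"
  using Af_polyA[of "[:c:]"] by (simp add: polyA_const)

lemma Af_minus: "x \<in> Af \<Longrightarrow> - x \<in> Af"
  using Af_mult[OF Af_const[of "-1"], of x] by simp

lemma f_Tx_in_Af: "f ^ k * Tx ^ j \<in> Af"
  by (intro Af_mult Af_power Af_f Af_Tx_power)

lemma cnjg_f_Tx: "cnjg (f ^ k * Tx ^ j) = f' ^ k * Tx ^ j"
  by (subst cnjg_mult) (auto simp: K_power K_f K_Tx_power cnjg_power cnjg_f cnjg_Tx_power)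

lemma absv_cnjg_f_Tx: 
  assumes "j \<le> k * d"
  shows "absv (cnjg (f ^ k * Tx ^ j)) \<le> 1"
proof -
  have "real CARD('a) ^ j \<le> real CARD('a) ^ (d * k)"
    using assms card_real_gt_1[where 'a='a] by (intro power_increasing) (auto simp: mult.commute)
  moreover have "real CARD('a) ^ (d * k) > 0" using card_real_gt_1[where 'a='a] by simp
  ultimately show ?thesis
    unfolding cnjg_f_Tx absv_mult absv_power absv_f' by (simp add: power_inverse power_mult[symmetric] field_simps)
qed

lemma absv_f_Tx: "absv (f ^ k * Tx ^ j) = real CARD('a) ^ (k * d + j)"
  by (simp add: absv_mult absv_power absv_f power_mult[symmetric] power_add mult.commute)

lemma R_subset: "x \<in> R \<Longrightarrow> x \<in> Af \<and> absv (cnjg x) \<le> 1"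
proof (induction rule: Ainf1.induct)
  case (const c)
  then show ?case using Af_const cnjg_const absv_const_le by simp
next
  case (gen i)
  then show ?case using f_Tx_in_Af[of 1 i] absv_cnjg_f_Tx[of i 1] by simp
next
  case (add x y)
  then show ?case
    using absv_add_le[of "cnjg x" "cnjg y"] by (auto simp: Af_add cnjg_add Af_K)
next
  case (mult x y)
  then show ?case by (auto simp: Af_mult cnjg_mult Af_K absv_mult mult_le_one)
next
  case (neg x)
  then show ?case by (auto simp: Af_minus cnjg_minus Af_K)
qed

lemma R_0: "0 \<in> R" and R_1: "1 \<in> R"
  using Ainf1.const[of 0 f d] Ainf1.const[of 1 f d] by auto

lemma R_power: "x \<in> R \<Longrightarrow> x ^ n \<in> R"
  using R_1 by (induction n) (auto intro: Ainf1.mult)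

text \<open>Division of \<open>n\<close> by \<open>d\<close>: the quotient is positive, so at least
  one factor f is available to turn the remaining power of T into a generator of
  \<open>R\<close>.\<close>

lemma R_f_Tx_gen:
  assumes "n \<ge> d"
  obtains g k j where "g = f ^ k * Tx ^ j" "g \<in> R" "k * d + j = n" "j < d"
proof -
  obtain k where k: "n div d = Suc k"
    using assms d by (metis div_greater_zero_iff gr0_implies_Suc less_le_trans zero_less_one)
  have "f ^ Suc k * Tx ^ (n mod d) = f ^ k * (f * Tx ^ (n mod d))" by simp
  also have "\<dots> \<in> R"
    using d Ainf1.gen[of 0 d f] by (intro Ainf1.mult R_power Ainf1.gen) auto
  finally show thesis
    using that[of _ "Suc k" "n mod d"] d k by (metis div_mult_mod_eq mod_less_divisor less_le_trans zero_less_one)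
qed

text \<open>The element differs from its conjugate by v (f - f'), of size q^(deg v + d); a smaller
  conjugate does not disturb this.\<close>

lemma Af_absv:
  assumes "v \<noteq> 0" "absv (polyA u + polyA v * f') < real CARD('a) ^ d"
  shows "absv (polyA u + polyA v * f) = real CARD('a) ^ (degree v + d)"
proof -
  have "absv (polyA v * (f - f')) = real CARD('a) ^ (degree v + d)"
    by (simp only: absv_mult absv_polyA[OF assms(1)] absv_f_minus_f' power_add)
  moreover have "real CARD('a) ^ d \<le> real CARD('a) ^ (degree v + d)"
    using card_real_gt_1[where 'a='a] by (intro power_increasing) auto
  moreover have "polyA u + polyA v * f = (polyA u + polyA v * f') + polyA v * (f - f')"
    by (simp add: algebra_simps)
  ultimately show ?thesis using assms(2) by (metis absv_add_eq_right less_le_trans)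
qed

text \<open>The degree of \<open>v\<close> is lowered by subtracting a scalar multiple of some f^k
  T^j in \<open>R\<close> of the same absolute value. For elements of small conjugate the size
  determines the degree of the f-coordinate, so equal size allows the leading coefficients to
  cancel. The measure separates v = 0 from nonzero constants.\<close>

lemma R_supset:
  assumes "absv (polyA u + polyA v * f') \<le> 1"
  shows "polyA u + polyA v * f \<in> R"
  using assms
proof (induction "if v = 0 then 0 else Suc (degree v)" arbitrary: u v rule: less_induct)
  case less
  show ?case
  proof (cases "v = 0")
    case True
    have "degree u = 0"
    proof (rule ccontr)
      assume "degree u \<noteq> 0"
      then have "u \<noteq> 0" "real CARD('a) ^ degree u > 1"
        using card_real_gt_1[where 'a='a] by (auto intro!: one_less_power)
      then show False using less.prems True absv_polyA[of u] by simp
    qed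
    then obtain c where "u = [:c:]" by (rule degree_eq_zeroE)
    then show ?thesis using True Ainf1.const by (simp add: polyA_const)
  next
    case False
    obtain g k j where g: "g = f ^ k * Tx ^ j" "g \<in> R" "k * d + j = degree v + d" "j < d"
      using R_f_Tx_gen[of "degree v + d"] by auto
    have "g \<in> Af" "absv (cnjg g) \<le> 1" using R_subset[OF g(2)] by auto
    then obtain u' v' where g2: "g = polyA u' + polyA v' * f" unfolding Af_def by blast
    then have sgg: "absv (polyA u' + polyA v' * f') \<le> 1" using \<open>absv (cnjg g) \<le> 1\<close> cnjg_Af by simp
    have avg: "absv g = real CARD('a) ^ (degree v + d)" using absv_f_Tx[of k j] g by simp
    have "real CARD('a) ^ (degree v + d) > 1"
      using card_real_gt_1[where 'a='a] d by (intro one_less_power) auto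
    have "v' \<noteq> 0"
    proof
      assume "v' = 0"
      then have "absv g \<le> 1" using g2 sgg by simp
      then show False using avg \<open>real CARD('a) ^ (degree v + d) > 1\<close> by simp
    qed
    then have "absv g = real CARD('a) ^ (degree v' + d)"
      unfolding g2 using sgg card_power_gt_1 by (intro Af_absv) auto
    then have dv: "degree v' = degree v"
      using avg card_real_gt_1[where 'a='a] by (simp add: power_inject_exp)
    define c where "c = lead_coeff v / lead_coeff v'"
    define v2 where "v2 = v - smult c v'"
    define u2 where "u2 = u - smult c u'"
    have "lead_coeff v' \<noteq> 0" using \<open>v' \<noteq> 0\<close> by simp
    then have c0: "coeff v2 (degree v) = 0" using dv by (simp add: v2_def c_def)
    have "degree v2 \<le> degree v" unfolding v2_def using dv by (intro degree_diff_le) auto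
    then have lt: "(if v2 = 0 then 0 else Suc (degree v2)) < Suc (degree v)"
      using c0 eq_zero_or_degree_less[of v2 "degree v"] by auto
    have e: "polyA u2 + polyA v2 * h = (polyA u + polyA v * h) - fls_const c * (polyA u' + polyA v' * h)" for h
      by (simp add: u2_def v2_def polyA_diff polyA_smult algebra_simps)
    have "absv (fls_const c * (polyA u' + polyA v' * f')) \<le> 1"
      using sgg absv_const_le[of c] by (auto simp: absv_mult intro: mult_le_one)
    then have "absv (polyA u2 + polyA v2 * f') \<le> 1"
      unfolding e using less.prems absv_diff_le by (meson max.boundedI order.trans)
    then have "polyA u2 + polyA v2 * f \<in> R" using less.hyps[of v2 u2] lt False by auto
    moreover have "fls_const c * g \<in> R" using g(2) by (intro Ainf1.mult Ainf1.const)
    ultimately have "(polyA u2 + polyA v2 * f) + fls_const c * g \<in> R" by (rule Ainf1.add)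
    then show ?thesis unfolding e g2 by simp
  qed
qed

lemma R_iff: "x \<in> R \<longleftrightarrow> x \<in> Af \<and> absv (cnjg x) \<le> 1"
proof
  assume "x \<in> Af \<and> absv (cnjg x) \<le> 1"
  then show "x \<in> R" using R_supset cnjg_Af unfolding Af_def by auto
qed (use R_subset in blast)

text \<open>The value j = d is included although only j < d are generators: |f' T^d| = 1. This extra
  element is what makes (1,T)^d principal.\<close>

lemma R_f_Tx: "j \<le> d \<Longrightarrow> f * Tx ^ j \<in> R"
  using f_Tx_in_Af[of 1 j] absv_cnjg_f_Tx[of j 1] by (simp add: R_iff)

text \<open>By \<open>Af_absv\<close> a nonzero f-coordinate already forces size at least q^d, so
  short elements of moderate conjugate are polynomials.\<close>

lemma Af_cases:
  assumes "x \<in> Af" "absv (cnjg x) < real CARD('a) ^ d"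
  shows "(\<exists>u. x = polyA u \<and> cnjg x = x) \<or> absv x \<ge> real CARD('a) ^ d"
proof -
  obtain u v where x: "x = polyA u + polyA v * f" using assms(1) unfolding Af_def by blast
  show ?thesis
  proof (cases "v = 0")
    case True
    then show ?thesis using x cnjg_polyA by auto
  next
    case False
    have "absv x = real CARD('a) ^ (degree v + d)"
      using assms(2) unfolding x cnjg_Af by (rule Af_absv[OF False])
    also have "\<dots> \<ge> real CARD('a) ^ d"
      using card_real_gt_1[where 'a='a] by (intro power_increasing) auto
    finally show ?thesis by blast
  qed
qed

lemma R_K: "x \<in> R \<Longrightarrow> x \<in> K" using R_subset Af_K by blast

section \<open>Modules over the ring of integers\<close>

definition R_module :: "'a fls set \<Rightarrow> bool" where
  "R_module L \<longleftrightarrow> 0 \<in> L \<and> (\<forall>x\<in>L. \<forall>y\<in>L. x + y \<in> L) \<and> (\<forall>r\<in>R. \<forall>x\<in>L. r * x \<in> L)"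

lemma R_module_0: "R_module L \<Longrightarrow> 0 \<in> L"
  and R_module_add: "R_module L \<Longrightarrow> x \<in> L \<Longrightarrow> y \<in> L \<Longrightarrow> x + y \<in> L"
  and R_module_mult: "R_module L \<Longrightarrow> r \<in> R \<Longrightarrow> x \<in> L \<Longrightarrow> r * x \<in> L"
  by (auto simp: R_module_def)

lemma R_module_fq_subspace: "R_module L \<Longrightarrow> fq_subspace L"
  by (rule fq_subspaceI) (auto simp: R_module_def intro: Ainf1.const)

lemma R_module_diff: "R_module L \<Longrightarrow> x \<in> L \<Longrightarrow> y \<in> L \<Longrightarrow> x - y \<in> L"
  using R_module_fq_subspace fq_subspace_diff by blast

text \<open>The denominator is padded by a power of T until its degree is a multiple of
  \<open>d\<close>; then f^k times it has absolute value 1 at the second infinite place.\<close>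

lemma common_denominator:
  assumes "y \<in> K"
  obtains D k where "D \<noteq> 0" "degree D = k * d" "polyA D * y \<in> Af"
proof -
  obtain u v where y: "u \<in> kset" "v \<in> kset" "y = u + v * f" using assms by (rule KE)
  obtain p r where r: "r \<noteq> 0" "u = polyA p / polyA r" using y(1) by (rule ksetE)
  obtain p' r' where r': "r' \<noteq> 0" "v = polyA p' / polyA r'" using y(2) by (rule ksetE)
  define n where "n = degree (r * r')"
  define D where "D = monom 1 (n * d - n) * (r * r')"
  have m0: "monom 1 (n * d - n) \<noteq> (0 :: 'a poly)" by (simp add: monom_eq_0_iff)
  have "n * d \<ge> n" using d by simp
  then have "degree D = n * d"
    unfolding D_def using r r' m0 by (subst degree_mult_eq) (auto simp: degree_monom_eq n_def)
  moreover have "D \<noteq> 0" using m0 r r' by (simp add: D_def)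
  moreover have "polyA D * y = polyA (monom 1 (n * d - n)) * (polyA (p * r') + polyA (p' * r) * f)"
    unfolding D_def y(3) r(2) r'(2) using r(1) r'(1) by (simp add: polyA_mult field_simps)
  then have "polyA D * y \<in> Af" using Af_mult[OF Af_polyA AfI] by metis
  ultimately show thesis using that by blast
qed

text \<open>
  The conjugate measures the valuation at the second infinite place, where \<open>1/T\<close> is a uniformiser
  and \<open>L\<close> is locally principal.
\<close>

lemma Tx_mult_in_module:
  assumes L: "R_module L" "L \<subseteq> K" and x1: "x1 \<in> L" "x1 \<noteq> 0" and x: "x \<in> L" and lt: "absv (cnjg x) < absv (cnjg x1)"
  shows "Tx * x \<in> L"
proof -
  have xK: "x \<in> K" "x1 \<in> K" using L x x1 by auto
  define y where "y = Tx * x / x1"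
  have yK: "y \<in> K" unfolding y_def by (intro K_divide K_mult K_Tx xK)
  have sx1: "cnjg x1 \<noteq> 0" using cnjg_eq_0_iff xK x1 by blast
  have sy: "cnjg y = Tx * cnjg x / cnjg x1"
    unfolding y_def using xK x1 by (simp add: cnjg_divide cnjg_mult K_mult K_Tx cnjg_Tx)
  have "absv (cnjg x / cnjg x1) < real CARD('a) powi ((-1) + 1)" using lt sx1 by (simp add: absv_divide)
  then have "absv (cnjg x / cnjg x1) \<le> real CARD('a) powi (-1)" unfolding absv_less_powi_iff .
  then have avy: "absv (cnjg y) \<le> 1"
    using card_real_gt_1[where 'a='a] by (simp add: sy absv_mult absv_divide power_int_minus field_simps)
  obtain D k where D: "D \<noteq> 0" "degree D = k * d" "polyA D * y \<in> Af"
    using yK by (rule common_denominator)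
  \<comment> \<open>Clears the denominators of \<open>y\<close> at no cost at the second place: the
    k factors f' compensate the degree k d of D exactly.\<close>
  define r where "r = f ^ k * polyA D"
  have rAf: "r \<in> Af" unfolding r_def by (intro Af_mult Af_power Af_f Af_polyA)
  have "cnjg r = f' ^ k * polyA D"
    unfolding r_def by (simp add: cnjg_mult K_power K_f K_polyA cnjg_power cnjg_f cnjg_polyA)
  then have avr: "absv (cnjg r) = 1"
    using card_real_gt_1[where 'a='a] D
    by (simp add: absv_mult absv_power absv_f' absv_polyA power_inverse power_mult[symmetric] mult.commute)
  have rR: "r \<in> R" using rAf avr by (simp add: R_iff)
  have "r * y = f ^ k * (polyA D * y)" by (simp add: r_def)
  then have "r * y \<in> Af" using D Af_mult[OF Af_power[OF Af_f]] by metis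
  moreover have "absv (cnjg (r * y)) \<le> 1" using avy avr rAf yK by (simp add: cnjg_mult Af_K absv_mult)
  ultimately have ryR: "r * y \<in> R" by (simp add: R_iff)
  \<comment> \<open>The residue c of r at the second place is nonzero. Since r - c vanishes there, T
    (r - c) lies in \<open>R\<close>, so c T x = (r y) x1 - T (r - c) x lies in
    \<open>L\<close>.\<close>
  obtain c where c: "absv (cnjg r - fls_const c * 1) < 1"
    using ex_smaller_absv_diff[of 1 "cnjg r"] avr by auto
  have c0: "c \<noteq> 0" using c avr by auto
  define p where "p = r - fls_const c"
  have pAf: "p \<in> Af" unfolding p_def using Af_add[OF rAf Af_minus[OF Af_const]] by simp
  have sp: "cnjg p = cnjg r - fls_const c" unfolding p_def using rAf by (simp add: cnjg_diff Af_K K_const cnjg_const)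
  have "absv (cnjg p) < real CARD('a) powi ((-1) + 1)" using c sp by simp
  then have "absv (cnjg p) \<le> real CARD('a) powi (-1)" unfolding absv_less_powi_iff .
  then have "absv (cnjg (Tx * p)) \<le> 1"
    using card_real_gt_1[where 'a='a] pAf
    by (simp add: cnjg_mult K_Tx Af_K cnjg_Tx absv_mult power_int_minus field_simps)
  moreover have "Tx * p \<in> Af" using Af_mult[OF Af_Tx_power[of 1] pAf] by simp
  ultimately have pR: "Tx * p \<in> R" by (simp add: R_iff)
  have "fls_const c * (Tx * x) = (r * y) * x1 - (Tx * p) * x"
    using x1 by (simp add: p_def y_def algebra_simps)
  also have "\<dots> \<in> L" using R_module_mult[OF L(1)] ryR pR x1 x by (intro R_module_diff[OF L(1)]) auto
  finally show ?thesis using fq_subspace_scale_iff[OF R_module_fq_subspace[OF L(1)] c0] by blast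
qed

end

text \<open>A ball of radius less than the minimum is trivial, and each increase of the radius by
  the factor q adds at most one dimension.\<close>

lemma finite_balls_if_bounded_below:
  fixes S :: "'a::{finite,field} fls set"
  assumes S: "fq_subspace S" and C: "C > 0" "\<And>x. x \<in> S \<Longrightarrow> x \<noteq> 0 \<Longrightarrow> C \<le> absv x"
  shows "finite_balls S"
proof -
  obtain k :: nat where k: "real CARD('a) powi (- int k) < C"
    using powi_arbitrarily_small[where 'a='a] C(1) by blast
  have *: "finite (trunc S (- int k + int j))" for j
  proof (induction j)
    case 0
    have "trunc S (- int k) \<subseteq> {0}" using k C(2) by fastforce
    then show ?case using finite_subset by auto
  next
    case (Suc j)
    let ?n = "- int k + int j"
    have eq: "- int k + int (Suc j) = ?n + 1" by simp
    show ?case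
    proof (cases "\<exists>x\<in>S. absv x = real CARD('a) powi (?n + 1)")
      case True
      then obtain x where x: "x \<in> S" "absv x = real CARD('a) powi (?n + 1)" by blast
      then have x0: "x \<noteq> 0" using card_real_gt_1[where 'a='a] by auto
      have "trunc S (?n + 1) \<subseteq> adjoin (trunc S ?n) x"
      proof
        fix y assume y: "y \<in> trunc S (?n + 1)"
        then obtain c where "absv (y - fls_const c * x) < absv x"
          using ex_smaller_absv_diff[OF x0, of y] x by auto
        then have "absv (y - fls_const c * x) \<le> real CARD('a) powi ?n"
          unfolding x(2) absv_less_powi_iff .
        moreover have "y - fls_const c * x \<in> S"
          using y x by (intro fq_subspace_diff[OF S] fq_subspace_scale[OF S]) auto
        ultimately show "y \<in> adjoin (trunc S ?n) x" unfolding in_adjoin_iff_diff by blast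
      qed
      then have "finite (trunc S (?n + 1))" by (rule finite_subset[OF _ finite_adjoin[OF Suc.IH]])
      then show ?thesis unfolding eq .
    next
      case False
      have "trunc S (?n + 1) \<subseteq> trunc S ?n"
      proof
        fix y assume y: "y \<in> trunc S (?n + 1)"
        then have "absv y < real CARD('a) powi (?n + 1)" using False by force
        then show "y \<in> trunc S ?n" using y unfolding absv_less_powi_iff by simp
      qed
      then have "finite (trunc S (?n + 1))" by (rule finite_subset[OF _ Suc.IH])
      then show ?thesis unfolding eq .
    qed
  qed
  show ?thesis unfolding finite_balls_def
  proof
    fix n
    have "trunc S n \<subseteq> trunc S (- int k + int (nat (n + int k)))"
      using card_real_gt_1[where 'a='a]
        power_int_increasing[of n "- int k + int (nat (n + int k))" "real CARD('a)"] by force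
    then show "finite (trunc S n)" using * finite_subset by blast
  qed
qed

section \<open>Shortest vectors and runs of powers of T\<close>

definition shortest :: "'a::{finite,field} fls set \<Rightarrow> 'a fls \<Rightarrow> bool" where
  "shortest L x \<longleftrightarrow> x \<in> L \<and> x \<noteq> 0 \<and> (\<forall>y\<in>L. y \<noteq> 0 \<longrightarrow> absv x \<le> absv y)"

text \<open>This is the number m of the overview without rescaling. Shortest vectors are unique up
  to constants, so the choice of \<open>x\<close> does not affect it
  (\<open>ascent_unique\<close>).\<close>

definition ascent :: "'a::{finite,field} fls set \<Rightarrow> nat \<Rightarrow> bool" where
  "ascent L m \<longleftrightarrow> (\<exists>x. shortest L x \<and> (\<forall>j\<le>m. x * Tx ^ j \<in> L) \<and> x * Tx ^ Suc m \<notin> L)"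

lemma ex_shortest:
  fixes L :: "'a::{finite,field} fls set"
  assumes "finite_balls L" "y \<in> L" "y \<noteq> 0"
  shows "\<exists>x. shortest L x"
proof -
  let ?n = "- fls_subdegree y"
  let ?S = "trunc L ?n - {0}"
  have y: "y \<in> ?S" using assms by (simp add: absv_def)
  have fin: "finite (absv ` ?S)" using finite_ballsD[OF assms(1)] by simp
  then have "Min (absv ` ?S) \<in> absv ` ?S" using y by (intro Min_in) auto
  then obtain x where "Min (absv ` ?S) = absv x" and xS: "x \<in> ?S" by (rule imageE)
  then have x: "x \<in> ?S" "absv x = Min (absv ` ?S)" by simp_all
  have "absv x \<le> absv z" if "z \<in> L" "z \<noteq> 0" for z
  proof (cases "z \<in> trunc L ?n")
    case True
    then show ?thesis using fin x that by auto
  next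
    case False
    then show ?thesis using x that by auto
  qed
  then show ?thesis using x by (intro exI[of _ x]) (auto simp: shortest_def)
qed

lemma shortest_unique:
  fixes L :: "'a::{finite,field} fls set"
  assumes "fq_subspace L" "shortest L x" "shortest L y"
  shows "\<exists>c. c \<noteq> 0 \<and> y = fls_const c * x"
proof -
  have "x \<noteq> 0" "absv y \<le> absv x" using assms by (auto simp: shortest_def)
  then obtain c where c: "absv (y - fls_const c * x) < absv x" using ex_smaller_absv_diff by blast
  have "y - fls_const c * x \<in> L"
    using assms by (intro fq_subspace_diff[OF assms(1)] fq_subspace_scale[OF assms(1)]) (auto simp: shortest_def)
  then have "y - fls_const c * x = 0" using c assms(2) by (force simp: shortest_def)
  moreover have "c \<noteq> 0" using calculation assms(3) by (auto simp: shortest_def)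
  ultimately show ?thesis by auto
qed

lemma ascent_shortest:
  fixes L :: "'a::{finite,field} fls set"
  assumes L: "fq_subspace L" "shortest L y" and m: "ascent L m"
  shows "(\<forall>j\<le>m. y * Tx ^ j \<in> L) \<and> y * Tx ^ Suc m \<notin> L"
proof -
  obtain x where x: "shortest L x" "\<forall>j\<le>m. x * Tx ^ j \<in> L" "x * Tx ^ Suc m \<notin> L"
    using m by (auto simp: ascent_def)
  obtain c where c: "c \<noteq> 0" "y = fls_const c * x" using shortest_unique[OF L(1) x(1) L(2)] by blast
  have "y * Tx ^ j \<in> L \<longleftrightarrow> x * Tx ^ j \<in> L" for j
    unfolding c(2) mult.assoc using fq_subspace_scale_iff[OF L(1) c(1)] .
  then show ?thesis using x by blast
qed

lemma ascent_unique:
  fixes L :: "'a::{finite,field} fls set"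
  assumes "fq_subspace L" "ascent L m" "ascent L n"
  shows "m = n"
proof (rule ccontr)
  assume "m \<noteq> n"
  moreover obtain x where x: "shortest L x" using assms(2) by (auto simp: ascent_def)
  ultimately show False
    using ascent_shortest[OF assms(1) x assms(2)] ascent_shortest[OF assms(1) x assms(3)]
    by (metis Suc_leI linorder_neqE_nat)
qed

lemma shortest_image_scale:
  fixes L :: "'a::{finite,field} fls set"
  assumes "shortest L x" "l \<noteq> 0"
  shows "shortest ((*) l ` L) (l * x)"
  using assms by (auto simp: shortest_def absv_mult)

lemma ascent_image_scale:
  fixes L :: "'a::{finite,field} fls set"
  assumes "ascent L m" "l \<noteq> 0"
  shows "ascent ((*) l ` L) m"
proof -
  obtain x where x: "shortest L x" "\<forall>j\<le>m. x * Tx ^ j \<in> L" "x * Tx ^ Suc m \<notin> L"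
    using assms(1) by (auto simp: ascent_def)
  have "l * x * Tx ^ j \<in> (*) l ` L \<longleftrightarrow> x * Tx ^ j \<in> L" for j
    using assms(2) by (auto simp: mult.assoc)
  then show ?thesis unfolding ascent_def using shortest_image_scale[OF x(1) assms(2)] x by blast
qed

section \<open>Multiplication by the fractional ideal (1,T)\<close>

definition adjT :: "'a::{finite,field} fls set \<Rightarrow> 'a fls set" where
  "adjT L = {x + Tx * y | x y. x \<in> L \<and> y \<in> L}"

abbreviation adjT_iter :: "nat \<Rightarrow> 'a::{finite,field} fls set \<Rightarrow> 'a fls set" where
  "adjT_iter i \<equiv> adjT ^^ i"

lemma adjTI: "x \<in> L \<Longrightarrow> y \<in> L \<Longrightarrow> x + Tx * y \<in> adjT L" by (auto simp: adjT_def)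

lemma adjTE:
  assumes "z \<in> adjT L"
  obtains x y where "x \<in> L" "y \<in> L" "z = x + Tx * y"
  using assms by (auto simp: adjT_def)

lemma adjT_image_scale: "adjT ((*) l ` L) = (*) l ` adjT L"
proof (intro equalityI subsetI)
  fix z assume "z \<in> adjT ((*) l ` L)"
  then obtain x y where xy: "x \<in> L" "y \<in> L" "z = l * x + Tx * (l * y)" by (auto simp: adjT_def)
  then have "z = l * (x + Tx * y)" by (simp add: algebra_simps)
  then show "z \<in> (*) l ` adjT L" using adjTI[OF xy(1,2)] by (rule image_eqI)
next
  fix z assume "z \<in> (*) l ` adjT L"
  then obtain x y where xy: "x \<in> L" "y \<in> L" "z = l * (x + Tx * y)" by (auto simp: adjT_def)
  then have "z = l * x + Tx * (l * y)" by (simp add: algebra_simps)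
  then show "z \<in> adjT ((*) l ` L)" using adjTI[OF imageI[OF xy(1), of "(*) l"] imageI[OF xy(2), of "(*) l"]] by simp
qed

lemma adjT_iter_image_scale: "adjT_iter i ((*) l ` L) = (*) l ` adjT_iter i L"
  by (induction i) (simp_all add: adjT_image_scale)

lemma subset_adjT: "0 \<in> L \<Longrightarrow> L \<subseteq> adjT L"
  using adjTI[of _ L 0] by auto

lemma Tx_mult_adjT: "0 \<in> L \<Longrightarrow> x \<in> L \<Longrightarrow> Tx * x \<in> adjT L"
  using adjTI[of 0 L x] by auto

context quad
begin

lemma R_module_adjT:
  assumes L: "R_module L" shows "R_module (adjT L)"
  unfolding R_module_def
proof (intro conjI ballI)
  show "0 \<in> adjT L" using subset_adjT R_module_0[OF L] by blast
  fix x y assume "x \<in> adjT L" "y \<in> adjT L"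
  then obtain u v u' v' where e: "u \<in> L" "v \<in> L" "u' \<in> L" "v' \<in> L" "x = u + Tx * v" "y = u' + Tx * v'"
    by (auto simp: adjT_def)
  have "x + y = (u + u') + Tx * (v + v')" unfolding e by (simp add: algebra_simps)
  then show "x + y \<in> adjT L" using adjTI R_module_add[OF L] e by metis
next
  fix r x assume r: "r \<in> R" and "x \<in> adjT L"
  then obtain u v where e: "u \<in> L" "v \<in> L" "x = u + Tx * v" by (auto simp: adjT_def)
  have "r * x = r * u + Tx * (r * v)" unfolding e by (simp add: algebra_simps)
  then show "r * x \<in> adjT L" using adjTI R_module_mult[OF L r] e by metis
qed

lemma R_module_adjT_iter: "R_module L \<Longrightarrow> R_module (adjT_iter i L)"
  by (induction i) (auto simp: R_module_adjT)

lemma R_module_image_scale: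
  assumes "R_module L" shows "R_module ((*) l ` L)"
  unfolding R_module_def
proof (intro conjI ballI)
  show "0 \<in> (*) l ` L" using R_module_0[OF assms] by (intro image_eqI[of _ _ 0]) auto
next
  fix x y assume "x \<in> (*) l ` L" "y \<in> (*) l ` L"
  then show "x + y \<in> (*) l ` L"
    using R_module_add[OF assms] by (auto simp: distrib_left[symmetric])
next
  fix r x assume "r \<in> R" "x \<in> (*) l ` L"
  then show "r * x \<in> (*) l ` L"
    using R_module_mult[OF assms] by (auto simp: mult.left_commute)
qed

lemma R_module_R: "R_module R"
  using R_0 by (auto simp: R_module_def intro: Ainf1.add Ainf1.mult)

lemma R_ex_absv:
  assumes "n \<ge> d" shows "\<exists>g\<in>R. absv g = real CARD('a) ^ n"
proof -
  obtain g k j where g: "g = f ^ k * Tx ^ j" "g \<in> R" "k * d + j = n" "j < d"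
    by (rule R_f_Tx_gen[OF assms])
  then show ?thesis using absv_f_Tx[of k j] by auto
qed

lemma adjT_iter_mono:
  assumes "R_module L" "i \<le> j" shows "adjT_iter i L \<subseteq> adjT_iter j L"
proof -
  have "adjT_iter n L \<subseteq> adjT_iter (Suc n) L" for n
    using subset_adjT[OF R_module_0[OF R_module_adjT_iter[OF assms(1)]]] by simp
  then show ?thesis using lift_Suc_mono_le[of "\<lambda>n. adjT_iter n L"] assms(2) by blast
qed

lemma Tx_power_mult_adjT_iter:
  assumes "R_module L" "x \<in> L" "j \<le> i" shows "Tx ^ j * x \<in> adjT_iter i L"
proof -
  have "Tx ^ j * x \<in> adjT_iter j L"
  proof (induction j)
    case (Suc j)
    then show ?case using Tx_mult_adjT[OF R_module_0[OF R_module_adjT_iter[OF assms(1)]]] by (simp add: mult.assoc)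
  qed (use assms in simp)
  then show ?thesis using adjT_iter_mono[OF assms(1,3)] by blast
qed

lemma adjT_iter_sum:
  assumes "R_module L" "x \<in> adjT_iter i L"
  shows "\<exists>l. (\<forall>j. l j \<in> L) \<and> x = (\<Sum>j\<le>i. Tx ^ j * l j)"
  using assms(2)
proof (induction i arbitrary: x)
  case 0
  then show ?case by (intro exI[of _ "\<lambda>_. x"]) simp
next
  case (Suc i)
  then obtain u v where "u \<in> adjT_iter i L" "v \<in> adjT_iter i L" and x: "x = u + Tx * v" by (auto elim: adjTE)
  then obtain l l' where l: "\<forall>j. l j \<in> L" "u = (\<Sum>j\<le>i. Tx ^ j * l j)"
    and l': "\<forall>j. l' j \<in> L" "v = (\<Sum>j\<le>i. Tx ^ j * l' j)" using Suc.IH by meson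
  let ?l = "\<lambda>j. (if j \<le> i then l j else 0) + (if j = 0 then 0 else l' (j - 1))"
  have "(\<Sum>j\<le>Suc i. Tx ^ j * ?l j) = (\<Sum>j\<le>Suc i. Tx ^ j * (if j \<le> i then l j else 0))
      + (\<Sum>j\<le>Suc i. Tx ^ j * (if j = 0 then 0 else l' (j - 1)))"
    by (simp only: distrib_left sum.distrib)
  also have "(\<Sum>j\<le>Suc i. Tx ^ j * (if j \<le> i then l j else 0)) = u"
    unfolding l(2) by (simp add: sum.atMost_Suc)
  also have "(\<Sum>j\<le>Suc i. Tx ^ j * (if j = 0 then 0 else l' (j - 1))) = Tx * v"
    unfolding l'(2) by (simp only: sum.atMost_Suc_shift) (simp add: sum_distrib_left mult.assoc)
  finally have "x = (\<Sum>j\<le>Suc i. Tx ^ j * ?l j)" using x by simp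
  moreover have "\<forall>j. ?l j \<in> L" using l l' R_module_0[OF assms(1)] R_module_add[OF assms(1)] by auto
  ultimately show ?case by (intro exI[of _ ?l]) blast
qed

lemma sum_adjT_iter: "R_module L \<Longrightarrow> (\<And>j. j \<le> i \<Longrightarrow> l j \<in> L) \<Longrightarrow> (\<Sum>j\<le>i. Tx ^ j * l j) \<in> adjT_iter i L"
  by (intro fq_subspace_sum R_module_fq_subspace R_module_adjT_iter Tx_power_mult_adjT_iter) auto

lemma a_ideal_eq: "a_ideal f d i = (*) f ` adjT_iter i R"
proof (intro equalityI subsetI)
  fix x assume "x \<in> a_ideal f d i"
  then obtain r where r: "\<forall>j\<le>i. r j \<in> R" "x = (\<Sum>j\<le>i. r j * (f * Tx ^ j))"
    by (auto simp: a_ideal_def)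
  have "x = f * (\<Sum>j\<le>i. Tx ^ j * r j)"
    unfolding r(2) sum_distrib_left by (rule sum.cong) (simp_all add: ac_simps)
  then show "x \<in> (*) f ` adjT_iter i R" using sum_adjT_iter[OF R_module_R, of i r] r(1) by blast
next
  fix x assume "x \<in> (*) f ` adjT_iter i R"
  then obtain l where l: "\<forall>j. l j \<in> R" "x = f * (\<Sum>j\<le>i. Tx ^ j * l j)"
    using adjT_iter_sum[OF R_module_R] by blast
  have "x = (\<Sum>j\<le>i. l j * (f * Tx ^ j))"
    unfolding l(2) sum_distrib_left by (rule sum.cong) (simp_all add: ac_simps)
  then show "x \<in> a_ideal f d i" unfolding a_ideal_def using l(1) by blast
qed

lemma ideal_mult_a_ideal:
  assumes L: "R_module L"
  shows "ideal_mult L (a_ideal f d i) = (*) f ` adjT_iter i L"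
proof (intro equalityI subsetI)
  fix x assume "x \<in> ideal_mult L (a_ideal f d i)"
  then show "x \<in> (*) f ` adjT_iter i L"
  proof (induction rule: ideal_mult.induct)
    case (prod x y)
    then obtain l where l: "\<forall>j. l j \<in> R" "y = f * (\<Sum>j\<le>i. Tx ^ j * l j)"
      unfolding a_ideal_eq using adjT_iter_sum[OF R_module_R] by blast
    have "x * y = f * (\<Sum>j\<le>i. Tx ^ j * (l j * x))"
      unfolding l(2) by (simp add: sum_distrib_left ac_simps)
    moreover have "(\<Sum>j\<le>i. Tx ^ j * (l j * x)) \<in> adjT_iter i L"
      using l(1) prod by (intro sum_adjT_iter[OF L] R_module_mult[OF L]) auto
    ultimately show ?case by blast
  next
    case (add u v)
    then show ?case using R_module_add[OF R_module_image_scale[OF R_module_adjT_iter[OF L]]] by blast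
  qed
next
  fix x assume "x \<in> (*) f ` adjT_iter i L"
  then obtain l where l: "\<forall>j. l j \<in> L" "x = f * (\<Sum>j\<le>i. Tx ^ j * l j)"
    using adjT_iter_sum[OF L] by blast
  have x: "x = (\<Sum>j\<le>i. l j * (f * Tx ^ j))"
    unfolding l(2) sum_distrib_left by (rule sum.cong) (simp_all add: ac_simps)
  have m: "l j * (f * Tx ^ j) \<in> ideal_mult L (a_ideal f d i)" if "j \<le> i" for j
  proof (rule ideal_mult.prod)
    have "Tx ^ j * 1 \<in> adjT_iter i R" by (rule Tx_power_mult_adjT_iter[OF R_module_R R_1 that])
    then show "f * Tx ^ j \<in> a_ideal f d i" unfolding a_ideal_eq by (intro imageI) simp
  qed (use l in blast)
  have "(\<Sum>j\<le>k. l j * (f * Tx ^ j)) \<in> ideal_mult L (a_ideal f d i)" if "k \<le> i" for k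
    using that
  proof (induction k)
    case 0
    then show ?case using m[of 0] by simp
  next
    case (Suc k)
    then show ?case using m[of "Suc k"] by (simp only: sum.atMost_Suc) (intro ideal_mult.add, auto)
  qed
  then show "x \<in> ideal_mult L (a_ideal f d i)" unfolding x by simp
qed

text \<open>For j < d both f T^j and f T^(j+1) lie in \<open>R\<close>, so f T^j lies in the inverse
  of (1,T).\<close>

lemma f_mult_adjT:
  assumes "R_module L" "x \<in> adjT L" "j < d"
  shows "f * Tx ^ j * x \<in> L"
proof -
  obtain u v where x: "u \<in> L" "v \<in> L" "x = u + Tx * v" using assms(2) by (auto simp: adjT_def)
  have "f * Tx ^ j * x = f * Tx ^ j * u + f * Tx ^ Suc j * v" unfolding x by (simp add: algebra_simps)
  then show ?thesis using assms(3) x by (simp only:) (intro R_module_add[OF assms(1)] R_module_mult[OF assms(1)] R_f_Tx; simp)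
qed

text \<open>This is (1,T)^d = f^(-1) R. One inclusion holds because f T^j lies in \<open>R\<close>
  for all j \<le> d, the other because b / f = f - a, where f lies in \<open>R\<close> and
  \<open>a\<close> has degree d.\<close>

lemma adjT_iter_d:
  assumes L: "R_module L"
  shows "adjT_iter d L = (*) (inverse f) ` L"
proof (intro equalityI subsetI)
  fix x assume "x \<in> adjT_iter d L"
  then obtain l where l: "\<forall>j. l j \<in> L" "x = (\<Sum>j\<le>d. Tx ^ j * l j)" using adjT_iter_sum[OF L] by blast
  have "f * x = (\<Sum>j\<le>d. (f * Tx ^ j) * l j)"
    unfolding l(2) sum_distrib_left by (rule sum.cong) (simp_all add: ac_simps)
  also have "\<dots> \<in> L" using l(1) by (intro fq_subspace_sum[OF R_module_fq_subspace[OF L]] R_module_mult[OF L] R_f_Tx) auto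
  finally have "f * x \<in> L" .
  moreover have "x = inverse f * (f * x)" using f_nonzero by (simp add: mult.assoc[symmetric])
  ultimately show "x \<in> (*) (inverse f) ` L" by blast
next
  fix x assume "x \<in> (*) (inverse f) ` L"
  then obtain y where y: "y \<in> L" "x = inverse f * y" by blast
  have "fls_const b * x = (f * (f - polyA a)) * x"
    using f_eq by (simp add: algebra_simps power2_eq_square)
  also have "\<dots> = f * y - polyA a * y" unfolding y(2) using f_nonzero by (simp add: field_simps)
  also have "polyA a * y = (\<Sum>j\<le>d. Tx ^ j * (fls_const (coeff a j) * y))"
    unfolding polyA_sum[OF eq_refl[OF deg_a]] sum_distrib_right
    by (rule sum.cong) (simp_all add: ac_simps)
  also have "f * y - (\<Sum>j\<le>d. Tx ^ j * (fls_const (coeff a j) * y)) \<in> adjT_iter d L"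
  proof (intro R_module_diff[OF R_module_adjT_iter[OF L]] sum_adjT_iter[OF L])
    have "f * y \<in> L" using R_module_mult[OF L R_f_Tx[of 0] y(1)] by simp
    then show "f * y \<in> adjT_iter d L" using adjT_iter_mono[OF L, of 0 d] by auto
  qed (use y in \<open>auto intro: R_module_mult[OF L] Ainf1.const\<close>)
  finally show "x \<in> adjT_iter d L"
    using fq_subspace_scale_iff[OF R_module_fq_subspace[OF R_module_adjT_iter[OF L]] b] by blast
qed

text \<open>The ideal (1,T) is invertible and can be cancelled. Concretely b = f^2 - f a, and every
  term of it sends x into \<open>L\<close>: f T^j with j < d because x lies in L(1,T), and f T^d
  because T x does as well.\<close>

lemma colon_adjT:
  assumes L: "R_module L" and x: "x \<in> adjT L" "Tx * x \<in> adjT L"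
  shows "x \<in> L"
proof -
  have "fls_const b * x = f * f * x - f * polyA a * x"
    using f_eq by (simp add: algebra_simps power2_eq_square)
  also have "f * polyA a * x = (\<Sum>j\<le>d. fls_const (coeff a j) * (f * Tx ^ j * x))"
    unfolding polyA_sum[OF eq_refl[OF deg_a]] sum_distrib_left sum_distrib_right
    by (rule sum.cong) (simp_all add: ac_simps)
  also have "f * f * x - \<dots> \<in> L"
  proof (intro R_module_diff[OF L] fq_subspace_sum[OF R_module_fq_subspace[OF L]] fq_subspace_scale[OF R_module_fq_subspace[OF L]])
    have "f * x \<in> L" using f_mult_adjT[OF L x(1), of 0] d by simp
    then have "f * (f * x) \<in> L" using R_module_mult[OF L R_f_Tx[of 0]] by simp
    then show "f * f * x \<in> L" by (simp add: mult.assoc)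
    fix j assume "j \<in> {..d}"
    show "f * Tx ^ j * x \<in> L"
    proof (cases "j < d")
      case True
      then show ?thesis by (rule f_mult_adjT[OF L x(1)])
    next
      case False
      then have "j = Suc (d - 1)" using \<open>j \<in> {..d}\<close> d by simp
      then have "Tx ^ j = (Tx * Tx ^ (d - 1) :: 'a fls)" by (simp only: power_Suc)
      then have "f * Tx ^ j * x = f * Tx ^ (d - 1) * (Tx * x)" by (simp only: ac_simps)
      then show ?thesis using f_mult_adjT[OF L x(2), of "d - 1"] d by (simp only:)
    qed
  qed
  finally show ?thesis using fq_subspace_scale_iff[OF R_module_fq_subspace[OF L] b] by blast
qed

text \<open>By \<open>colon_adjT\<close> two consecutive powers in L(1,T) put the lower one into
  \<open>L\<close>, so passing to \<open>L\<close> shortens the run by at most one. It does shorten,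
  since x T^(m+1) in \<open>L\<close> would put x T^(m+2) into L(1,T).\<close>

lemma ascent_adjT:
  assumes L: "R_module L" and m: "ascent (adjT L) (Suc m)"
  shows "ascent L m"
proof -
  obtain x where x: "shortest (adjT L) x" "\<forall>j\<le>Suc m. x * Tx ^ j \<in> adjT L" "x * Tx ^ Suc (Suc m) \<notin> adjT L"
    using m by (auto simp: ascent_def)
  have in_L: "x * Tx ^ j \<in> L" if "j \<le> m" for j
  proof (rule colon_adjT[OF L])
    show "x * Tx ^ j \<in> adjT L" "Tx * (x * Tx ^ j) \<in> adjT L"
      using x(2) that spec[OF x(2), of "Suc j"] by (auto simp: mult.left_commute)
  qed
  have "x * Tx ^ Suc m \<notin> L"
    using x(3) Tx_mult_adjT[OF R_module_0[OF L], of "x * Tx ^ Suc m"] by (auto simp: mult.left_commute)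
  moreover have "shortest L x"
    using x(1) in_L[of 0] subset_adjT[OF R_module_0[OF L]] by (auto simp: shortest_def)
  ultimately show ?thesis using in_L unfolding ascent_def by blast
qed

text \<open>Both infinite places are controlled: discreteness at the first makes the power sums
  converge, and the bounded conjugate limits the pole at the second and makes every run finite. Both
  conditions survive scaling and \<open>adjT\<close>.\<close>

definition lattice_module :: "'a fls set \<Rightarrow> bool" where
  "lattice_module L \<longleftrightarrow> R_module L \<and> L \<subseteq> K \<and> L \<noteq> {0} \<and> (\<exists>C>0. \<forall>x\<in>L. x \<noteq> 0 \<longrightarrow> C \<le> absv x) \<and>
     (\<exists>C. \<forall>x\<in>L. absv (cnjg x) \<le> C)"

lemma lattice_module_R_module: "lattice_module L \<Longrightarrow> R_module L" by (simp add: lattice_module_def)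

lemma lattice_module_finite_balls: "lattice_module L \<Longrightarrow> finite_balls L"
proof -
  assume L: "lattice_module L"
  then obtain C where "C > 0" "\<And>x. x \<in> L \<Longrightarrow> x \<noteq> 0 \<Longrightarrow> C \<le> absv x" by (auto simp: lattice_module_def)
  then show ?thesis by (rule finite_balls_if_bounded_below[OF R_module_fq_subspace[OF lattice_module_R_module[OF L]]])
qed

lemma lattice_module_ex_shortest: "lattice_module L \<Longrightarrow> \<exists>x. shortest L x"
proof -
  assume L: "lattice_module L"
  then obtain y where "y \<in> L" "y \<noteq> 0" using R_module_0[OF lattice_module_R_module[OF L]] by (auto simp: lattice_module_def)
  then show ?thesis using ex_shortest[OF lattice_module_finite_balls[OF L]] by blast
qed

lemma R_absv_ge_1: "x \<in> R \<Longrightarrow> x \<noteq> 0 \<Longrightarrow> absv x \<ge> 1"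
proof -
  assume x: "x \<in> R" "x \<noteq> 0"
  then have "x \<in> Af" "absv (cnjg x) < real CARD('a) ^ d" using R_subset card_power_gt_1 by force+
  then consider u where "x = polyA u" | "absv x \<ge> real CARD('a) ^ d" using Af_cases by blast
  then show ?thesis
  proof cases
    case 1
    then show ?thesis using x absv_polyA[of u] card_real_gt_1[where 'a='a] by (auto simp: one_le_power)
  qed (use card_power_gt_1 in simp)
qed

lemma lattice_module_R: "lattice_module R"
  unfolding lattice_module_def
proof (intro conjI)
  show "R \<noteq> {0}"
  proof
    assume "R = {0}"
    then have "(1 :: 'a fls) \<in> {0}" using R_1 by (rule subst)
    then show False by simp
  qed
  show "\<exists>C>0. \<forall>x\<in>R. x \<noteq> 0 \<longrightarrow> C \<le> absv x" using R_absv_ge_1 by (intro exI[of _ 1]) auto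
  show "\<exists>C. \<forall>x\<in>R. absv (cnjg x) \<le> C" using R_subset by (intro exI[of _ 1]) auto
qed (use R_module_R R_K in auto)

lemma lattice_module_frac_ideal:
  assumes "frac_ideal f d B" shows "lattice_module B"
proof -
  obtain e where e: "e \<in> R" "e \<noteq> 0" "\<And>x. x \<in> B \<Longrightarrow> e * x \<in> R"
    and BK: "B \<subseteq> K" using assms unfolding frac_ideal_def by blast
  have eK: "e \<in> K" using R_K e by blast
  have "\<forall>x\<in>B. x \<noteq> 0 \<longrightarrow> inverse (absv e) \<le> absv x"
  proof (intro ballI impI)
    fix x assume "x \<in> B" "x \<noteq> 0"
    then have "1 \<le> absv e * absv x" using R_absv_ge_1[of "e * x"] e by (simp add: absv_mult)
    then show "inverse (absv e) \<le> absv x" using e(2) by (simp add: field_simps)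
  qed
  moreover have "inverse (absv e) > 0" using e by simp
  moreover have "\<forall>x\<in>B. absv (cnjg x) \<le> inverse (absv (cnjg e))"
  proof
    fix x assume x: "x \<in> B"
    have "absv (cnjg e) * absv (cnjg x) \<le> 1"
      using R_subset[OF e(3)[OF x]] eK BK x by (auto simp: cnjg_mult absv_mult)
    moreover have "absv (cnjg e) > 0" using cnjg_eq_0_iff[OF eK] e by simp
    ultimately show "absv (cnjg x) \<le> inverse (absv (cnjg e))" by (simp add: field_simps)
  qed
  ultimately show ?thesis using assms unfolding lattice_module_def frac_ideal_def R_module_def by blast
qed

lemma lattice_module_adjT:
  assumes L: "lattice_module L" shows "lattice_module (adjT L)"
proof -
  have rL: "R_module L" and LK: "L \<subseteq> K" using L by (auto simp: lattice_module_def)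
  obtain C where C: "C > 0" "\<And>x. x \<in> L \<Longrightarrow> x \<noteq> 0 \<Longrightarrow> C \<le> absv x" using L by (auto simp: lattice_module_def)
  obtain C' where C': "\<And>x. x \<in> L \<Longrightarrow> absv (cnjg x) \<le> C'" using L by (auto simp: lattice_module_def)
  have "adjT L \<subseteq> K" using LK by (auto simp: adjT_def intro!: K_add K_mult K_Tx)
  moreover have "adjT L \<noteq> {0}"
    using subset_adjT[OF R_module_0[OF rL]] L R_module_0[OF rL] by (auto simp: lattice_module_def)
  moreover have "\<forall>x\<in>adjT L. x \<noteq> 0 \<longrightarrow> C / absv f \<le> absv x"
  proof (intro ballI impI)
    fix x assume x: "x \<in> adjT L" "x \<noteq> 0"
    then have "C \<le> absv (f * x)" using f_mult_adjT[OF rL x(1), of 0] d f_nonzero by (intro C(2)) auto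
    then show "C / absv f \<le> absv x" using f_nonzero by (simp add: absv_mult field_simps)
  qed
  moreover have "C / absv f > 0" using C f_nonzero by simp
  moreover have "\<forall>x\<in>adjT L. absv (cnjg x) \<le> real CARD('a) * C'"
  proof
    fix x assume "x \<in> adjT L"
    then obtain u v where x: "u \<in> L" "v \<in> L" "x = u + Tx * v" by (auto simp: adjT_def)
    have "cnjg x = cnjg u + Tx * cnjg v"
      unfolding x(3) using x LK by (subst cnjg_add) (auto intro!: K_mult K_Tx simp: cnjg_mult K_Tx cnjg_Tx)
    then have "absv (cnjg x) \<le> max (absv (cnjg u)) (real CARD('a) * absv (cnjg v))"
      using absv_add_le[of "cnjg u" "Tx * cnjg v"] by (simp add: absv_mult)
    also have "\<dots> \<le> real CARD('a) * C'"
    proof -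
      have "0 \<le> C'" using C'[OF x(1)] absv_nonneg order.trans by blast
      then have "1 * C' \<le> real CARD('a) * C'" using card_real_gt_1[where 'a='a] by (intro mult_right_mono) auto
      then show ?thesis using C'[OF x(1)] C'[OF x(2)] by (auto intro: mult_left_mono)
    qed
    finally show "absv (cnjg x) \<le> real CARD('a) * C'" .
  qed
  ultimately show ?thesis unfolding lattice_module_def using R_module_adjT[OF rL] by blast
qed

lemma lattice_module_adjT_iter: "lattice_module L \<Longrightarrow> lattice_module (adjT_iter i L)"
  by (induction i) (auto simp: lattice_module_adjT)

lemma lattice_module_image_scale:
  assumes L: "lattice_module L" and l: "l \<in> K" "l \<noteq> 0"
  shows "lattice_module ((*) l ` L)"
proof -
  have rL: "R_module L" and LK: "L \<subseteq> K" using L by (auto simp: lattice_module_def)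
  obtain C where C: "C > 0" "\<And>x. x \<in> L \<Longrightarrow> x \<noteq> 0 \<Longrightarrow> C \<le> absv x" using L by (auto simp: lattice_module_def)
  obtain C' where C': "\<And>x. x \<in> L \<Longrightarrow> absv (cnjg x) \<le> C'" using L by (auto simp: lattice_module_def)
  have "(*) l ` L \<subseteq> K" using LK l by (auto intro!: K_mult)
  moreover have "(*) l ` L \<noteq> {0}"
  proof -
    obtain x where "x \<in> L" "x \<noteq> 0" using lattice_module_ex_shortest[OF L] by (auto simp: shortest_def)
    then have "l * x \<in> (*) l ` L" "l * x \<noteq> 0" using l by auto
    then show ?thesis by blast
  qed
  moreover have "\<forall>x\<in>(*) l ` L. x \<noteq> 0 \<longrightarrow> absv l * C \<le> absv x"
    using C by (auto simp: absv_mult intro!: mult_left_mono)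
  moreover have "absv l * C > 0" using C l by simp
  moreover have "\<forall>x\<in>(*) l ` L. absv (cnjg x) \<le> absv (cnjg l) * C'"
  proof
    fix y assume "y \<in> (*) l ` L"
    then obtain x where x: "x \<in> L" "y = l * x" by blast
    then have "absv (cnjg y) = absv (cnjg l) * absv (cnjg x)" using LK l by (simp only: cnjg_mult absv_mult subsetD)
    also have "\<dots> \<le> absv (cnjg l) * C'" using C'[OF x(1)] by (intro mult_left_mono) auto
    finally show "absv (cnjg y) \<le> absv (cnjg l) * C'" .
  qed
  ultimately show ?thesis unfolding lattice_module_def
    by (intro conjI R_module_image_scale[OF rL] exI[of _ "absv l * C"] exI[of _ "absv (cnjg l) * C'"]) assumption+
qed

text \<open>If T lam is not in \<open>L\<close>, then by \<open>Tx_mult_in_module\<close> the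
  conjugate of lam is as large as any in \<open>L\<close>. Subtracting a scalar multiple of lam from
  x therefore makes the conjugate strictly smaller than this maximum, and the same lemma applies to
  the difference.\<close>

lemma lattice_module_codim1:
  assumes L: "lattice_module L" and lam: "lam \<in> L" "Tx * lam \<notin> L" and x: "x \<in> L"
  shows "\<exists>c. Tx * (x - fls_const c * lam) \<in> L"
proof -
  have rL: "R_module L" and LK: "L \<subseteq> K" using L by (auto simp: lattice_module_def)
  obtain C where C: "\<And>x. x \<in> L \<Longrightarrow> absv (cnjg x) \<le> C" using L by (auto simp: lattice_module_def)
  obtain N where N: "C < real CARD('a) ^ N"
    using real_arch_pow[OF card_real_gt_1[where 'a='a]] by blast
  have lam0: "lam \<noteq> 0" using lam R_module_0[OF rL] by auto
  have sd: "fls_subdegree (cnjg y) \<ge> - int N" if "y \<in> L" "y \<noteq> 0" for y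
  proof -
    have "absv (cnjg y) \<le> absv (Tx ^ N :: 'a fls)" using C[OF that(1)] N by (simp add: absv_Tx_power)
    moreover have "cnjg y \<noteq> 0" using cnjg_eq_0_iff that LK by blast
    ultimately show ?thesis by (subst (asm) absv_le_iff_subdegree) (auto simp: Tx_def)
  qed
  \<comment> \<open>The order of the conjugate, shifted by N to become a natural number, so that an
    element \<open>x1\<close> with largest conjugate exists.\<close>
  define h where "h = (\<lambda>y. nat (fls_subdegree (cnjg y) + int N))"
  obtain x1 where x1: "x1 \<in> L \<and> x1 \<noteq> 0" "\<And>y. y \<in> L \<and> y \<noteq> 0 \<Longrightarrow> h x1 \<le> h y"
    using ex_has_least_nat[of "\<lambda>y. y \<in> L \<and> y \<noteq> 0" lam h] lam lam0 by blast
  have max: "absv (cnjg y) \<le> absv (cnjg x1)" if y: "y \<in> L" for y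
  proof (cases "y = 0")
    case True
    then show ?thesis using cnjg_const[of 0] by simp
  next
    case False
    have "fls_subdegree (cnjg x1) \<le> fls_subdegree (cnjg y)"
      using x1(2)[of y] y False sd[of x1] sd[of y] x1(1) by (auto simp: h_def)
    then show ?thesis
      using False y x1(1) LK cnjg_eq_0_iff by (subst absv_le_iff_subdegree) auto
  qed
  have lx: "absv (cnjg lam) = absv (cnjg x1)"
    using max[OF lam(1)] Tx_mult_in_module[OF rL LK, of x1 lam] x1(1) lam by force
  have lK: "lam \<in> K" "x \<in> K" using LK lam x by auto
  have "cnjg lam \<noteq> 0" using cnjg_eq_0_iff[OF lK(1)] lam0 by simp
  then obtain c where c: "absv (cnjg x - fls_const c * cnjg lam) < absv (cnjg lam)"
    using ex_smaller_absv_diff[of "cnjg lam" "cnjg x"] max[OF x] lx by auto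
  have e: "cnjg (x - fls_const c * lam) = cnjg x - fls_const c * cnjg lam"
    using lK by (simp add: cnjg_diff cnjg_mult K_mult K_const cnjg_const)
  have "x - fls_const c * lam \<in> L"
    using x lam by (intro R_module_diff[OF rL] fq_subspace_scale[OF R_module_fq_subspace[OF rL]])
  then have "Tx * (x - fls_const c * lam) \<in> L"
    using x1(1) c lx e by (intro Tx_mult_in_module[OF rL LK, of x1]) auto
  then show ?thesis by blast
qed

lemma lattice_lattice_module:
  assumes L: "lattice_module L" and one: "shortest L 1"
    and lam: "lam \<in> L" "Tx * lam \<notin> L"
  shows "normalised_lattice L lam"
proof
  have rL: "R_module L" using L by (auto simp: lattice_module_def)
  show "fq_subspace L" by (rule R_module_fq_subspace[OF rL])
  show "finite_balls L" by (rule lattice_module_finite_balls[OF L])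
  show "1 \<in> L" using one by (simp add: shortest_def)
  show "absv x \<ge> 1" if "x \<in> L" "x \<noteq> 0" for x using one that by (auto simp: shortest_def)
  show "lam \<in> L" "Tx * lam \<notin> L" by (fact lam)+
  show "\<exists>c. Tx * (x - fls_const c * lam) \<in> L" if "x \<in> L" for x
    by (rule lattice_module_codim1[OF L lam that])
  show "\<exists>n0. \<forall>n\<ge>n0. \<exists>x\<in>L. absv x = real CARD('a) powi n"
  proof (intro exI[of _ "int d"] allI impI)
    fix n assume "n \<ge> int d"
    define n' where "n' = nat n"
    have n': "n = int n'" "n' \<ge> d" using \<open>n \<ge> int d\<close> by (auto simp: n'_def)
    obtain g where g: "g \<in> R" "absv g = real CARD('a) ^ n'"
      using R_ex_absv[OF n'(2)] by blast
    have "g * 1 \<in> L" using one by (intro R_module_mult[OF rL g(1)]) (simp add: shortest_def)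
    moreover have "absv g = real CARD('a) powi n" using g n' by simp
    ultimately show "\<exists>x\<in>L. absv x = real CARD('a) powi n" by auto
  qed
qed

lemma lattice_module_ex_ascent:
  assumes L: "lattice_module L" shows "\<exists>m. ascent L m"
proof -
  have rL: "R_module L" and LK: "L \<subseteq> K" using L by (auto simp: lattice_module_def)
  obtain C where C: "\<And>x. x \<in> L \<Longrightarrow> absv (cnjg x) \<le> C" using L by (auto simp: lattice_module_def)
  obtain x where x: "shortest L x" using lattice_module_ex_shortest[OF L] by blast
  then have x0: "x \<in> L" "x \<in> K" "cnjg x \<noteq> 0" using LK cnjg_eq_0_iff by (auto simp: shortest_def)
  obtain N where N: "C / absv (cnjg x) < real CARD('a) ^ N"
    using real_arch_pow[OF card_real_gt_1[where 'a='a]] by blast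
  have "x * Tx ^ N \<notin> L"
  proof
    assume "x * Tx ^ N \<in> L"
    from C[OF this] have "absv (cnjg x) * real CARD('a) ^ N \<le> C"
      using x0 by (simp add: cnjg_mult K_Tx_power cnjg_Tx_power absv_mult absv_Tx_power)
    then show False using N x0(3) by (simp add: field_simps)
  qed
  define n where "n = (LEAST n. x * Tx ^ n \<notin> L)"
  have n: "x * Tx ^ n \<notin> L" unfolding n_def using \<open>x * Tx ^ N \<notin> L\<close> by (rule LeastI)
  have n2: "x * Tx ^ j \<in> L" if "j < n" for j using not_less_Least[of j "\<lambda>n. x * Tx ^ n \<notin> L"] that n_def by blast
  have "n \<noteq> 0" using n x0 by (metis mult.right_neutral power_0)
  then obtain m where "n = Suc m" using not0_implies_Suc by blast
  then show ?thesis using n n2 x unfolding ascent_def by (intro exI[of _ m]) auto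
qed

lemma lattice_module_normalise:
  assumes L: "lattice_module L" and x: "shortest L x"
  defines "M \<equiv> (*) (inverse x) ` L"
  shows "lattice_module M" "shortest M 1" "jinv M = jinv L" "\<And>y. y \<in> M \<longleftrightarrow> x * y \<in> L"
proof -
  have x0: "x \<noteq> 0" "x \<in> K" using x L by (auto simp: shortest_def lattice_module_def)
  then show "lattice_module M" unfolding M_def using K_inverse by (intro lattice_module_image_scale[OF L]) auto
  show "shortest M 1" unfolding M_def using shortest_image_scale[OF x, of "inverse x"] x0 by simp
  show "jinv M = jinv L" unfolding M_def using jinv_image_scale[OF lattice_module_finite_balls[OF L]] x0 by simp
  show "y \<in> M \<longleftrightarrow> x * y \<in> L" for y
  proof
    assume "x * y \<in> L"
    then show "y \<in> M" unfolding M_def using x0 by (intro image_eqI[of _ _ "x * y"]) (simp_all add: mult.assoc[symmetric])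
  qed (use x0 in \<open>auto simp: M_def mult.assoc[symmetric]\<close>)
qed

lemma absv_jinv_lattice_module_le:
  assumes L: "lattice_module L" and m: "ascent L m"
  shows "absv (jinv L) \<le> real CARD('a) ^ ((CARD('a))\<^sup>2 + CARD('a) + geom_exp CARD('a) m * (CARD('a))\<^sup>2 + d)"
proof -
  obtain x where x: "shortest L x" "\<forall>j\<le>m. x * Tx ^ j \<in> L" "x * Tx ^ Suc m \<notin> L"
    using m by (auto simp: ascent_def)
  define M where "M = (*) (inverse x) ` L"
  note M = lattice_module_normalise[OF L x(1), folded M_def]
  have rM: "R_module M" using M(1) by (rule lattice_module_R_module)
  have T: "Tx ^ j \<in> M" if "j \<le> m" for j using x(2) that M(4) by blast
  have T2: "Tx ^ Suc m \<notin> M" using x(3) M(4) by blast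
  interpret normalised_lattice M "Tx ^ m"
    using T[of m] T2 by (intro lattice_lattice_module[OF M(1,2)]) auto
  have "inverse (real CARD('a) ^ d) \<le> absv (Tx ^ Suc m - y)" if y: "y \<in> M" for y
  proof -
    \<comment> \<open>One factor T is absorbed into f T, which lies in \<open>R\<close>; hence f
      T^(m+1) lies in \<open>M\<close> although T^(m+1) does not.\<close>
    have "f * Tx ^ Suc m = (f * Tx ^ 1) * Tx ^ m" by (simp add: ac_simps)
    also have "\<dots> \<in> M" using d by (intro R_module_mult[OF rM] R_f_Tx T) auto
    finally have "f * Tx ^ Suc m - f * y \<in> M"
      using R_module_mult[OF rM R_f_Tx[of 0] y] by (intro R_module_diff[OF rM]) auto
    moreover have "f * Tx ^ Suc m - f * y = f * (Tx ^ Suc m - y)" by (simp add: algebra_simps)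
    ultimately have fM: "f * (Tx ^ Suc m - y) \<in> M" by metis
    have "Tx ^ Suc m - y \<noteq> 0" using T2 y by auto
    then have "1 \<le> absv (f * (Tx ^ Suc m - y))" using f_nonzero by (intro minimal fM) simp
    then have "1 \<le> real CARD('a) ^ d * absv (Tx ^ Suc m - y)" by (simp only: absv_mult absv_f)
    then show ?thesis using card_power_gt_1 by (simp add: field_simps)
  qed
  then show ?thesis using absv_jinv_le[OF refl T, of d] M(3) by simp
qed

text \<open>x (1,T)^(d-1) contains an element of size |x| q^n for every n: x T^n for n < d, and
  multiples of x by elements of \<open>R\<close> beyond. Subtracting such elements reduces any
  vector of \<open>L\<close> until it is shorter than \<open>x\<close>, hence zero.\<close>

lemma full_module:
  assumes L: "lattice_module L" and x: "shortest L x" and T: "\<And>j. j < d \<Longrightarrow> x * Tx ^ j \<in> L"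
  shows "L = (*) x ` adjT_iter (d - 1) R"
proof (intro equalityI subsetI)
  have rL: "R_module L" using L by (rule lattice_module_R_module)
  have x0: "x \<noteq> 0" using x by (simp add: shortest_def)
  have sub: "x * g \<in> L" if g: "g \<in> adjT_iter (d - 1) R" for g
  proof -
    obtain l where l: "\<forall>j. l j \<in> R" "g = (\<Sum>j\<le>d - 1. Tx ^ j * l j)" using adjT_iter_sum[OF R_module_R g] by blast
    have "x * g = (\<Sum>j\<le>d - 1. l j * (x * Tx ^ j))" unfolding l(2) sum_distrib_left
      by (rule sum.cong) (simp_all add: ac_simps)
    also have "\<dots> \<in> L" using l(1) d by (intro fq_subspace_sum[OF R_module_fq_subspace[OF rL]] R_module_mult[OF rL] T) auto
    finally show ?thesis .
  qed
  then show "y \<in> L" if "y \<in> (*) x ` adjT_iter (d - 1) R" for y using that by auto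
  have rS: "R_module ((*) x ` adjT_iter (d - 1) R)" by (intro R_module_image_scale R_module_adjT_iter R_module_R)
  have gen: "\<exists>g\<in>adjT_iter (d - 1) R. absv g = real CARD('a) ^ n" for n
  proof (cases "n < d")
    case True
    then have "Tx ^ n * 1 \<in> adjT_iter (d - 1) R" by (intro Tx_power_mult_adjT_iter[OF R_module_R R_1]) auto
    then show ?thesis by (intro bexI[of _ "Tx ^ n"]) (auto simp: absv_Tx_power)
  next
    case False
    then have "n \<ge> d" by simp
    from R_ex_absv[OF this] show ?thesis using adjT_iter_mono[OF R_module_R, of 0 "d - 1"] by auto
  qed
  have main: "y \<in> (*) x ` adjT_iter (d - 1) R" if "y \<in> L" "absv (y / x) \<le> real CARD('a) ^ n" for y n
    using that
  proof (induction n arbitrary: y)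
    case 0
    then obtain c where c: "absv (y / x - fls_const c * 1) < 1" using ex_smaller_absv_diff[of 1 "y / x"] by auto
    have e: "y - fls_const c * x = x * (y / x - fls_const c * 1)" using x0 by (simp add: field_simps)
    have "y - fls_const c * x \<in> L"
      using 0 x by (intro R_module_diff[OF rL] fq_subspace_scale[OF R_module_fq_subspace[OF rL]]) (auto simp: shortest_def)
    moreover have "absv (y - fls_const c * x) < absv x" unfolding e using c x0 by (simp add: absv_mult)
    ultimately have "y = fls_const c * x" using x by (force simp: shortest_def)
    moreover have "fls_const c \<in> adjT_iter (d - 1) R" using adjT_iter_mono[OF R_module_R, of 0 "d - 1"] Ainf1.const by auto
    moreover have "fls_const c * x = x * fls_const c" by (rule mult.commute)
    ultimately show ?case by blast
  next
    case (Suc n)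
    obtain g where g: "g \<in> adjT_iter (d - 1) R" "absv g = real CARD('a) ^ Suc n" using gen by blast
    have "g \<noteq> 0" using g card_real_gt_1[where 'a='a] by auto
    then obtain c where c: "absv (y / x - fls_const c * g) < absv g"
      using ex_smaller_absv_diff[of g "y / x"] Suc.prems g by auto
    have cg: "fls_const c * (x * g) \<in> (*) x ` adjT_iter (d - 1) R"
      using g by (intro fq_subspace_scale[OF R_module_fq_subspace[OF rS]]) auto
    have "y - fls_const c * (x * g) \<in> L"
      using Suc.prems sub[OF g(1)] by (intro R_module_diff[OF rL] fq_subspace_scale[OF R_module_fq_subspace[OF rL]])
    moreover have e: "(y - fls_const c * (x * g)) / x = y / x - fls_const c * g"
      using x0 by (simp add: field_simps)
    have "absv (y / x - fls_const c * g) < real CARD('a) powi (int n + 1)"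
      using c g(2) by (simp add: power_int_add mult.commute)
    then have "absv ((y - fls_const c * (x * g)) / x) \<le> real CARD('a) ^ n"
      unfolding e absv_less_powi_iff by simp
    ultimately have "y - fls_const c * (x * g) \<in> (*) x ` adjT_iter (d - 1) R" by (rule Suc.IH)
    from R_module_add[OF rS this cg] show ?case by simp
  qed
  fix y assume y: "y \<in> L"
  obtain n where "absv (y / x) < real CARD('a) ^ n"
    using real_arch_pow[OF card_real_gt_1[where 'a='a]] by blast
  then show "y \<in> (*) x ` adjT_iter (d - 1) R" using main[OF y, of n] by simp
qed

end

section \<open>The norm of the invariant\<close>

context quad
begin

section \<open>Exact sizes for the class of (1)\<close>

lemma adjT_iter_R_cnjg: "x \<in> adjT_iter i R \<Longrightarrow> x \<in> Af \<and> absv (cnjg x) \<le> real CARD('a) ^ i"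
proof (induction i arbitrary: x)
  case 0
  then show ?case using R_subset by simp
next
  case (Suc i)
  from Suc.prems have "x \<in> adjT (adjT_iter i R)" by simp
  then obtain u v where x: "u \<in> adjT_iter i R" "v \<in> adjT_iter i R" "x = u + Tx * v" by (rule adjTE)
  have A: "Tx \<in> Af" using Af_Tx_power[of 1] by simp
  have u: "u \<in> Af" "absv (cnjg u) \<le> real CARD('a) ^ i" and v: "v \<in> Af" "absv (cnjg v) \<le> real CARD('a) ^ i"
    using Suc.IH x by auto
  have "cnjg x = cnjg u + Tx * cnjg v"
    unfolding x(3) cnjg_add[OF Af_K[OF u(1)] Af_K[OF Af_mult[OF A v(1)]]] cnjg_mult[OF K_Tx Af_K[OF v(1)]] cnjg_Tx ..
  then have "absv (cnjg x) \<le> max (absv (cnjg u)) (real CARD('a) * absv (cnjg v))"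
    using absv_add_le[of "cnjg u" "Tx * cnjg v"] by (simp add: absv_mult)
  also have "\<dots> \<le> real CARD('a) ^ Suc i"
  proof -
    have "real CARD('a) ^ i \<le> real CARD('a) ^ Suc i"
      using card_real_gt_1[where 'a='a] by (intro power_increasing) auto
    then show ?thesis using u v by (auto intro: mult_left_mono order.trans)
  qed
  finally show ?case unfolding x(3) using A u v by (auto intro!: Af_add Af_mult)
qed

context
  fixes i :: nat
  assumes i: "i < d"
begin

lemma adjT_iter_R_cases:
  assumes "x \<in> adjT_iter i R"
  shows "(\<exists>u. x = polyA u) \<and> absv x \<le> real CARD('a) ^ i \<or> absv x \<ge> real CARD('a) ^ d"
proof -
  have "real CARD('a) ^ i < real CARD('a) ^ d"
    using i card_real_gt_1[where 'a='a] by (intro power_strict_increasing) auto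
  then show ?thesis using adjT_iter_R_cnjg[OF assms] Af_cases[of x] by auto
qed

lemma shortest_adjT_iter_R: "shortest (adjT_iter i R) 1"
  unfolding shortest_def
proof (intro conjI ballI impI)
  show "1 \<in> adjT_iter i R" using adjT_iter_mono[OF R_module_R, of 0 i] R_1 by auto
  fix y assume y: "y \<in> adjT_iter i R" "y \<noteq> 0"
  from adjT_iter_R_cases[OF y(1)] show "absv (1 :: 'a fls) \<le> absv y"
  proof
    assume "(\<exists>u. y = polyA u) \<and> absv y \<le> real CARD('a) ^ i"
    then obtain u where "y = polyA u" by blast
    then show ?thesis using y absv_polyA[of u] card_real_gt_1[where 'a='a] by (auto simp: one_le_power)
  qed (use card_power_gt_1 in simp)
qed simp

lemma Tx_power_in_adjT_iter_R: "j \<le> i \<Longrightarrow> Tx ^ j \<in> adjT_iter i R"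
  using Tx_power_mult_adjT_iter[OF R_module_R R_1, of j i] by simp

lemma Tx_power_notin_adjT_iter_R: "Tx * Tx ^ i \<notin> adjT_iter i R"
proof
  assume "Tx * Tx ^ i \<in> adjT_iter i R"
  then have "absv (cnjg (Tx ^ Suc i)) \<le> real CARD('a) ^ i" using adjT_iter_R_cnjg by auto
  then have "real CARD('a) ^ Suc i \<le> real CARD('a) ^ i" by (simp only: cnjg_Tx_power absv_Tx_power)
  then show False using card_real_gt_1[where 'a='a] by simp
qed

lemma lattice_adjT_iter_R: "normalised_lattice (adjT_iter i R) (Tx ^ i)"
  by (rule lattice_lattice_module[OF lattice_module_adjT_iter[OF lattice_module_R] shortest_adjT_iter_R Tx_power_in_adjT_iter_R Tx_power_notin_adjT_iter_R]) simp

text \<open>T^(i+1) is tested against the vectors of length at most q^(i+1). For i + 1 < d these are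
  the polynomials of degree at most i, and \<open>absv_exp_fun_low_degree\<close> applies. For i = d
  - 1 the element f enters and T^d comes within q^(-d) of the lattice, which gives the extra d in
  the exponent. The factor with \<open>if\<close> stands on the left to keep exponents
  natural.\<close>

lemma absv_jinv_adjT_iter_R:
  "absv (jinv (adjT_iter i R)) * (if Suc i < d then real CARD('a) ^ geom_exp CARD('a) (Suc i) else 1) =
    real CARD('a) ^ ((CARD('a))\<^sup>2 + CARD('a) + geom_exp CARD('a) i * (CARD('a))\<^sup>2 + (if Suc i < d then 0 else d))"
proof -
  let ?q = "real CARD('a)"
  let ?n = "(CARD('a))\<^sup>2 + CARD('a) + geom_exp CARD('a) i * (CARD('a))\<^sup>2"
  have q: "?q > 1" by (rule card_real_gt_1)
  interpret normalised_lattice "adjT_iter i R" "Tx ^ i" by (rule lattice_adjT_iter_R)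
  have j: "absv (jinv (adjT_iter i R)) = ?q ^ ?n / absv (exp_fun (trunc (adjT_iter i R) (int i + 1)) (Tx ^ Suc i))"
    by (rule absv_jinv_power[OF refl Tx_power_in_adjT_iter_R])
  show ?thesis
  proof (cases "Suc i < d")
    case True
    have "trunc (adjT_iter i R) (int i + 1) = low_degree (Suc i)"
    proof (intro equalityI subsetI)
      fix x assume x: "x \<in> trunc (adjT_iter i R) (int i + 1)"
      have "?q powi (int i + 1) = ?q ^ Suc i" using power_int_of_nat[of ?q "Suc i"] by (simp add: add.commute)
      also have "\<dots> < ?q ^ d" using q True by (intro power_strict_increasing) auto
      finally have "absv x \<le> ?q ^ i" using x adjT_iter_R_cases[of x] by auto
      then have "x \<in> trunc (adjT_iter i R) (int i)" using x by simp
      then show "x \<in> low_degree (Suc i)" using trunc_subset_low_degree[OF Tx_power_in_adjT_iter_R] by blast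
    next
      fix x :: "'a fls" assume x: "x \<in> low_degree (Suc i)"
      then have "x \<in> adjT_iter i R" using low_degree_subset[OF fq_subspace, of "Suc i"] Tx_power_in_adjT_iter_R by auto
      moreover have "absv x \<le> ?q powi (int i + 1)"
        using low_degree_absv_less[OF x] power_int_of_nat[of ?q "Suc i"] by (simp add: add.commute)
      ultimately show "x \<in> trunc (adjT_iter i R) (int i + 1)" by simp
    qed
    moreover have "absv (exp_fun (low_degree (Suc i)) (Tx ^ Suc i :: 'a fls)) = ?q ^ geom_exp CARD('a) (Suc i)"
      using absv_exp_fun_low_degree[of "Tx ^ Suc i :: 'a fls" "Suc i" "Suc i"] absv_Tx_power[of "Suc i", where 'a='a] by simp
    ultimately show ?thesis using j True q by simp
  next
    case False
    then have d_eq: "d = Suc i" using i by simp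
    let ?V = "trunc (adjT_iter i R) (int i + 1)"
    have V: "finite ?V" "fq_subspace ?V" by (rule finite_trunc, rule fq_subspace_trunc)
    have powi: "?q powi (int i + 1) = ?q ^ d" unfolding d_eq using power_int_of_nat[of ?q "Suc i"] by (simp add: add.commute)
    \<comment> \<open>As \<open>a\<close> is monic of degree d and equals f + f', the power T^d is
      congruent to f' modulo the lattice, and |f'| = q^(-d) is below the minimum 1.\<close>
    have "Tx ^ d - f' = f - (\<Sum>j\<le>i. Tx ^ j * fls_const (coeff a j))"
      using polyA_sum[OF eq_refl[OF deg_a]] monic unfolding deg_a unfolding d_eq
      by (simp add: algebra_simps)
    also have "\<dots> \<in> adjT_iter i R"
      using R_f_Tx[of 0] adjT_iter_mono[OF R_module_R, of 0 i]
      by (intro R_module_diff[OF R_module_adjT_iter[OF R_module_R]] sum_adjT_iter[OF R_module_R] Ainf1.const) auto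
    finally have tL: "Tx ^ d - f' \<in> adjT_iter i R" .
    have "absv f' \<le> ?q ^ d"
      unfolding absv_f' using card_power_gt_1 by (simp add: field_simps) (metis less_imp_le less_1_mult)
    then have "absv (Tx ^ d - f') \<le> ?q ^ d" using absv_diff_le[of "Tx ^ d" f'] by (simp add: absv_Tx_power)
    then have "exp_fun ?V (Tx ^ d - f') = 0" using tL exp_fun_eq_0_iff[OF V] powi by simp
    then have "exp_fun ?V (Tx ^ d) = exp_fun ?V f'" by (simp only: exp_fun_diff[OF V]) simp
    also have "absv (exp_fun ?V f') = absv (exp_fun {0} f')"
    proof (rule absv_exp_fun_restrict[OF V(1)])
      show "{0} \<subseteq> ?V" using fq_subspace_0[OF V(2)] by simp
      fix v assume "v \<in> ?V - {0}"
      then have "1 \<le> absv v" using minimal by auto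
      moreover have "absv f' < 1" unfolding absv_f' using card_power_gt_1 by (simp add: field_simps)
      ultimately show "absv f' < absv v" by simp
    qed
    finally have "absv (exp_fun ?V (Tx ^ Suc i)) = inverse (?q ^ d)" unfolding d_eq[symmetric] by (simp add: absv_f')
    then show ?thesis using j False by (simp add: power_add divide_inverse)
  qed
qed

end

lemma jinv_ideal_mult_a_ideal:
  assumes "lattice_module L"
  shows "jinv (ideal_mult L (a_ideal f d i)) = jinv (adjT_iter i L)"
  unfolding ideal_mult_a_ideal[OF lattice_module_R_module[OF assms]]
  by (rule jinv_image_scale[OF lattice_module_finite_balls[OF lattice_module_adjT_iter[OF assms]] f_nonzero])

lemma normj_eq: "lattice_module L \<Longrightarrow> normj f d L = (\<Prod>i<d. jinv (adjT_iter i L))"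
  by (simp add: normj_def jinv_ideal_mult_a_ideal)

text \<open>Multiply B (1,T)^i = x (1,T)^(d-1) by (1,T)^(d-i) and cancel (1,T)^d = f^(-1) R on both
  sides; what remains exhibits \<open>B\<close> as a multiple of (1,T)^(d-1-i).\<close>

lemma same_class_if_full:
  assumes B: "lattice_module B" and i: "i < d" and x: "x \<in> K" "x \<noteq> 0" and e: "adjT_iter i B = (*) x ` adjT_iter (d - 1) R"
  shows "same_class f (a_ideal f d (d - 1 - i)) B"
proof -
  let ?n = "d - 1 - i"
  have "(*) (inverse f) ` B = adjT_iter (d - i) (adjT_iter i B)"
    using adjT_iter_d[OF lattice_module_R_module[OF B]] i by (simp add: funpow_add[symmetric, THEN fun_cong, unfolded o_apply])
  also have "\<dots> = (*) x ` adjT_iter (d - i) (adjT_iter (d - 1) R)" unfolding e adjT_iter_image_scale ..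
  also have "adjT_iter (d - i) (adjT_iter (d - 1) R) = adjT_iter ?n (adjT_iter d R)"
    using i by (simp add: funpow_add[symmetric, THEN fun_cong, unfolded o_apply])
  also have "\<dots> = (*) (inverse f) ` adjT_iter ?n R"
    unfolding adjT_iter_d[OF R_module_R] adjT_iter_image_scale ..
  finally have *: "(*) (inverse f) ` B = (*) x ` (*) (inverse f) ` adjT_iter ?n R" .
  have "B = (*) f ` (*) (inverse f) ` B"
    using f_nonzero by (simp add: image_image mult.assoc[symmetric])
  also have "\<dots> = (*) (x / f) ` a_ideal f d ?n"
    unfolding * a_ideal_eq image_image using f_nonzero by (intro image_cong) (simp_all add: field_simps)
  finally have "B = (\<lambda>y. x / f * y) ` a_ideal f d ?n" .
  moreover have "x / f \<in> K" "x / f \<noteq> 0" using x f_nonzero by (auto intro: K_divide K_f)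
  ultimately show ?thesis unfolding same_class_def by blast
qed

end

section \<open>Comparison of exponents\<close>

lemma geom_exp_Suc': "geom_exp q (Suc m) = q + q * geom_exp q m"
proof (induction m)
  case (Suc m)
  have "geom_exp q (Suc (Suc m)) = (q + q * geom_exp q m) + q ^ Suc (Suc m)"
    unfolding Suc.IH[symmetric] by (rule geom_exp_Suc)
  moreover have "q * geom_exp q (Suc m) = q * geom_exp q m + q ^ Suc (Suc m)" by (simp add: distrib_left)
  ultimately show ?case by linarith
qed simp

lemma geom_exp_mono: "m \<le> n \<Longrightarrow> geom_exp q m \<le> geom_exp q n"
  unfolding geom_exp_def by (rule sum_mono2) auto

text \<open>For q \<ge> 2 the values of \<open>geom_exp q\<close> at least double at each step, so
  the last term dominates the sum like a geometric series of ratio 1/2.\<close>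

lemma sum_geom_exp_le: "q \<ge> 2 \<Longrightarrow> (\<Sum>i<n. geom_exp q (Suc i)) \<le> 2 * geom_exp q n"
proof (induction n)
  case (Suc n)
  have "2 * geom_exp q n \<le> q * geom_exp q n" using Suc.prems by simp
  then have "2 * geom_exp q n \<le> geom_exp q (Suc n)" unfolding geom_exp_Suc' by linarith
  then show ?case using Suc by simp
qed simp

lemma geom_exp_gt: 
  assumes "q \<ge> 2" "n \<ge> 1" shows "n * n + n < 2 * geom_exp q n"
  using assms(2)
proof (induction n rule: dec_induct)
  case base
  then show ?case using assms(1) by (simp add: geom_exp_def)
next
  case (step n)
  have "n + 1 < 2 ^ Suc n" using less_exp[of "Suc n"] by simp
  also have "\<dots> \<le> q ^ Suc n" using assms(1) by (rule power_mono) simp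
  finally show ?case using step.IH by simp
qed

text \<open>With n = d - 1 and G = \<open>geom_exp q\<close>, the term i = n on the right, absent
  from the bound on \<open>s\<close>, is worth q^2 G_n \<ge> 4 G_n. Half of 4 G_n covers the sum of
  the G_(i+1), the other half covers d^2 - d = n^2 + n.\<close>

lemma exponent_inequality:
  assumes q: "q \<ge> 2" and d: "d \<ge> 2" and s: "s \<le> (\<Sum>i<d - 1. geom_exp q i)"
  shows "s * q\<^sup>2 + d * d + (\<Sum>i<d - 1. geom_exp q (Suc i)) < (\<Sum>i<d. geom_exp q i) * q\<^sup>2 + d"
proof -
  obtain n where n: "d = Suc n" "n \<ge> 1" using d by (cases d) auto
  have "4 * geom_exp q n \<le> geom_exp q n * q\<^sup>2"
  proof -
    have "2 * 2 \<le> q * q" using q by (intro mult_mono) auto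
    then show ?thesis by (simp add: power2_eq_square)
  qed
  moreover have "s * q\<^sup>2 \<le> (\<Sum>i<n. geom_exp q i) * q\<^sup>2"
    using s unfolding n(1) diff_Suc_1 by (rule mult_right_mono) simp
  moreover have "Suc n * Suc n = n * n + n + Suc n" by simp
  ultimately show ?thesis
    using sum_geom_exp_le[OF q, of n] geom_exp_gt[OF q n(2)]
    unfolding n(1) diff_Suc_1 sum.lessThan_Suc distrib_right by linarith
qed

text \<open>
  The cyclic sequence \<open>m\<close> consists of ascending runs \<open>0, 1, \<dots>\<close>, and no run has full length \<open>d\<close>.
\<close>

lemma sum_cyclic_runs_le:
  fixes m :: "nat \<Rightarrow> nat" and g :: "nat \<Rightarrow> nat"
  assumes d: "d \<ge> 1" and mono: "\<And>i j. i \<le> j \<Longrightarrow> g i \<le> g j" and g0: "g 0 = 0"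
    and per: "\<And>i. m (i + d) = m i" and step: "\<And>i k. m (Suc i) = Suc k \<Longrightarrow> m i = k"
    and bound: "\<And>i. Suc (m i) < d"
  shows "(\<Sum>i<d. g (m i)) \<le> (\<Sum>i<d - 1. g i)"
proof -
  \<comment> \<open>Without a zero, \<open>step\<close> would make \<open>m\<close> grow by one at
    every index, against periodicity.\<close>
  have "\<exists>s. m s = 0"
  proof (rule ccontr)
    assume n: "\<nexists>s. m s = 0"
    have "m i = m 0 + i" for i
    proof (induction i)
      case (Suc i)
      obtain k where "m (Suc i) = Suc k" using n not0_implies_Suc by blast
      then show ?case using step[of i k] Suc by simp
    qed simp
    from this[of d] show False using per[of 0] d by simp
  qed
  then obtain s where s: "m s = 0" by blast
  have shift: "(\<Sum>i<d. g (m (n + i))) = (\<Sum>i<d. g (m i))" for n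
  proof (induction n)
    case (Suc n)
    have "g (m n) + (\<Sum>i<d. g (m (Suc n + i))) = (\<Sum>i<Suc d. g (m (n + i)))"
      by (simp only: sum.lessThan_Suc_shift) simp
    also have "\<dots> = (\<Sum>i<d. g (m (n + i))) + g (m n)" using per[of n] by simp
    finally show ?case using Suc by simp
  qed simp
  have le: "m (t + i) \<le> i" if "m t = 0" for t i
  proof (induction i)
    case (Suc i)
    show ?case
    proof (cases "m (Suc (t + i))")
      case (Suc k)
      then show ?thesis using step[of "t + i" k] \<open>m (t + i) \<le> i\<close> by simp
    qed simp
  qed (use that in simp)
  \<comment> \<open>A single zero in a period would start a run 0, ..., d - 1, whose last value
    violates \<open>bound\<close>.\<close>
  have "\<exists>t. 0 < t \<and> t < d \<and> m (s + t) = 0"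
  proof (rule ccontr)
    assume n: "\<not> ?thesis"
    have "m (s + i) = i" if "i < d" for i
      using that
    proof (induction i)
      case (Suc i)
      then obtain k where k: "m (Suc (s + i)) = Suc k" using n not0_implies_Suc
        by (metis add_Suc_right zero_less_Suc)
      then show ?case using step[of "s + i" k] Suc by simp
    qed (use s in simp)
    from this[of "d - 1"] show False using bound[of "s + (d - 1)"] d by simp
  qed
  then obtain t where t: "0 < t" "t < d" "m (s + t) = 0" by blast
  define r where "r = d - t - 1"
  have dt: "d = t + Suc r" "d - 1 = t + r" using t by (auto simp: r_def)
  have split: "(\<Sum>i<t + n. h i) = (\<Sum>i<t. h i) + (\<Sum>i<n. h (t + i))" for h :: "nat \<Rightarrow> nat" and n
    by (induction n) simp_all
  have "(\<Sum>i<d. g (m i)) = (\<Sum>i<t + Suc r. g (m (s + i)))"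
    unfolding dt(1)[symmetric] shift ..
  also have "\<dots> = (\<Sum>i<t. g (m (s + i))) + (\<Sum>i<Suc r. g (m (s + t + i)))"
    unfolding split by (simp add: add.assoc)
  also have "\<dots> \<le> (\<Sum>i<t. g i) + (\<Sum>i<Suc r. g i)"
    using le[OF s] le[OF t(3)] by (intro add_mono sum_mono mono)
  \<comment> \<open>The two blocks have lengths t and r + 1 with t + r + 1 = d. The second loses its
    first term g 0 = 0, and its terms g 1, ..., g r are dominated by g t, ..., g (t + r - 1) because
    t \<ge> 1.\<close>
  also have "(\<Sum>i<Suc r. g i) = (\<Sum>i<r. g (Suc i))" using g0 by (simp add: sum.lessThan_Suc_shift del: sum.lessThan_Suc)
  also have "(\<Sum>i<t. g i) + \<dots> \<le> (\<Sum>i<t. g i) + (\<Sum>i<r. g (t + i))"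
    using t(1) by (intro add_mono sum_mono mono) auto
  also have "\<dots> = (\<Sum>i<d - 1. g i)" unfolding dt(2) split ..
  finally show ?thesis .
qed

context quad
begin

lemma absv_normj_R:
  "absv (normj f d R) * real CARD('a) ^ (\<Sum>i<d - 1. geom_exp CARD('a) (Suc i)) =
    real CARD('a) ^ (d * ((CARD('a))\<^sup>2 + CARD('a)) + (\<Sum>i<d. geom_exp CARD('a) i) * (CARD('a))\<^sup>2 + d)"
proof -
  let ?q = "CARD('a)"
  obtain n where n: "d = Suc n" using d by (cases d) auto
  let ?c = "\<lambda>i. if Suc i < d then real ?q ^ geom_exp ?q (Suc i) else 1"
  let ?e = "\<lambda>i. ?q\<^sup>2 + ?q + geom_exp ?q i * ?q\<^sup>2 + (if Suc i < d then 0 else d)"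
  have "absv (normj f d R) * (\<Prod>i<d. ?c i) = (\<Prod>i<d. absv (jinv (adjT_iter i R)) * ?c i)"
    by (simp only: normj_eq[OF lattice_module_R] absv_prod prod.distrib)
  also have "\<dots> = (\<Prod>i<d. real ?q ^ ?e i)"
    by (rule prod.cong[OF refl], rule absv_jinv_adjT_iter_R) simp
  also have "\<dots> = real ?q ^ (\<Sum>i<d. ?e i)" by (simp only: power_sum)
  also have "(\<Sum>i<d. ?e i) = d * (?q\<^sup>2 + ?q) + (\<Sum>i<d. geom_exp ?q i) * ?q\<^sup>2 + d"
    by (simp only: sum.distrib sum_distrib_right[symmetric]) (simp add: n algebra_simps)
  also have "(\<Prod>i<d. ?c i) = real ?q ^ (\<Sum>i<d - 1. geom_exp ?q (Suc i))"
    by (simp add: n power_sum)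
  finally show ?thesis .
qed

lemma normj_neq:
  assumes B: "lattice_module B" and nc: "\<forall>i<d. \<not> same_class f (a_ideal f d i) B"
  shows "normj f d B \<noteq> normj f d R"
proof
  assume eq: "normj f d B = normj f d R"
  let ?q = "CARD('a)"
  let ?L = "\<lambda>i. adjT_iter i B"
  have q: "?q \<ge> 2" by (rule card_finite_field_ge2)
  have L: "lattice_module (?L i)" "fq_subspace (?L i)" for i
    using lattice_module_adjT_iter[OF B] R_module_fq_subspace[OF lattice_module_R_module] by auto
  define m where "m = (\<lambda>i. SOME m. ascent (?L i) m)"
  have m: "ascent (?L i) (m i)" for i unfolding m_def using lattice_module_ex_ascent[OF L(1)] by (rule someI_ex)
  have m_eq: "m i = n" if "ascent (?L i) n" for i n using ascent_unique[OF L(2) m that] .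
  have per: "m (i + d) = m i" for i
  proof (rule m_eq)
    have "?L (i + d) = (*) (inverse f) ` ?L i"
      using adjT_iter_d[OF lattice_module_R_module[OF B]] by (simp add: funpow_add adjT_iter_image_scale)
    then show "ascent (?L (i + d)) (m i)" using ascent_image_scale[OF m[of i], of "inverse f"] f_nonzero by simp
  qed
  have step: "m i = k" if "m (Suc i) = Suc k" for i k
  proof (rule m_eq)
    have "ascent (adjT (?L i)) (Suc k)" using m[of "Suc i"] that by simp
    then show "ascent (?L i) k" by (rule ascent_adjT[OF lattice_module_R_module[OF L(1)]])
  qed
  \<comment> \<open>A value m i \<ge> d - 1 would make the i-th lattice a multiple of (1,T)^(d-1),
    and then \<open>B\<close> would lie in one of the excluded classes.\<close>
  have bound_lt: "Suc (m i) < d" if i: "i < d" for i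
  proof (rule ccontr)
    assume "\<not> Suc (m i) < d"
    then have md: "j < d \<Longrightarrow> j \<le> m i" for j by simp
    obtain x where x: "shortest (?L i) x" "\<forall>j\<le>m i. x * Tx ^ j \<in> ?L i" using m[of i] by (auto simp: ascent_def)
    have e: "?L i = (*) x ` adjT_iter (d - 1) R"
      using x(2) md by (intro full_module[OF L(1) x(1)]) blast
    have "x \<in> K" "x \<noteq> 0" using x(1) L(1)[of i] by (auto simp: shortest_def lattice_module_def)
    then have "same_class f (a_ideal f d (d - 1 - i)) B" by (intro same_class_if_full[OF B i _ _ e])
    moreover have "d - 1 - i < d" using d by simp
    ultimately show False using nc by blast
  qed
  have mod: "m (i mod d) = m i" for i
  proof -
    have "m (j + k * d) = m j" for j k
    proof (induction k)
      case (Suc k)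
      have "j + Suc k * d = (j + k * d) + d" by simp
      then show ?case using per[of "j + k * d"] Suc by (simp only:)
    qed simp
    from this[of "i mod d" "i div d"] show ?thesis by simp
  qed
  have bound: "Suc (m i) < d" for i
    using bound_lt[of "i mod d"] mod[of i] d by simp
  \<comment> \<open>The case d = 1 is already contradictory here: every lattice would be
    full.\<close>
  have d2: "d \<ge> 2" using bound[of 0] by simp
  have "(\<Sum>i<d. geom_exp ?q (m i)) \<le> (\<Sum>i<d - 1. geom_exp ?q i)"
    by (rule sum_cyclic_runs_le[of d "geom_exp ?q" m, OF d geom_exp_mono geom_exp_0 per step bound])
  then have lt: "(\<Sum>i<d. geom_exp ?q (m i)) * ?q\<^sup>2 + d * d + (\<Sum>i<d - 1. geom_exp ?q (Suc i))
      < (\<Sum>i<d. geom_exp ?q i) * ?q\<^sup>2 + d"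
    by (rule exponent_inequality[OF q d2])
  \<comment> \<open>Multiplication by q^?S clears the denominator in the exact value for
    \<open>R\<close>, so that the two norms are compared through natural exponents.\<close>
  let ?S = "\<Sum>i<d - 1. geom_exp ?q (Suc i)"
  have "absv (normj f d B) \<le> (\<Prod>i<d. real ?q ^ (?q\<^sup>2 + ?q + geom_exp ?q (m i) * ?q\<^sup>2 + d))"
    unfolding normj_eq[OF B] absv_prod using absv_jinv_lattice_module_le[OF L(1) m] by (intro prod_mono) auto
  also have "\<dots> = real ?q ^ (d * (?q\<^sup>2 + ?q) + (\<Sum>i<d. geom_exp ?q (m i)) * ?q\<^sup>2 + d * d)"
    unfolding power_sum[symmetric] sum.distrib sum_distrib_right[symmetric] by (simp add: algebra_simps)
  finally have "absv (normj f d B) * real ?q ^ ?S \<le>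
      real ?q ^ (d * (?q\<^sup>2 + ?q) + (\<Sum>i<d. geom_exp ?q (m i)) * ?q\<^sup>2 + d * d) * real ?q ^ ?S"
    by (rule mult_right_mono) simp
  also have "\<dots> = real ?q ^ (d * (?q\<^sup>2 + ?q) + ((\<Sum>i<d. geom_exp ?q (m i)) * ?q\<^sup>2 + d * d + ?S))"
    by (simp only: power_add[symmetric] add.assoc)
  also have "\<dots> < real ?q ^ (d * (?q\<^sup>2 + ?q) + ((\<Sum>i<d. geom_exp ?q i) * ?q\<^sup>2 + d))"
    using lt q by (intro power_strict_increasing) auto
  also have "\<dots> = absv (normj f d R) * real ?q ^ ?S"
    unfolding absv_normj_R by (simp only: add.assoc)
  finally show False unfolding eq by simp
qed

end

theorem theorem6:
  fixes f :: "'a::{finite,field} fls" and a :: "'a poly" and b :: 'a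
    and d :: nat and B :: "'a fls set"
  assumes "d \<ge> 1" and "degree a = d" and "lead_coeff a = 1" and "b \<noteq> 0"
    and "f ^ 2 = polyA a * f + fls_const b"
    and "f \<notin> kset"
    and "fls_subdegree f = - int d"
    and "frac_ideal f d B"
    and "\<forall>i<d. \<not> same_class f (a_ideal f d i) B"
  shows "normj f d B \<noteq> normj f d (Ainf1 f d)"
proof -
  interpret quad f a b d
    by unfold_locales (use assms in auto)
  show ?thesis using normj_neq[OF lattice_module_frac_ideal[OF assms(8)] assms(9)] .
qed

end
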